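(* For consistent RE theories (with "$P$ implies $Q$" meaning every consistent RE theory with $P$ has $Q$, and "$P$ does not imply $Q$" meaning some consistent RE theory has $P$ but not $Q$): (1) EU does not imply Creative. (2) Creative does not imply EU. (3) EU does not imply $\mathbf{0}'$. (4) $\mathbf{0}'$ does not imply EU. (5) EU does not imply REW. (6) REW does not imply EU. (7) EU does not imply any one of RFD, RSS, RSW. (8) Each of RFD and RSS implies EU. (9) RSW does not imply EU.
   Context: All theories are first-order RE theories; sentences identified with Gödel numbers; $T_P=\{\ulcorner\phi\urcorner:T\vdash\phi\}$. A consistent RE theory $T$ is: EU if every consistent RE extension of $T$ in the same language is undecidable; Creative if $T_P$ is creative; $\mathbf{0}'$ if $T$ has Turing degree $\mathbf{0}'$. For theories whose language contains $\mathbf{0}$ and unary $\mathbf{S}$, $\overline{n}=\mathbf{S}^n\mathbf{0}$: $A$ weakly representable if some $\phi(x)$ has $n\in A\iff T\vdash\phi(\overline{n})$; strongly representable if some $\phi(x)$ has $n\in A\Rightarrow T\vdash\phi(\overline{n})$, $n\notin A\Rightarrow T\vdash\neg\phi(\overline{n})$; total $f$ definable if some $\phi(\vec x,y)$ has $T\vdash\forall y[\phi(\overline{\vec a},y)\leftrightarrow y=\overline{f(\vec a)}]$ for all $\vec a$. REW: every RE set weakly representable; RFD: every recursive function definable; RSS: every recursive set strongly representable; RSW: every recursive set weakly representable.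
   Formalization: In (8), "RFD implies EU" is proved for theories that also prove 0 ≠ S0; without this it fails, since the decidable theory "all elements are equal" defines every total function by y = y. All other items are as stated. *)

theory Defs
  imports Main "HOL-Library.Nat_Bijection"
begin

section \<open>Computability\<close>

text \<open>Programs for the mu-recursive functions, with a query instruction for an oracle set.\<close>

datatype prog =
    Zero
  | Succ
  | Proj nat
  | Query
  | Comp prog "prog list"
  | PrimRec prog prog
  | Mu prog

inductive computes :: "nat set \<Rightarrow> prog \<Rightarrow> nat list \<Rightarrow> nat \<Rightarrow> bool"
  for X :: "nat set"
where
  zero: "computes X Zero xs 0"
| succ: "computes X Succ [x] (Suc x)"
| proj: "i < length xs \<Longrightarrow> computes X (Proj i) xs (xs ! i)"
| query: "computes X Query [x] (if x \<in> X then 1 else 0)"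
| comp: "list_all2 (\<lambda>g y. computes X g xs y) gs ys \<Longrightarrow> computes X f ys z
    \<Longrightarrow> computes X (Comp f gs) xs z"
| primrec_0: "computes X f xs y \<Longrightarrow> computes X (PrimRec f g) (0 # xs) y"
| primrec_Suc: "computes X (PrimRec f g) (n # xs) r \<Longrightarrow> computes X g (r # n # xs) y
    \<Longrightarrow> computes X (PrimRec f g) (Suc n # xs) y"
| mu: "computes X f (n # xs) 0 \<Longrightarrow> (\<forall>m<n. \<exists>y. computes X f (m # xs) (Suc y))
    \<Longrightarrow> computes X (Mu f) xs n"

fun prog_code :: "prog \<Rightarrow> nat" where
  "prog_code Zero = prod_encode (0, 0)"
| "prog_code Succ = prod_encode (1, 0)"
| "prog_code (Proj i) = prod_encode (2, i)"
| "prog_code Query = prod_encode (3, 0)"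
| "prog_code (Comp f gs) = prod_encode (4, prod_encode (prog_code f, list_encode (map prog_code gs)))"
| "prog_code (PrimRec f g) = prod_encode (5, prod_encode (prog_code f, prog_code g))"
| "prog_code (Mu f) = prod_encode (6, prog_code f)"

text \<open>With the empty oracle a query always returns 0, so \<open>computes {}\<close> yields exactly the
  partial recursive functions. A number that is not the code of a program is an index of
  the empty set.\<close>

definition W :: "nat \<Rightarrow> nat set" where
  "W e = {x. \<exists>p y. prog_code p = e \<and> computes {} p [x] y}"

definition re_set :: "nat set \<Rightarrow> bool" where
  "re_set A \<longleftrightarrow> (\<exists>e. A = W e)"

text \<open>Functions of arity \<open>k\<close> are represented by functions on lists, of which only the values
  at lists of length \<open>k\<close> matter.\<close>

definition recursive_fun :: "nat \<Rightarrow> (nat list \<Rightarrow> nat) \<Rightarrow> bool" where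
  "recursive_fun k f \<longleftrightarrow> (\<exists>p. \<forall>xs. length xs = k \<longrightarrow> computes {} p xs (f xs))"

definition turing_le :: "nat set \<Rightarrow> nat set \<Rightarrow> bool" where
  "turing_le A B \<longleftrightarrow> (\<exists>p. \<forall>x. computes B p [x] (if x \<in> A then 1 else 0))"

definition recursive_set :: "nat set \<Rightarrow> bool" where
  "recursive_set A \<longleftrightarrow> recursive_fun 1 (\<lambda>xs. if hd xs \<in> A then 1 else 0)"

definition halting_set :: "nat set" where
  "halting_set = {e. e \<in> W e}"

definition degree_zero_jump :: "nat set \<Rightarrow> bool" where
  "degree_zero_jump A \<longleftrightarrow> turing_le A halting_set \<and> turing_le halting_set A"

definition creative_set :: "nat set \<Rightarrow> bool" where
  "creative_set A \<longleftrightarrow> re_set A \<and>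
     (\<exists>f. recursive_fun 1 f \<and> (\<forall>e. W e \<inter> A = {} \<longrightarrow> f [e] \<notin> A \<union> W e))"


section \<open>First-order logic with equality\<close>

text \<open>Variables are de Bruijn indices. A function or relation symbol is a pair of a name and
  an arity; constants are function symbols of arity 0. The arity of an occurrence is the
  length of its argument list.\<close>

datatype tm = Var nat | Fun nat "tm list"

datatype fm =
    Eq tm tm
  | Rel nat "tm list"
  | Fls
  | Imp fm fm
  | All fm

abbreviation Neg :: "fm \<Rightarrow> fm" where
  "Neg \<phi> \<equiv> Imp \<phi> Fls"

abbreviation Conj :: "fm \<Rightarrow> fm \<Rightarrow> fm" where
  "Conj \<phi> \<psi> \<equiv> Neg (Imp \<phi> (Neg \<psi>))"

abbreviation Iff :: "fm \<Rightarrow> fm \<Rightarrow> fm" where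
  "Iff \<phi> \<psi> \<equiv> Conj (Imp \<phi> \<psi>) (Imp \<psi> \<phi>)"

fun subst_tm :: "(nat \<Rightarrow> tm) \<Rightarrow> tm \<Rightarrow> tm" where
  "subst_tm \<sigma> (Var n) = \<sigma> n"
| "subst_tm \<sigma> (Fun f ts) = Fun f (map (subst_tm \<sigma>) ts)"

definition up :: "(nat \<Rightarrow> tm) \<Rightarrow> nat \<Rightarrow> tm" where
  "up \<sigma> = case_nat (Var 0) (\<lambda>n. subst_tm (\<lambda>m. Var (Suc m)) (\<sigma> n))"

text \<open>Simultaneous capture-avoiding substitution.\<close>

fun subst_fm :: "(nat \<Rightarrow> tm) \<Rightarrow> fm \<Rightarrow> fm" where
  "subst_fm \<sigma> (Eq t u) = Eq (subst_tm \<sigma> t) (subst_tm \<sigma> u)"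
| "subst_fm \<sigma> (Rel r ts) = Rel r (map (subst_tm \<sigma>) ts)"
| "subst_fm \<sigma> Fls = Fls"
| "subst_fm \<sigma> (Imp \<phi> \<psi>) = Imp (subst_fm \<sigma> \<phi>) (subst_fm \<sigma> \<psi>)"
| "subst_fm \<sigma> (All \<phi>) = All (subst_fm (up \<sigma>) \<phi>)"

definition lift :: "fm \<Rightarrow> fm" where
  "lift \<phi> = subst_fm (\<lambda>n. Var (Suc n)) \<phi>"

text \<open>Replaces variable 0 by \<open>t\<close> and lowers the other variables by one.\<close>

definition inst :: "tm \<Rightarrow> fm \<Rightarrow> fm" where
  "inst t \<phi> = subst_fm (case_nat t Var) \<phi>"

text \<open>Classical natural deduction. Intermediate formulas may use symbols that do not occur in
  the premises or the conclusion; by conservativity of first-order logic this does not affect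
  which sentences of a given language are provable from axioms in that language.\<close>

inductive provable :: "fm set \<Rightarrow> fm \<Rightarrow> bool" (infix "\<turnstile>" 50) where
  assm: "\<phi> \<in> \<Gamma> \<Longrightarrow> \<Gamma> \<turnstile> \<phi>"
| imp_intro: "insert \<phi> \<Gamma> \<turnstile> \<psi> \<Longrightarrow> \<Gamma> \<turnstile> Imp \<phi> \<psi>"
| imp_elim: "\<Gamma> \<turnstile> Imp \<phi> \<psi> \<Longrightarrow> \<Gamma> \<turnstile> \<phi> \<Longrightarrow> \<Gamma> \<turnstile> \<psi>"
| classical: "insert (Neg \<phi>) \<Gamma> \<turnstile> Fls \<Longrightarrow> \<Gamma> \<turnstile> \<phi>"
| all_intro: "lift ` \<Gamma> \<turnstile> \<phi> \<Longrightarrow> \<Gamma> \<turnstile> All \<phi>"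
| all_elim: "\<Gamma> \<turnstile> All \<phi> \<Longrightarrow> \<Gamma> \<turnstile> inst t \<phi>"
| eq_intro: "\<Gamma> \<turnstile> Eq t t"
| eq_elim: "\<Gamma> \<turnstile> Eq t u \<Longrightarrow> \<Gamma> \<turnstile> inst t \<phi> \<Longrightarrow> \<Gamma> \<turnstile> inst u \<phi>"

record lang =
  funs :: "(nat \<times> nat) set"
  rels :: "(nat \<times> nat) set"

text \<open>\<open>tm_in L k\<close> and \<open>fm_in L k\<close>: terms and formulas of the language \<open>L\<close> whose free variables
  are among those with indices \<open>0, \<dots>, k - 1\<close>.\<close>

fun tm_in :: "lang \<Rightarrow> nat \<Rightarrow> tm \<Rightarrow> bool" where
  "tm_in L k (Var n) \<longleftrightarrow> n < k"
| "tm_in L k (Fun f ts) \<longleftrightarrow> (f, length ts) \<in> funs L \<and> (\<forall>t \<in> set ts. tm_in L k t)"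

fun fm_in :: "lang \<Rightarrow> nat \<Rightarrow> fm \<Rightarrow> bool" where
  "fm_in L k (Eq t u) \<longleftrightarrow> tm_in L k t \<and> tm_in L k u"
| "fm_in L k (Rel r ts) \<longleftrightarrow> (r, length ts) \<in> rels L \<and> (\<forall>t \<in> set ts. tm_in L k t)"
| "fm_in L k Fls \<longleftrightarrow> True"
| "fm_in L k (Imp \<phi> \<psi>) \<longleftrightarrow> fm_in L k \<phi> \<and> fm_in L k \<psi>"
| "fm_in L k (All \<phi>) \<longleftrightarrow> fm_in L (Suc k) \<phi>"

abbreviation sentence :: "lang \<Rightarrow> fm \<Rightarrow> bool" where
  "sentence L \<phi> \<equiv> fm_in L 0 \<phi>"

fun tm_code :: "tm \<Rightarrow> nat" where
  "tm_code (Var n) = prod_encode (0, n)"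
| "tm_code (Fun f ts) = prod_encode (Suc f, list_encode (map tm_code ts))"

fun fm_code :: "fm \<Rightarrow> nat" where
  "fm_code (Eq t u) = prod_encode (0, prod_encode (tm_code t, tm_code u))"
| "fm_code (Rel r ts) = prod_encode (1, prod_encode (r, list_encode (map tm_code ts)))"
| "fm_code Fls = prod_encode (2, 0)"
| "fm_code (Imp \<phi> \<psi>) = prod_encode (3, prod_encode (fm_code \<phi>, fm_code \<psi>))"
| "fm_code (All \<phi>) = prod_encode (4, fm_code \<phi>)"


section \<open>RE theories\<close>

definition recursive_lang :: "lang \<Rightarrow> bool" where
  "recursive_lang L \<longleftrightarrow>
     recursive_set (prod_encode ` funs L) \<and> recursive_set (prod_encode ` rels L)"

text \<open>A theory is given by its language and a set of axioms, which need not be deductively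
  closed.\<close>

definition re_theory :: "lang \<Rightarrow> fm set \<Rightarrow> bool" where
  "re_theory L T \<longleftrightarrow>
     recursive_lang L \<and> (\<forall>\<phi> \<in> T. sentence L \<phi>) \<and> re_set (fm_code ` T)"

definition consistent :: "fm set \<Rightarrow> bool" where
  "consistent T \<longleftrightarrow> \<not> T \<turnstile> Fls"

definition con_re_theory :: "lang \<Rightarrow> fm set \<Rightarrow> bool" where
  "con_re_theory L T \<longleftrightarrow> re_theory L T \<and> consistent T"

definition theorem_codes :: "lang \<Rightarrow> fm set \<Rightarrow> nat set" where
  "theorem_codes L T = fm_code ` {\<phi>. sentence L \<phi> \<and> T \<turnstile> \<phi>}"

definition decidable_theory :: "lang \<Rightarrow> fm set \<Rightarrow> bool" where
  "decidable_theory L T \<longleftrightarrow> recursive_set (theorem_codes L T)"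

definition extends :: "fm set \<Rightarrow> fm set \<Rightarrow> bool" where
  "extends S T \<longleftrightarrow> (\<forall>\<phi>. T \<turnstile> \<phi> \<longrightarrow> S \<turnstile> \<phi>)"

definition EU :: "lang \<Rightarrow> fm set \<Rightarrow> bool" where
  "EU L T \<longleftrightarrow> (\<forall>S. con_re_theory L S \<and> extends S T \<longrightarrow> \<not> decidable_theory L S)"

definition Creative :: "lang \<Rightarrow> fm set \<Rightarrow> bool" where
  "Creative L T \<longleftrightarrow> creative_set (theorem_codes L T)"

definition Zero_Jump :: "lang \<Rightarrow> fm set \<Rightarrow> bool" where
  "Zero_Jump L T \<longleftrightarrow> degree_zero_jump (theorem_codes L T)"


section \<open>Representability\<close>

text \<open>The constant \<open>\<zero>\<close> and the unary \<open>S\<close> are the function symbols with names 0 and 1.\<close>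

definition has_numerals :: "lang \<Rightarrow> bool" where
  "has_numerals L \<longleftrightarrow> (0, 0) \<in> funs L \<and> (1, 1) \<in> funs L"

fun num :: "nat \<Rightarrow> tm" where
  "num 0 = Fun 0 []"
| "num (Suc n) = Fun 1 [num n]"

definition weakly_representable :: "lang \<Rightarrow> fm set \<Rightarrow> nat set \<Rightarrow> bool" where
  "weakly_representable L T A \<longleftrightarrow>
     (\<exists>\<phi>. fm_in L 1 \<phi> \<and> (\<forall>n. n \<in> A \<longleftrightarrow> T \<turnstile> inst (num n) \<phi>))"

definition strongly_representable :: "lang \<Rightarrow> fm set \<Rightarrow> nat set \<Rightarrow> bool" where
  "strongly_representable L T A \<longleftrightarrow>
     (\<exists>\<phi>. fm_in L 1 \<phi> \<and>
        (\<forall>n. (n \<in> A \<longrightarrow> T \<turnstile> inst (num n) \<phi>) \<and> (n \<notin> A \<longrightarrow> T \<turnstile> Neg (inst (num n) \<phi>))))"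

text \<open>In the defining formula of a \<open>k\<close>-ary function, variable 0 is the value \<open>y\<close> and variables
  \<open>1, \<dots>, k\<close> are the arguments, for which the substitution puts numerals while keeping \<open>y\<close>.
  If \<open>T\<close> proves that all elements are equal, every function is definable in this sense (take
  \<open>y = y\<close>), so definability of all recursive functions has consequences only together
  with a nontriviality condition such as \<open>T \<turnstile> Neg (Eq (num 0) (num 1))\<close>.\<close>

definition definable_fun :: "lang \<Rightarrow> fm set \<Rightarrow> nat \<Rightarrow> (nat list \<Rightarrow> nat) \<Rightarrow> bool" where
  "definable_fun L T k f \<longleftrightarrow>
     (\<exists>\<phi>. fm_in L (Suc k) \<phi> \<and>
        (\<forall>as. length as = k \<longrightarrow>
           T \<turnstile> All (Iff (subst_fm (case_nat (Var 0) (\<lambda>i. num (as ! i))) \<phi>)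
                        (Eq (Var 0) (num (f as))))))"

definition REW :: "lang \<Rightarrow> fm set \<Rightarrow> bool" where
  "REW L T \<longleftrightarrow> (\<forall>A. re_set A \<longrightarrow> weakly_representable L T A)"

definition RFD :: "lang \<Rightarrow> fm set \<Rightarrow> bool" where
  "RFD L T \<longleftrightarrow> (\<forall>k f. recursive_fun k f \<longrightarrow> definable_fun L T k f)"

definition RSS :: "lang \<Rightarrow> fm set \<Rightarrow> bool" where
  "RSS L T \<longleftrightarrow> (\<forall>A. recursive_set A \<longrightarrow> strongly_representable L T A)"

definition RSW :: "lang \<Rightarrow> fm set \<Rightarrow> bool" where
  "RSW L T \<longleftrightarrow> (\<forall>A. recursive_set A \<longrightarrow> weakly_representable L T A)"

end

theory Submission imports Defs begin

text \<open>
  The separating examples are theories of literals over infinitely many predicates, in which a set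
  \<open>D\<close> of numbers decides which atoms \<open>R\<^sub>x(0)\<close> are asserted (\<open>2 x \<in> D\<close>) and which are refuted
  (\<open>2 x + 1 \<in> D\<close>). Adding the axiom that there is only one element turns provability into a
  tautology test, so that the theory has the Turing degree of \<open>D\<close>. It is essentially undecidable as
  soon as no recursive set separates the two sides. A finite injury construction in the style of the
  low simple set yields such a \<open>D\<close> with a jump that is a limit of a recursive function; hence the
  theory is not Turing complete, hence not creative. If on the other hand only the atoms \<open>R\<^sub>x(0)\<close>
  with \<open>x\<close> in the halting set are asserted, the theory is creative but has the decidable extension in
  which all predicates hold. The same extension serves the theory with axioms \<open>R\<^sub>e(n)\<close> for \<open>n \<in> W e\<close>,
  in which every RE set is weakly representable. Without the one-element axiom but with
  \<open>0 = 2 \<noteq> 1\<close>, an essentially undecidable theory represents nothing that separates 0 from 2.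
  Conversely, strong representability of the recursive sets gives essential undecidability by
  diagonalising against a decision procedure for an extension.\<close>

section \<open>Relative computability\<close>

text \<open>Defeating every recursive separator is easy; the difficulty is to do so without coding
  the halting set. The usual inseparable pair, two values of a diagonal function, makes the theory
  Turing complete. Hence each program gets a column of its own, where a number is placed on the side
  that contradicts its output, and a restraint protects the computation of program \<open>e\<close>
  on input \<open>e\<close> from \<open>low_set\<close>. Only columns below \<open>e\<close> may
  violate that restraint, and each column acts at a single stage, so the injuries are finite. The
  one-element axiom bounds the degree from above: quantifiers become vacuous, so a sentence with
  code \<open>n\<close> is settled by the atoms up to \<open>n\<close>, with finitely many queries
  to \<open>D\<close>. The price is that all numerals coincide and every function is trivially
  definable; this is why the failure of definability takes a second theory, whose two-element model
  keeps 0 and 1 apart.\<close>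

inductive_cases computes_Zero: "computes X Zero xs y"
inductive_cases computes_Succ: "computes X Succ xs y"
inductive_cases computes_Proj: "computes X (Proj i) xs y"
inductive_cases computes_Query: "computes X Query xs y"
inductive_cases computes_Comp: "computes X (Comp f gs) xs y"
inductive_cases computes_PrimRec_0: "computes X (PrimRec f g) (0 # xs) y"
inductive_cases computes_PrimRec_Suc: "computes X (PrimRec f g) (Suc n # xs) y"
inductive_cases computes_Mu: "computes X (Mu f) xs y"

lemma computes_deterministic:
  "computes X p xs y \<Longrightarrow> computes X p xs z \<Longrightarrow> y = z"
proof (induction arbitrary: z rule: computes.induct)
  case (comp xs gs ys f y)
  from comp.prems obtain zs where
    zs: "list_all2 (\<lambda>g y. computes X g xs y) gs zs" "computes X f zs z"
    by (rule computes_Comp)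
  have "ys = zs"
  proof (rule nth_equalityI)
    show "length ys = length zs"
      using comp.IH(1) zs(1) by (simp add: list_all2_conv_all_nth)
    fix i assume "i < length ys"
    then show "ys ! i = zs ! i"
      using comp.IH(1) zs(1) by (auto simp: list_all2_conv_all_nth)
  qed
  then show ?case using comp.IH(2) zs(2) by blast
next
  case (primrec_Suc f g n xs r y)
  from primrec_Suc.prems obtain r' where "computes X (PrimRec f g) (n # xs) r'"
    "computes X g (r' # n # xs) z" by (rule computes_PrimRec_Suc)
  then show ?case using primrec_Suc.IH by blast
next
  case (mu f n xs)
  from mu.prems have z: "computes X f (z # xs) 0" "\<forall>m<z. \<exists>y. computes X f (m # xs) (Suc y)"
    by (auto elim: computes_Mu)
  show ?case
  proof (rule linorder_cases[of n z])
    assume "n < z"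
    then show ?thesis using z(2) mu.IH(1) by (metis nat.distinct(1))
  next
    assume "z < n"
    then show ?thesis using z(1) mu.IH(2) by (metis nat.distinct(1))
  qed
next
  case (primrec_0 f xs y g)
  from primrec_0.prems show ?case by (rule computes_PrimRec_0) (rule primrec_0.IH)
qed (auto elim: computes_Zero computes_Succ computes_Proj computes_Query)

section \<open>Closure properties of the total functions recursive in an oracle\<close>

definition rec_in :: "nat set \<Rightarrow> nat \<Rightarrow> (nat list \<Rightarrow> nat) \<Rightarrow> bool" where
  "rec_in X k f \<longleftrightarrow> (\<exists>p. \<forall>xs. length xs = k \<longrightarrow> computes X p xs (f xs))"

text \<open>\<open>PrimRec\<close> and \<open>Mu\<close> force the k-ary version
  \<open>rec_in\<close>. The unary one, with arguments packed by \<open>prod_encode\<close>, is what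
  later proofs use, since its rules apply by backward chaining on the body of a function.\<close>

definition computable :: "nat set \<Rightarrow> (nat \<Rightarrow> nat) \<Rightarrow> bool" where
  "computable X f \<longleftrightarrow> (\<exists>p. \<forall>x. computes X p [x] (f x))"

definition decidable :: "nat set \<Rightarrow> (nat \<Rightarrow> bool) \<Rightarrow> bool" where
  "decidable X P \<longleftrightarrow> computable X (\<lambda>x. if P x then 1 else 0)"

lemma rec_in_cong:
  assumes "rec_in X k f" "\<And>xs. length xs = k \<Longrightarrow> f xs = g xs"
  shows "rec_in X k g"
  using assms unfolding rec_in_def by metis

lemma rec_in_proj: "i < k \<Longrightarrow> rec_in X k (\<lambda>xs. xs ! i)"
  unfolding rec_in_def by (auto intro!: exI[of _ "Proj i"] computes.intros)

lemma rec_in_zero: "rec_in X k (\<lambda>xs. 0)"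
  unfolding rec_in_def by (auto intro!: exI[of _ Zero] computes.intros)

lemma rec_in_comp1:
  assumes "rec_in X 1 (\<lambda>xs. F (xs ! 0))" "rec_in X k f"
  shows "rec_in X k (\<lambda>xs. F (f xs))"
proof -
  obtain p q where "\<And>xs. length xs = 1 \<Longrightarrow> computes X p xs (F (xs ! 0))"
    and "\<And>xs. length xs = k \<Longrightarrow> computes X q xs (f xs)"
    using assms unfolding rec_in_def by auto
  from this(1)[of "[f _]"] this(2)
  have "computes X (Comp p [q]) xs (F (f xs))" if "length xs = k" for xs
    using that by (auto intro!: computes.comp[where ys = "[f xs]"])
  then show ?thesis unfolding rec_in_def by blast
qed

lemma rec_in_comp2:
  assumes "rec_in X 2 (\<lambda>xs. F (xs ! 0) (xs ! 1))" "rec_in X k f" "rec_in X k g"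
  shows "rec_in X k (\<lambda>xs. F (f xs) (g xs))"
proof -
  obtain p q r where "\<And>xs. length xs = 2 \<Longrightarrow> computes X p xs (F (xs ! 0) (xs ! 1))"
    and "\<And>xs. length xs = k \<Longrightarrow> computes X q xs (f xs)"
    and "\<And>xs. length xs = k \<Longrightarrow> computes X r xs (g xs)"
    using assms unfolding rec_in_def by auto
  from this(1)[of "[f _, g _]"] this(2,3)
  have "computes X (Comp p [q, r]) xs (F (f xs) (g xs))" if "length xs = k" for xs
    using that by (auto intro!: computes.comp[where ys = "[f xs, g xs]"])
  then show ?thesis unfolding rec_in_def by blast
qed

lemma rec_in_Suc: "rec_in X k f \<Longrightarrow> rec_in X k (\<lambda>xs. Suc (f xs))"
proof (erule rec_in_comp1[where F = Suc, rotated])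
  have "computes X Succ xs (Suc (xs ! 0))" if "length xs = 1" for xs
    using that computes.succ[of X "xs ! 0"] by (cases xs) auto
  then show "rec_in X 1 (\<lambda>xs. Suc (xs ! 0))" unfolding rec_in_def by blast
qed

lemma rec_in_const: "rec_in X k (\<lambda>xs. c)"
  by (induction c) (auto intro: rec_in_zero rec_in_Suc)

lemma rec_in_primrec:
  assumes "rec_in X k f" "rec_in X (Suc (Suc k)) g"
  shows "rec_in X (Suc k) (\<lambda>xs. rec_nat (f (tl xs)) (\<lambda>n r. g (r # n # tl xs)) (hd xs))"
proof -
  obtain p q where pq: "\<And>xs. length xs = k \<Longrightarrow> computes X p xs (f xs)"
    "\<And>xs. length xs = Suc (Suc k) \<Longrightarrow> computes X q xs (g xs)"
    using assms unfolding rec_in_def by auto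
  have main: "computes X (PrimRec p q) (n # xs) (rec_nat (f xs) (\<lambda>n r. g (r # n # xs)) n)"
    if "length xs = k" for xs n
    by (induction n) (auto intro!: computes.intros pq that)
  have "computes X (PrimRec p q) xs (rec_nat (f (tl xs)) (\<lambda>n r. g (r # n # tl xs)) (hd xs))"
    if "length xs = Suc k" for xs using that main by (cases xs) auto
  then show ?thesis unfolding rec_in_def by blast
qed

lemma rec_in_Least:
  assumes "rec_in X (Suc k) f" and ex: "\<And>xs. length xs = k \<Longrightarrow> \<exists>n. f (n # xs) = 0"
  shows "rec_in X k (\<lambda>xs. LEAST n. f (n # xs) = 0)"
proof -
  obtain p where p: "\<And>xs. length xs = Suc k \<Longrightarrow> computes X p xs (f xs)"
    using assms unfolding rec_in_def by auto
  have "computes X (Mu p) xs (LEAST n. f (n # xs) = 0)" if "length xs = k" for xs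
  proof (rule computes.mu)
    have "f ((LEAST n. f (n # xs) = 0) # xs) = 0"
      using ex[OF that] by (rule LeastI_ex)
    then show "computes X p ((LEAST n. f (n # xs) = 0) # xs) 0"
      using p that by (metis length_Cons)
    show "\<forall>m<LEAST n. f (n # xs) = 0. \<exists>y. computes X p (m # xs) (Suc y)"
    proof (intro allI impI)
      fix m assume "m < (LEAST n. f (n # xs) = 0)"
      then have "f (m # xs) \<noteq> 0" by (rule not_less_Least)
      then obtain y where "f (m # xs) = Suc y" using not0_implies_Suc by blast
      then show "\<exists>y. computes X p (m # xs) (Suc y)"
        using p[of "m # xs"] that by auto
    qed
  qed
  then show ?thesis unfolding rec_in_def by blast
qed

lemma length_2_conv: "length xs = 2 \<longleftrightarrow> (\<exists>x y. xs = [x, y])"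
  by (auto simp: numeral_2_eq_2 length_Suc_conv)

lemma rec_in_add2: "rec_in X 2 (\<lambda>xs. xs ! 0 + xs ! 1)"
proof (rule rec_in_cong)
  show "rec_in X 2 (\<lambda>xs. rec_nat (tl xs ! 0) (\<lambda>n r. Suc ((r # n # tl xs) ! 0)) (hd xs))"
    unfolding numeral_2_eq_2
    by (rule rec_in_primrec[where f = "\<lambda>xs. xs ! 0" and g = "\<lambda>xs. Suc (xs ! 0)"])
      (auto intro!: rec_in_proj rec_in_Suc)
  have "rec_nat b (\<lambda>n. Suc) a = a + b" for a b by (induction a) auto
  then show "rec_nat (tl xs ! 0) (\<lambda>n r. Suc ((r # n # tl xs) ! 0)) (hd xs) = xs ! 0 + xs ! 1"
    if "length xs = 2" for xs using that by (auto simp: length_2_conv)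
qed

lemmas rec_in_add = rec_in_comp2[OF rec_in_add2]

lemma rec_in_pred: "rec_in X k f \<Longrightarrow> rec_in X k (\<lambda>xs. f xs - 1)"
proof (erule rec_in_comp1[where F = "\<lambda>x. x - 1", rotated])
  show "rec_in X 1 (\<lambda>xs. xs ! 0 - 1)"
  proof (rule rec_in_cong)
    show "rec_in X 1 (\<lambda>xs. rec_nat 0 (\<lambda>n r. (r # n # tl xs) ! 1) (hd xs))"
      unfolding One_nat_def
      by (rule rec_in_primrec[where g = "\<lambda>xs. xs ! Suc 0"]) (auto intro!: rec_in_proj rec_in_zero)
    have "rec_nat 0 (\<lambda>n r. n) a = a - 1" for a :: nat by (cases a) auto
    then show "rec_nat 0 (\<lambda>n r. (r # n # tl xs) ! 1) (hd xs) = xs ! 0 - 1"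
      if "length xs = 1" for xs using that by (cases xs) auto
  qed
qed

text \<open>\<open>PrimRec\<close> recurses on its first argument. Subtraction iterates the
  predecessor as often as the subtrahend says, so the subtrahend comes first and the arguments are
  swapped.\<close>

lemma rec_in_diff: "rec_in X k f \<Longrightarrow> rec_in X k g \<Longrightarrow> rec_in X k (\<lambda>xs. f xs - g xs)"
proof (erule rec_in_comp2[where F = "\<lambda>x y. y - x", rotated], assumption)
  show "rec_in X 2 (\<lambda>xs. xs ! 1 - xs ! 0)"
  proof (rule rec_in_cong)
    show "rec_in X 2 (\<lambda>xs. rec_nat (tl xs ! 0) (\<lambda>n r. ((r # n # tl xs) ! 0) - 1) (hd xs))"
      unfolding numeral_2_eq_2
      by (rule rec_in_primrec[where f = "\<lambda>xs. xs ! 0" and g = "\<lambda>xs. (xs ! 0) - 1"])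
        (intro rec_in_proj rec_in_pred, simp)+
    have "rec_nat b (\<lambda>n r. r - 1) a = b - a" for a b :: nat by (induction a) auto
    then show "rec_nat (tl xs ! 0) (\<lambda>n r. ((r # n # tl xs) ! 0) - 1) (hd xs) = xs ! 1 - xs ! 0"
      if "length xs = 2" for xs using that by (auto simp: length_2_conv)
  qed
qed

lemma rec_in_mult2: "rec_in X 2 (\<lambda>xs. xs ! 0 * xs ! 1)"
proof (rule rec_in_cong)
  show "rec_in X 2 (\<lambda>xs. rec_nat 0 (\<lambda>n r. (r # n # tl xs) ! 0 + (r # n # tl xs) ! 2) (hd xs))"
    unfolding numeral_2_eq_2
    by (rule rec_in_primrec[where g = "\<lambda>xs. xs ! 0 + xs ! Suc (Suc 0)"])
      (auto intro!: rec_in_proj rec_in_add rec_in_zero)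
  have "rec_nat 0 (\<lambda>n r. r + b) a = a * b" for a b :: nat by (induction a) auto
  then show "rec_nat 0 (\<lambda>n r. (r # n # tl xs) ! 0 + (r # n # tl xs) ! 2) (hd xs) = xs ! 0 * xs ! 1"
    if "length xs = 2" for xs using that by (auto simp: length_2_conv)
qed

lemmas rec_in_mult = rec_in_comp2[OF rec_in_mult2]

lemma rec_in_triangle: "rec_in X k f \<Longrightarrow> rec_in X k (\<lambda>xs. triangle (f xs))"
proof (erule rec_in_comp1[where F = triangle, rotated])
  show "rec_in X 1 (\<lambda>xs. triangle (xs ! 0))"
  proof (rule rec_in_cong)
    show "rec_in X 1 (\<lambda>xs. rec_nat 0 (\<lambda>n r. (r # n # tl xs) ! 0 + Suc ((r # n # tl xs) ! 1)) (hd xs))"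
      unfolding One_nat_def
      by (rule rec_in_primrec[where g = "\<lambda>xs. xs ! 0 + Suc (xs ! Suc 0)"])
        (auto intro!: rec_in_proj rec_in_add rec_in_Suc rec_in_zero)
    have "rec_nat 0 (\<lambda>n r. r + Suc n) a = triangle a" for a :: nat by (induction a) auto
    then show "rec_nat 0 (\<lambda>n r. (r # n # tl xs) ! 0 + Suc ((r # n # tl xs) ! 1)) (hd xs) = triangle (xs ! 0)"
      if "length xs = 1" for xs using that by (cases xs) auto
  qed
qed

lemma rec_in_pair2: "rec_in X 2 (\<lambda>xs. prod_encode (xs ! 0, xs ! 1))"
  unfolding prod_encode_def by (auto intro!: rec_in_proj rec_in_add rec_in_triangle)

lemma computable_iff_rec_in: "computable X f \<longleftrightarrow> rec_in X 1 (\<lambda>xs. f (xs ! 0))"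
proof
  assume "computable X f"
  then obtain p where "\<And>x. computes X p [x] (f x)" unfolding computable_def by blast
  then have "computes X p xs (f (xs ! 0))" if "length xs = 1" for xs
    using that by (cases xs) auto
  then show "rec_in X 1 (\<lambda>xs. f (xs ! 0))" unfolding rec_in_def by blast
next
  assume "rec_in X 1 (\<lambda>xs. f (xs ! 0))"
  then obtain p where "\<And>xs. length xs = 1 \<Longrightarrow> computes X p xs (f (xs ! 0))"
    unfolding rec_in_def by blast
  from this[of "[_]"] show "computable X f" unfolding computable_def by auto
qed

lemma computable_comp: "computable X F \<Longrightarrow> computable X f \<Longrightarrow> computable X (\<lambda>x. F (f x))"
  unfolding computable_iff_rec_in by (rule rec_in_comp1)

named_theorems computable_intros

lemma computable_const [computable_intros]: "computable X (\<lambda>x. c)"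
  unfolding computable_iff_rec_in by (rule rec_in_const)

lemma computable_id [computable_intros]: "computable X (\<lambda>x. x)"
  unfolding computable_iff_rec_in by (rule rec_in_proj) simp

lemma computable_Suc [computable_intros]: "computable X f \<Longrightarrow> computable X (\<lambda>x. Suc (f x))"
  unfolding computable_iff_rec_in by (rule rec_in_Suc)

lemma computable_add [computable_intros]:
  "computable X f \<Longrightarrow> computable X g \<Longrightarrow> computable X (\<lambda>x. f x + g x)"
  unfolding computable_iff_rec_in by (rule rec_in_add)

lemma computable_diff [computable_intros]:
  "computable X f \<Longrightarrow> computable X g \<Longrightarrow> computable X (\<lambda>x. f x - g x)"
  unfolding computable_iff_rec_in by (rule rec_in_diff)

lemma computable_mult [computable_intros]:
  "computable X f \<Longrightarrow> computable X g \<Longrightarrow> computable X (\<lambda>x. f x * g x)"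
  unfolding computable_iff_rec_in by (rule rec_in_mult)

lemma computable_pair [computable_intros]:
  "computable X f \<Longrightarrow> computable X g \<Longrightarrow> computable X (\<lambda>x. prod_encode (f x, g x))"
  unfolding computable_iff_rec_in by (rule rec_in_comp2[OF rec_in_pair2])

lemma triangle_mono: "m \<le> n \<Longrightarrow> triangle m \<le> triangle n"
  by (induction n) (auto simp: le_Suc_eq)

text \<open>Cantor pairing puts \<open>(m, n)\<close> on the diagonal \<open>t = m + n\<close>, at
  offset \<open>m\<close> after \<open>triangle t\<close>. The diagonal of \<open>z\<close> is the
  first \<open>t\<close> with \<open>triangle (Suc t)\<close> above \<open>z\<close>, which a search
  finds; this makes the decoding computable.\<close>

lemma prod_decode_triangle:
  assumes "t = (LEAST t. Suc z - triangle (Suc t) = 0)"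
  shows "prod_decode z = (z - triangle t, t - (z - triangle t))"
proof -
  obtain m n where mn: "z = prod_encode (m, n)" by (metis prod_decode_inverse surj_pair)
  have "t = m + n" unfolding assms
  proof (rule Least_equality)
    show "Suc z - triangle (Suc (m + n)) = 0" by (simp add: mn prod_encode_def)
    fix y assume y: "Suc z - triangle (Suc y) = 0"
    show "m + n \<le> y"
    proof (rule ccontr)
      assume "\<not> m + n \<le> y"
      then have "triangle (Suc y) \<le> triangle (m + n)" by (intro triangle_mono) simp
      with y show False by (simp add: mn prod_encode_def)
    qed
  qed
  then show ?thesis by (simp add: mn) (simp add: prod_encode_def)
qed

lemma computable_fst_snd_prod_decode:
  "computable X (\<lambda>x. fst (prod_decode x))" "computable X (\<lambda>x. snd (prod_decode x))"
proof -
  define t where "t z = (LEAST t. Suc z - triangle (Suc t) = 0)" for z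
  have ex: "\<exists>n. Suc z \<le> triangle (Suc n)" for z
    by (rule exI[of _ z]) simp
  have "rec_in X 1 (\<lambda>xs. LEAST n. Suc ((n # xs) ! 1) - triangle (Suc ((n # xs) ! 0)) = 0)"
    by (rule rec_in_Least[where f = "\<lambda>xs. Suc (xs ! 1) - triangle (Suc (xs ! 0))"])
      (auto intro!: rec_in_proj rec_in_diff rec_in_triangle rec_in_Suc ex simp del: triangle_Suc)
  then have "computable X t" unfolding computable_iff_rec_in t_def by simp
  moreover have "computable X triangle"
    unfolding computable_iff_rec_in by (auto intro!: rec_in_proj rec_in_triangle)
  ultimately have "computable X (\<lambda>z. z - triangle (t z))" "computable X (\<lambda>z. t z - (z - triangle (t z)))"
    by (auto intro!: computable_intros intro: computable_comp)
  then show "computable X (\<lambda>x. fst (prod_decode x))" "computable X (\<lambda>x. snd (prod_decode x))"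
    by (simp_all add: prod_decode_triangle[OF t_def])
qed

abbreviation left :: "nat \<Rightarrow> nat" where "left n \<equiv> fst (prod_decode n)"
abbreviation right :: "nat \<Rightarrow> nat" where "right n \<equiv> snd (prod_decode n)"

lemmas computable_left [computable_intros] =
  computable_comp[OF computable_fst_snd_prod_decode(1)]
lemmas computable_right [computable_intros] =
  computable_comp[OF computable_fst_snd_prod_decode(2)]

text \<open>A premise about \<open>F (left u) (right u)\<close> is how joint computability in two
  arguments is expressed by unary functions; triples nest the pairing to the right. The rules for
  recursion, bounded quantifiers and search follow the same convention.\<close>

lemma computable_comp2:
  assumes "computable X (\<lambda>u. F (left u) (right u))" "computable X f" "computable X g"
  shows "computable X (\<lambda>x. F (f x) (g x))"
  using computable_comp[OF assms(1) computable_pair[OF assms(2,3)]] by simp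

lemma computable_rec_nat [computable_intros]:
  assumes "computable X f" "computable X (\<lambda>u. G (left u) (left (right u)) (right (right u)))"
    "computable X h"
  shows "computable X (\<lambda>x. rec_nat (f x) (G x) (h x))"
proof -
  have p2: "rec_in X k (\<lambda>xs. prod_encode (f xs, g xs))" if "rec_in X k f" "rec_in X k g" for k f g
    using that by (rule rec_in_comp2[OF rec_in_pair2])
  let ?g = "\<lambda>v. G (left v) (left (right v)) (right (right v))"
  have "rec_in X (Suc (Suc (Suc 0))) (\<lambda>xs. ?g (prod_encode (xs ! 2, prod_encode (xs ! 1, xs ! 0))))"
    using assms(2) unfolding computable_iff_rec_in
    by (rule rec_in_comp1) (auto intro!: p2 rec_in_proj)
  moreover have "rec_in X (Suc 0) (\<lambda>xs. f (xs ! 0))"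
    using assms(1) unfolding computable_iff_rec_in by simp
  ultimately have "rec_in X (Suc (Suc 0)) (\<lambda>xs. rec_nat (f (tl xs ! 0)) (\<lambda>n r. G (tl xs ! 0) n r) (hd xs))"
    using rec_in_primrec[of X "Suc 0" "\<lambda>xs. f (xs ! 0)" "\<lambda>xs. G (xs ! 2) (xs ! 1) (xs ! 0)"]
    by (simp add: numeral_2_eq_2)
  then have "rec_in X 2 (\<lambda>xs. rec_nat (f (xs ! 1)) (\<lambda>n r. G (xs ! 1) n r) (xs ! 0))"
    unfolding numeral_2_eq_2 by (rule rec_in_cong) (auto simp: length_Suc_conv)
  from rec_in_comp2[OF this assms(3)[unfolded computable_iff_rec_in] rec_in_proj[of 0 1]]
  show ?thesis unfolding computable_iff_rec_in by simp
qed

lemma computable_if [computable_intros]: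
  assumes "decidable X P" "computable X f" "computable X g"
  shows "computable X (\<lambda>x. if P x then f x else g x)"
proof -
  have "computable X (\<lambda>x. (if P x then 1 else 0) * f x + (1 - (if P x then 1 else 0)) * g x)"
    using assms unfolding decidable_def by (intro computable_intros)
  then show ?thesis by (rule back_subst[of "computable X"]) auto
qed

lemma decidable_comp: "decidable X P \<Longrightarrow> computable X f \<Longrightarrow> decidable X (\<lambda>x. P (f x))"
  unfolding decidable_def by (rule computable_comp)

lemma decidable_comp2:
  assumes "decidable X (\<lambda>u. P (left u) (right u))" "computable X f" "computable X g"
  shows "decidable X (\<lambda>x. P (f x) (g x))"
  using decidable_comp[OF assms(1) computable_pair[OF assms(2,3)]] by simp

lemma decidable_comp3:
  assumes "decidable X (\<lambda>u. P (left u) (left (right u)) (right (right u)))"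
    "computable X f" "computable X g" "computable X h"
  shows "decidable X (\<lambda>x. P (f x) (g x) (h x))"
  using decidable_comp[OF assms(1) computable_pair[OF assms(2) computable_pair[OF assms(3,4)]]]
  by simp

lemma decidable_cong: "decidable X P \<Longrightarrow> (\<And>x. P x \<longleftrightarrow> Q x) \<Longrightarrow> decidable X Q"
  by (drule ext[of P Q]) simp

lemma decidable_const [computable_intros]: "decidable X (\<lambda>x. b)"
  unfolding decidable_def by (intro computable_intros)

lemma decidable_eq_0:
  assumes "computable X f" shows "decidable X (\<lambda>x. f x = 0)"
proof -
  have "computable X (\<lambda>x. 1 - f x)" using assms by (intro computable_intros)
  then show ?thesis unfolding decidable_def by (rule back_subst[of "computable X"]) auto
qed

lemma decidable_not [computable_intros]:
  assumes "decidable X P" shows "decidable X (\<lambda>x. \<not> P x)"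
  by (rule decidable_cong[OF decidable_eq_0[OF assms[unfolded decidable_def]]]) simp

lemma decidable_le [computable_intros]:
  "computable X f \<Longrightarrow> computable X g \<Longrightarrow> decidable X (\<lambda>x. f x \<le> g x)"
  using decidable_eq_0[OF computable_diff, of X f g] by simp

lemma decidable_less [computable_intros]:
  "computable X f \<Longrightarrow> computable X g \<Longrightarrow> decidable X (\<lambda>x. f x < g x)"
  using decidable_le[OF computable_Suc, of X f g] by (simp add: Suc_le_eq)

lemma decidable_conj [computable_intros]:
  assumes "decidable X P" "decidable X Q" shows "decidable X (\<lambda>x. P x \<and> Q x)"
proof -
  have "computable X (\<lambda>x. (if P x then 1 else 0) * (if Q x then 1 else 0))"
    using assms unfolding decidable_def by (rule computable_mult)
  then show ?thesis unfolding decidable_def by (rule back_subst[of "computable X"]) auto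
qed

lemma decidable_disj [computable_intros]:
  assumes "decidable X P" "decidable X Q" shows "decidable X (\<lambda>x. P x \<or> Q x)"
  by (rule decidable_cong[where P = "\<lambda>x. \<not> (\<not> P x \<and> \<not> Q x)"])
    (intro computable_intros assms, blast)

lemma decidable_imp [computable_intros]:
  assumes "decidable X P" "decidable X Q" shows "decidable X (\<lambda>x. P x \<longrightarrow> Q x)"
  by (rule decidable_cong[where P = "\<lambda>x. \<not> P x \<or> Q x"]) (intro computable_intros assms, blast)

lemma decidable_iff [computable_intros]:
  assumes "decidable X P" "decidable X Q" shows "decidable X (\<lambda>x. P x \<longleftrightarrow> Q x)"
  by (rule decidable_cong[where P = "\<lambda>x. (P x \<longrightarrow> Q x) \<and> (Q x \<longrightarrow> P x)"])
    (intro computable_intros assms, blast)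

lemma decidable_if [computable_intros]:
  assumes "decidable X P" "decidable X Q" "decidable X R"
  shows "decidable X (\<lambda>x. if P x then Q x else R x)"
  by (rule decidable_cong[where P = "\<lambda>x. (P x \<longrightarrow> Q x) \<and> (\<not> P x \<longrightarrow> R x)"])
    (intro computable_intros assms, simp)

lemma decidable_eq [computable_intros]:
  assumes "computable X f" "computable X g" shows "decidable X (\<lambda>x. f x = g x)"
  by (rule decidable_cong[where P = "\<lambda>x. f x \<le> g x \<and> g x \<le> f x"])
    (intro computable_intros assms, auto)

lemma decidable_ex_less [computable_intros]:
  assumes "decidable X (\<lambda>u. P (left u) (right u))" "computable X b"
  shows "decidable X (\<lambda>x. \<exists>n<b x. P x n)"
proof -
  have "computable X (\<lambda>x. rec_nat 0 (\<lambda>n r. if P x n then 1 else r) (b x))"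
    by (intro computable_intros decidable_comp2[where P = P, OF assms(1)] assms(2))
  moreover have "rec_nat 0 (\<lambda>n r. if P x n then 1 else r) k = (if \<exists>n<k. P x n then 1 else 0::nat)" for x k
    by (induction k) (auto simp: less_Suc_eq)
  ultimately show ?thesis unfolding decidable_def by simp
qed

lemma decidable_all_less [computable_intros]:
  assumes "decidable X (\<lambda>u. P (left u) (right u))" "computable X b"
  shows "decidable X (\<lambda>x. \<forall>n<b x. P x n)"
  by (rule decidable_cong[where P = "\<lambda>x. \<not> (\<exists>n<b x. \<not> P x n)"])
    (intro computable_intros assms, blast)

lemma decidable_all_le [computable_intros]:
  assumes "decidable X (\<lambda>u. P (left u) (right u))" "computable X b"
  shows "decidable X (\<lambda>x. \<forall>n\<le>b x. P x n)"
  using decidable_all_less[OF assms(1) computable_Suc[OF assms(2)]] by (simp add: less_Suc_eq_le)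

lemma computable_Least:
  assumes "decidable X (\<lambda>u. P (left u) (right u))" "\<And>x. \<exists>n. P x n"
  shows "computable X (\<lambda>x. LEAST n. P x n)"
proof -
  have "computable X (\<lambda>u. if P (left u) (right u) then 0 else 1)"
    by (intro computable_intros assms)
  then have c: "rec_in X 1 (\<lambda>xs. if P (left (xs ! 0)) (right (xs ! 0)) then 0 else 1)"
    unfolding computable_iff_rec_in .
  have "rec_in X 2 (\<lambda>xs. if P (xs ! 1) (xs ! 0) then 0 else 1)"
    using rec_in_comp1[OF c rec_in_comp2[OF rec_in_pair2 rec_in_proj[of 1 2] rec_in_proj[of 0 2]]] by simp
  then have "rec_in X 1 (\<lambda>xs. LEAST n. (if P ((n # xs) ! 1) ((n # xs) ! 0) then 0 else 1::nat) = 0)"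
    using assms(2) by (intro rec_in_Least) (auto simp: numeral_2_eq_2)
  moreover have "((if b then 0 else 1::nat) = 0) = b" for b by simp
  ultimately show ?thesis unfolding computable_iff_rec_in by simp
qed

lemma computable_div [computable_intros]:
  assumes "computable X f" "computable X g"
  shows "computable X (\<lambda>x. f x div g x)"
proof (rule computable_comp2[OF _ assms])
  \<comment> \<open>The search must halt for every input, so a zero divisor satisfies its condition
    at once; the outer conditional then supplies the value that \<open>div\<close> has
    there.\<close>
  have "computable X (\<lambda>u. if right u = 0 then 0
      else LEAST q. right u = 0 \<or> left u < Suc q * right u)"
  proof (intro computable_intros computable_Least)
    show "\<exists>q. right u = 0 \<or> left u < Suc q * right u" for u
      by (intro exI[of _ "left u"]) (cases "right u", auto)
  qed
  moreover have "(if n = 0 then 0 else LEAST q. n = 0 \<or> m < Suc q * n) = m div n" for m n :: nat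
  proof (cases "n = 0")
    case False
    then have "n = 0 \<or> m < Suc q * n \<longleftrightarrow> m div n \<le> q" for q
      using div_less_iff_less_mult[of n m "Suc q"] by (simp add: less_Suc_eq_le)
    with False show ?thesis by (auto intro: Least_equality)
  qed simp
  ultimately show "computable X (\<lambda>u. left u div right u)" by simp
qed

lemma computable_mod [computable_intros]:
  assumes "computable X f" "computable X g"
  shows "computable X (\<lambda>x. f x mod g x)"
  unfolding modulo_nat_def by (intro computable_intros assms)

lemma decidable_even [computable_intros]:
  assumes "computable X f" shows "decidable X (\<lambda>x. even (f x))"
  unfolding even_iff_mod_2_eq_zero by (intro computable_intros assms)

lemma computable_power [computable_intros]:
  assumes "computable X f" "computable X g"
  shows "computable X (\<lambda>x. f x ^ g x)"
proof -
  have "computable X (\<lambda>x. rec_nat 1 (\<lambda>n r. f x * r) (g x))"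
    by (intro computable_intros computable_comp[OF assms(1)] assms)
  moreover have "rec_nat 1 (\<lambda>n r. k * r) m = k ^ m" for k m :: nat by (induction m) auto
  ultimately show ?thesis by simp
qed

subsection \<open>Codes of finite sets and lists\<close>

lemma decidable_set_decode [computable_intros]:
  assumes "computable X f" "computable X g"
  shows "decidable X (\<lambda>x. f x \<in> set_decode (g x))"
  unfolding set_decode_def mem_Collect_eq by (intro computable_intros assms)

lemma set_encode_less_Suc:
  "set_encode {n. n < Suc b \<and> P n} = (if P b then 2 ^ b else 0) + set_encode {n. n < b \<and> P n}"
proof -
  have "{n. n < Suc b \<and> P n} = (if P b then insert b {n. n < b \<and> P n} else {n. n < b \<and> P n})"
    by (auto simp: less_Suc_eq)
  then show ?thesis by simp
qed

lemma computable_set_encode [computable_intros]: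
  assumes "decidable X (\<lambda>u. P (left u) (right u))" "computable X b"
  shows "computable X (\<lambda>x. set_encode {n. n < b x \<and> P x n})"
proof -
  have "computable X (\<lambda>x. rec_nat 0 (\<lambda>n r. (if P x n then 2 ^ n else 0) + r) (b x))"
    by (intro computable_intros decidable_comp2[where P = P, OF assms(1)] assms(2))
  moreover have "rec_nat 0 (\<lambda>n r. (if P x n then 2 ^ n else 0) + r) k = set_encode {n. n < k \<and> P x n}"
    for x k by (induction k) (auto simp: set_encode_less_Suc)
  ultimately show ?thesis by simp
qed

text \<open>Course-of-values recursion: the finite part of \<open>A\<close> below \<open>n\<close>
  is carried along as one number by \<open>set_encode\<close>, and membership of \<open>n\<close> is
  read off from it. Any syntactic predicate that descends to smaller codes becomes decidable in this
  way.\<close>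

lemma decidable_course_of_values:
  assumes dec: "decidable X (\<lambda>u. P (set_decode (left u)) (right u))"
    and A: "\<And>n. n \<in> A \<longleftrightarrow> P (A \<inter> {..<n}) n"
  shows "decidable X (\<lambda>n. n \<in> A)"
proof -
  have "computable X (\<lambda>m. rec_nat 0 (\<lambda>n r. (if P (set_decode r) n then 2 ^ n else 0) + r) m)"
    by (intro computable_intros decidable_comp2[where P = "\<lambda>r. P (set_decode r)", OF dec])
  moreover have "rec_nat 0 (\<lambda>n r. (if P (set_decode r) n then 2 ^ n else 0) + r) m
      = set_encode (A \<inter> {..<m})" for m
  proof (induction m)
    case (Suc m)
    have "A \<inter> {..<k} = {n. n < k \<and> n \<in> A}" for k by auto
    with Suc A[of m] show ?case by (simp add: set_encode_less_Suc)
  qed simp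
  ultimately have "computable X (\<lambda>n. set_encode (A \<inter> {..<n}))" by simp
  then have "decidable X (\<lambda>n. P (set_decode (set_encode (A \<inter> {..<n}))) n)"
    by (intro decidable_comp2[where P = "\<lambda>r. P (set_decode r)", OF dec] computable_intros)
  then show ?thesis using A by simp
qed

definition tl_code :: "nat \<Rightarrow> nat" where "tl_code c = right (c - 1)"

lemma tl_code: "c \<noteq> 0 \<Longrightarrow> tl_code c = list_encode (tl (list_decode c))"
  by (cases c) (simp_all add: tl_code_def split: prod.split)

lemma tl_code_0 [simp]: "tl_code 0 = 0"
  by (simp add: tl_code_def prod_decode_def prod_decode_aux.simps)

lemma funpow_tl_code: "(tl_code ^^ i) c = list_encode (drop i (list_decode c))"
proof (induction i)
  case (Suc i)
  have "tl_code (list_encode xs) = list_encode (tl xs)" for xs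
    by (cases xs) (auto simp: tl_code)
  with Suc show ?case by (simp add: drop_Suc tl_drop)
qed simp

lemma list_encode_eq_0: "list_encode xs = 0 \<longleftrightarrow> xs = []"
  by (cases xs) auto

lemma hd_list_decode: "c \<noteq> 0 \<Longrightarrow> hd (list_decode c) = left (c - 1)"
  by (cases c) (auto split: prod.split)

lemma computable_funpow_tl_code:
  assumes "computable X f" "computable X g"
  shows "computable X (\<lambda>x. (tl_code ^^ f x) (g x))"
proof -
  have "computable X (\<lambda>x. rec_nat (g x) (\<lambda>n r. right (r - 1)) (f x))"
    by (intro computable_intros assms)
  moreover have "rec_nat c (\<lambda>n r. right (r - 1)) m = (tl_code ^^ m) c" for c m
    by (induction m) (auto simp: tl_code_def)
  ultimately show ?thesis by simp
qed

lemma computable_length [computable_intros]: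
  assumes "computable X f" shows "computable X (\<lambda>x. length (list_decode (f x)))"
proof (rule computable_comp[OF _ assms])
  have "computable X (\<lambda>c. LEAST n. (tl_code ^^ n) c = 0)"
    by (intro computable_Least decidable_eq_0 computable_funpow_tl_code computable_intros)
      (auto simp: funpow_tl_code list_encode_eq_0)
  moreover have "(LEAST n. (tl_code ^^ n) c = 0) = length (list_decode c)" for c
    by (rule Least_equality) (simp_all add: funpow_tl_code list_encode_eq_0)
  ultimately show "computable X (\<lambda>c. length (list_decode c))" by simp
qed

text \<open>The junk value of \<open>xs ! n\<close> beyond the length of the list is not computable,
  hence a variant with value 0 there.\<close>

definition nth_code :: "nat \<Rightarrow> nat \<Rightarrow> nat" where
  "nth_code c i = (if i < length (list_decode c) then list_decode c ! i else 0)"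

lemma computable_nth_code [computable_intros]:
  assumes "computable X f" "computable X g"
  shows "computable X (\<lambda>x. nth_code (f x) (g x))"
proof -
  have "computable X (\<lambda>x. if g x < length (list_decode (f x)) then left ((tl_code ^^ g x) (f x) - 1) else 0)"
    by (intro computable_intros computable_funpow_tl_code assms)
  moreover have "left ((tl_code ^^ n) c - 1) = list_decode c ! n"
    if "n < length (list_decode c)" for n c
  proof -
    have "(tl_code ^^ n) c \<noteq> 0" using that by (simp add: funpow_tl_code list_encode_eq_0)
    from hd_list_decode[OF this] show ?thesis
      using that by (simp add: funpow_tl_code hd_drop_conv_nth)
  qed
  ultimately show ?thesis by (simp add: nth_code_def cong: if_cong)
qed

lemma decidable_list_all2 [computable_intros]:
  assumes P: "decidable X (\<lambda>u. P (left u) (left (right u)) (right (right u)))"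
    and fg: "computable X f" "computable X g"
  shows "decidable X (\<lambda>x. list_all2 (P x) (list_decode (f x)) (list_decode (g x)))"
proof -
  have "decidable X (\<lambda>x. length (list_decode (f x)) = length (list_decode (g x)) \<and>
     (\<forall>i<length (list_decode (f x)). P x (nth_code (f x) i) (nth_code (g x) i)))"
    by (intro computable_intros decidable_comp3[where P = P, OF P]
        computable_comp[OF fg(1)] computable_comp[OF fg(2)])
  then show ?thesis by (rule decidable_cong) (auto simp: list_all2_conv_all_nth nth_code_def)
qed

lemma decidable_ball_list [computable_intros]:
  assumes P: "decidable X (\<lambda>u. P (left u) (right u))" and f: "computable X f"
  shows "decidable X (\<lambda>x. \<forall>y\<in>set (list_decode (f x)). P x y)"
  by (rule decidable_cong[OF decidable_list_all2[where P = "\<lambda>x y z. P x y", OF _ f f]])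
    (auto simp: list_all2_same intro!: decidable_comp2[where P = P, OF P] computable_intros)

subsection \<open>Turing reductions\<close>

lemma turing_le_iff: "turing_le A B \<longleftrightarrow> decidable B (\<lambda>x. x \<in> A)"
  unfolding turing_le_def decidable_def computable_def by (rule refl)

lemma recursive_fun_1_iff: "recursive_fun 1 f \<longleftrightarrow> computable {} (\<lambda>x. f [x])"
proof -
  have "length xs = 1 \<longleftrightarrow> (\<exists>x. xs = [x])" for xs :: "nat list"
    by (cases xs) auto
  then show ?thesis unfolding recursive_fun_def computable_def by metis
qed

lemma recursive_set_iff: "recursive_set A \<longleftrightarrow> decidable {} (\<lambda>x. x \<in> A)"
  unfolding recursive_set_def recursive_fun_1_iff decidable_def by simp

lemma decidable_query [computable_intros]:
  assumes "computable X f" shows "decidable X (\<lambda>x. f x \<in> X)"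
proof (rule decidable_comp[where P = "\<lambda>x. x \<in> X", OF _ assms])
  show "decidable X (\<lambda>x. x \<in> X)"
    unfolding decidable_def computable_def by (intro exI[of _ Query] allI computes.query)
qed

text \<open>Oracle substitution: if \<open>q\<close> decides \<open>X\<close> from \<open>Y\<close>,
  a program with oracle \<open>X\<close> becomes one with oracle \<open>Y\<close>. It yields the
  transitivity of Turing reducibility.\<close>

primrec answer_queries :: "prog \<Rightarrow> prog \<Rightarrow> prog" where
  "answer_queries q Zero = Zero"
| "answer_queries q Succ = Succ"
| "answer_queries q (Proj i) = Proj i"
| "answer_queries q Query = q"
| "answer_queries q (Comp f gs) = Comp (answer_queries q f) (map (answer_queries q) gs)"
| "answer_queries q (PrimRec f g) = PrimRec (answer_queries q f) (answer_queries q g)"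
| "answer_queries q (Mu f) = Mu (answer_queries q f)"

lemma computes_answer_queries:
  assumes q: "\<And>x. computes Y q [x] (if x \<in> X then 1 else 0)"
  shows "computes X p xs y \<Longrightarrow> computes Y (answer_queries q p) xs y"
proof (induction rule: computes.induct)
  case (comp xs gs ys f z)
  then show ?case
    by (auto intro!: computes.comp[where ys = ys] simp: list_all2_conv_all_nth)
next
  case (mu f n xs)
  then show ?case by (auto intro!: computes.mu)
qed (auto intro: computes.intros simp: q simp del: One_nat_def)

lemma computable_trans:
  assumes "computable X f" "decidable Y (\<lambda>x. x \<in> X)"
  shows "computable Y f"
  using assms unfolding computable_def decidable_def by (blast intro: computes_answer_queries)

lemma decidable_trans:
  assumes "decidable X P" "decidable Y (\<lambda>x. x \<in> X)"
  shows "decidable Y P"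
  using computable_trans assms unfolding decidable_def[of _ P] by blast

lemma computable_any_oracle: "computable {} f \<Longrightarrow> computable X f"
  by (rule computable_trans[where X = "{}"]) (simp_all add: decidable_const)

subsection \<open>Codes of programs\<close>

text \<open>Needed because \<open>W e\<close> ranges over all programs with code \<open>e\<close>:
  it belongs to a single program.\<close>

lemma prog_code_inject: "prog_code p = prog_code q \<Longrightarrow> p = q"
proof (induction p arbitrary: q)
  case (Comp f gs)
  then obtain f' gs' where q: "q = Comp f' gs'" by (cases q) auto
  with Comp.prems have "prog_code f = prog_code f'" "map prog_code gs = map prog_code gs'"
    by (simp_all add: list_encode_eq)
  from Comp.IH(1)[OF this(1)] list.inj_map_strong[OF Comp.IH(2) this(2)]
  show ?case by (simp add: q)
next
  case (PrimRec f g)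
  then show ?case by (cases q) auto
next
  case (Mu f)
  then show ?case by (cases q) auto
qed (case_tac q; simp)+

lemma list_encode_less: "x \<in> set xs \<Longrightarrow> x < list_encode xs"
  by (induction xs)
    (auto simp: less_Suc_eq_le intro: le_prod_encode_1 le_trans[OF less_imp_le le_prod_encode_2])

lemma prod_encode_greater: "0 < t \<Longrightarrow> c < prod_encode (t, c)"
  using triangle_mono[of "Suc c" "t + c"] by (simp add: prod_encode_def)

lemma right_less: "0 < left n \<Longrightarrow> right n < n"
  using prod_encode_greater[of "left n" "right n"] by simp

lemma left_le: "left n \<le> n" and right_le: "right n \<le> n"
  using le_prod_encode_1[of "left n" "right n"] le_prod_encode_2[of "right n" "left n"] by simp_all

lemma set_list_decode_less: "x \<in> set (list_decode c) \<Longrightarrow> x < c"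
  using list_encode_less[of x "list_decode c"] by simp

text \<open>This is the recursion to which \<open>decidable_course_of_values\<close> applies:
  subprograms have smaller codes, since every tag with subprograms is positive.\<close>

lemma prog_code_cases:
  "n \<in> range prog_code \<longleftrightarrow>
     left n = 0 \<and> right n = 0 \<or> left n = 1 \<and> right n = 0 \<or> left n = 2 \<or> left n = 3 \<and> right n = 0
   \<or> left n = 4 \<and> left (right n) \<in> range prog_code
       \<and> (\<forall>g\<in>set (list_decode (right (right n))). g \<in> range prog_code)
   \<or> left n = 5 \<and> left (right n) \<in> range prog_code \<and> right (right n) \<in> range prog_code
   \<or> left n = 6 \<and> right n \<in> range prog_code" (is "_ \<longleftrightarrow> ?R n")
proof
  assume "n \<in> range prog_code"
  then obtain p where "n = prog_code p" by blast
  then show "?R n" by (cases p) auto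
next
  have *: "n = prod_encode (a, b) \<Longrightarrow> prog_code p = prod_encode (a, b) \<Longrightarrow> n \<in> range prog_code" for p a b
    by (metis rangeI)
  have n: "n = prod_encode (left n, right n)" by simp
  have r: "right n = prod_encode (left (right n), right (right n))" by simp
  assume "?R n"
  then consider "left n = 0" "right n = 0" | "left n = 1" "right n = 0" | "left n = 2"
    | "left n = 3" "right n = 0"
    | "left n = 4" "left (right n) \<in> range prog_code"
       "\<forall>g\<in>set (list_decode (right (right n))). g \<in> range prog_code"
    | "left n = 5" "left (right n) \<in> range prog_code" "right (right n) \<in> range prog_code"
    | "left n = 6" "right n \<in> range prog_code"
    by (elim disjE conjE) simp_all
  then show "n \<in> range prog_code"
  proof cases
    case 1 then show ?thesis using *[OF n, of Zero] by simp
  next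
    case 2 then show ?thesis using *[OF n, of Succ] by simp
  next
    case 3 then show ?thesis using *[OF n, of "Proj (right n)"] by simp
  next
    case 4 then show ?thesis using *[OF n, of Query] by simp
  next
    case 5
    then obtain f where f: "left (right n) = prog_code f" by blast
    have "list_decode (right (right n)) \<in> lists (range prog_code)" using 5 by blast
    then obtain gs where gs: "list_decode (right (right n)) = map prog_code gs"
      unfolding lists_image by blast
    have "right (right n) = list_encode (map prog_code gs)" using gs by (metis list_decode_inverse)
    then show ?thesis using *[OF n, of "Comp f gs"] 5 f r by simp
  next
    case 6
    then obtain f g where "left (right n) = prog_code f" "right (right n) = prog_code g" by blast
    then show ?thesis using *[OF n, of "PrimRec f g"] 6 r by simp
  next
    case 7
    then obtain f where "right n = prog_code f" by blast
    then show ?thesis using *[OF n, of "Mu f"] 7 by simp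
  qed
qed

lemma decidable_prog_code [computable_intros]:
  assumes "computable X f" shows "decidable X (\<lambda>x. f x \<in> range prog_code)"
proof (rule decidable_comp[OF _ assms])
  define P where "P A n \<longleftrightarrow>
     left n = 0 \<and> right n = 0 \<or> left n = 1 \<and> right n = 0 \<or> left n = 2 \<or> left n = 3 \<and> right n = 0
   \<or> left n = 4 \<and> left (right n) \<in> A \<and> (\<forall>g\<in>set (list_decode (right (right n))). g \<in> A)
   \<or> left n = 5 \<and> left (right n) \<in> A \<and> right (right n) \<in> A
   \<or> left n = 6 \<and> right n \<in> A" for A n
  show "decidable X (\<lambda>n. n \<in> range prog_code)"
  proof (rule decidable_course_of_values)
    show "decidable X (\<lambda>u. P (set_decode (left u)) (right u))"
      unfolding P_def by (intro computable_intros)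
    fix n
    have 1: "0 < left n \<Longrightarrow> left (right n) < n" "0 < left n \<Longrightarrow> right (right n) < n"
      using right_less[of n] left_le[of "right n"] right_le[of "right n"] by linarith+
    then have 2: "g < n" if "0 < left n" "g \<in> set (list_decode (right (right n)))" for g
      using set_list_decode_less[OF that(2)] that(1) by fastforce
    have "P A n \<longleftrightarrow> P (A \<inter> {..<n}) n" for A
      unfolding P_def by (intro refl disj_cong conj_cong ball_cong) (use 1 2 right_less[of n] in simp_all)
    moreover have "n \<in> range prog_code \<longleftrightarrow> P (range prog_code) n"
      unfolding P_def by (rule prog_code_cases)
    ultimately show "n \<in> range prog_code \<longleftrightarrow> P (range prog_code \<inter> {..<n}) n" by blast
  qed
qed

subsection \<open>A universal machine\<close>

text \<open>The evaluation relation is enumerated in stages: \<open>run D s\<close> contains the codes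
  below \<open>s\<close> of the triples \<open>(p, xs, y)\<close> that one rule of \<open>computes\<close> derives from the triples
  of the previous stage. In particular only queries below \<open>s\<close> matter for \<open>run D s\<close>.\<close>

definition triple :: "nat \<Rightarrow> nat \<Rightarrow> nat \<Rightarrow> nat" where
  "triple p l y = prod_encode (p, prod_encode (l, y))"

abbreviation cons_code :: "nat \<Rightarrow> nat \<Rightarrow> nat" where
  "cons_code x l \<equiv> Suc (prod_encode (x, l))"

text \<open>The program is split into its tag \<open>t\<close> and the rest \<open>c\<close>, so
  that each disjunct mirrors one rule of \<open>computes\<close>. Intermediate values are sought
  below \<open>b\<close> only, which keeps the relation decidable; larger ones are reached at later
  stages. In the recursive case of \<open>PrimRec\<close> the program refers to itself, as
  \<open>prod_encode (5, c)\<close>.\<close>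

definition step :: "nat set \<Rightarrow> nat set \<Rightarrow> nat \<Rightarrow> nat \<Rightarrow> nat \<Rightarrow> nat \<Rightarrow> nat \<Rightarrow> bool" where
  "step D F b t c l y \<longleftrightarrow>
     t = 0 \<and> c = 0 \<and> y = 0
   \<or> t = 1 \<and> c = 0 \<and> length (list_decode l) = 1 \<and> y = Suc (nth_code l 0)
   \<or> t = 2 \<and> c < length (list_decode l) \<and> y = nth_code l c
   \<or> t = 3 \<and> c = 0 \<and> length (list_decode l) = 1
       \<and> (nth_code l 0 \<in> D \<and> y = 1 \<or> nth_code l 0 \<notin> D \<and> y = 0)
   \<or> t = 4 \<and> (\<exists>ys<b. triple (left c) ys y \<in> F
       \<and> list_all2 (\<lambda>g z. triple g l z \<in> F) (list_decode (right c)) (list_decode ys))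
   \<or> t = 5 \<and> l \<noteq> 0 \<and> nth_code l 0 = 0 \<and> triple (left c) (tl_code l) y \<in> F
   \<or> t = 5 \<and> l \<noteq> 0 \<and> nth_code l 0 \<noteq> 0
       \<and> (\<exists>r<b. triple (prod_encode (5, c)) (cons_code (nth_code l 0 - 1) (tl_code l)) r \<in> F
            \<and> triple (right c) (cons_code r (cons_code (nth_code l 0 - 1) (tl_code l))) y \<in> F)
   \<or> t = 6 \<and> triple c (cons_code y l) 0 \<in> F \<and> (\<forall>m<y. \<exists>z<b. triple c (cons_code m l) (Suc z) \<in> F)"

primrec run :: "nat set \<Rightarrow> nat \<Rightarrow> nat set" where
  "run D 0 = {}"
| "run D (Suc s) = {n. n < Suc s \<and>
     step D (run D s) s (left (left n)) (right (left n)) (left (right n)) (right (right n))}"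

lemma run_less: "n \<in> run D s \<Longrightarrow> n < s"
  by (cases s) auto

lemma finite_run [simp]: "finite (run D s)"
  by (rule finite_subset[of _ "{..<s}"]) (auto dest: run_less)

lemma step_mono:
  assumes "step D F b t c l y" "F \<subseteq> F'" "b \<le> b'"
  shows "step D F' b' t c l y"
proof -
  have "list_all2 (\<lambda>g z. triple g l z \<in> F') gs zs" if "list_all2 (\<lambda>g z. triple g l z \<in> F) gs zs" for gs zs
    using that assms(2) by (auto elim: list_all2_mono)
  moreover have "triple p k z \<in> F \<longrightarrow> triple p k z \<in> F'" "z < b \<longrightarrow> z < b'" for p k z
    using assms(2,3) by auto
  ultimately have "step D F b t c l y \<longrightarrow> step D F' b' t c l y"
    unfolding step_def by (intro imp_refl disj_mono conj_mono ex_mono all_mono imp_mono) simp_all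
  with assms(1) show ?thesis by blast
qed

lemma run_Suc_mono: "run D s \<subseteq> run D (Suc s)"
proof (induction s)
  case (Suc s)
  show ?case
  proof
    fix n assume "n \<in> run D (Suc s)"
    then show "n \<in> run D (Suc (Suc s))"
      using step_mono[OF _ Suc, of D s _ _ _ _ "Suc s"] by simp
  qed
qed simp

lemma run_mono: "s \<le> s' \<Longrightarrow> run D s \<subseteq> run D s'"
  by (rule lift_Suc_mono_le[where f = "run D"]) (rule run_Suc_mono)

lemma nth_code_le: "nth_code l i \<le> l"
  using set_list_decode_less[of "list_decode l ! i" l] by (auto simp: nth_code_def)

text \<open>A queried number is an entry of an argument list, whose code bounds it; the code of the
  list is in turn bounded by the code of the triple, which lies below the stage.\<close>

lemma run_use: "D \<inter> {..<s} = D' \<inter> {..<s} \<Longrightarrow> run D s = run D' s"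
proof (induction s)
  case (Suc s)
  have "D \<inter> {..<s} = (D \<inter> {..<Suc s}) \<inter> {..<s}" "D' \<inter> {..<s} = (D' \<inter> {..<Suc s}) \<inter> {..<s}" by auto
  then have IH: "run D s = run D' s" using Suc by simp
  have "step D F b t c l y \<longleftrightarrow> step D' F b t c l y" if "l < Suc s" for F b t c l y
  proof -
    have "nth_code l 0 \<in> D \<longleftrightarrow> nth_code l 0 \<in> D'"
      using Suc.prems le_less_trans[OF nth_code_le[of l 0] that] by blast
    then show ?thesis unfolding step_def by simp
  qed
  moreover have "left (right n) < Suc s" if "n < Suc s" for n
    using that left_le[of "right n"] right_le[of n] by linarith
  ultimately show ?case by (auto simp: IH)
qed simp

lemma triple_bound: "triple p l y \<in> run D s \<Longrightarrow> p < s \<and> l < s \<and> y < s"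
  using run_less[of "triple p l y" D s] le_prod_encode_1[of p "prod_encode (l, y)"]
    le_prod_encode_2[of "prod_encode (l, y)" p] le_prod_encode_1[of l y] le_prod_encode_2[of y l]
  unfolding triple_def by linarith

lemma triple_run_Suc:
  "triple (prod_encode (t, c)) l y \<in> run D (Suc s) \<longleftrightarrow>
    triple (prod_encode (t, c)) l y < Suc s \<and> step D (run D s) s t c l y"
  by (simp add: triple_def)

declare run.simps(2) [simp del]

lemma run_sound: "triple (prog_code p) (list_encode xs) y \<in> run D s \<Longrightarrow> computes D p xs y"
proof (induction s arbitrary: p xs y)
  case (Suc s)
  have len: "length xs = 1 \<longleftrightarrow> (\<exists>x. xs = [x])" for xs :: "nat list" by (cases xs) auto
  show ?case
  proof (cases p)
    case Zero
    then show ?thesis using Suc.prems by (auto simp: triple_run_Suc step_def intro: computes.intros)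
  next
    case Succ
    then show ?thesis using Suc.prems
      by (auto simp: triple_run_Suc step_def nth_code_def len simp del: One_nat_def intro: computes.intros)
  next
    case (Proj i)
    then show ?thesis using Suc.prems
      by (auto simp: triple_run_Suc step_def nth_code_def intro: computes.intros)
  next
    case Query
    then obtain x where "xs = [x]" "y = (if x \<in> D then 1 else 0)" using Suc.prems
      by (auto simp: triple_run_Suc step_def nth_code_def len simp del: One_nat_def)
    then show ?thesis using computes.query[of D x] Query by simp
  next
    case (Comp f gs)
    then obtain ys where ys: "triple (prog_code f) ys y \<in> run D s"
      "list_all2 (\<lambda>g z. triple g (list_encode xs) z \<in> run D s) (map prog_code gs) (list_decode ys)"
      using Suc.prems by (auto simp: triple_run_Suc step_def)
    have "computes D f (list_decode ys) y" using Suc.IH[of f "list_decode ys"] ys(1) by simp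
    moreover have "list_all2 (\<lambda>g z. computes D g xs z) gs (list_decode ys)"
      using ys(2) Suc.IH by (auto simp: list_all2_conv_all_nth)
    ultimately show ?thesis unfolding Comp by (rule computes.comp[rotated])
  next
    case (PrimRec f g)
    show ?thesis
    proof (cases xs)
      case Nil
      then show ?thesis using Suc.prems PrimRec by (auto simp: triple_run_Suc step_def)
    next
      case (Cons x xs')
      have 1: "nth_code (list_encode xs) 0 = x" "tl_code (list_encode xs) = list_encode xs'"
        by (simp_all add: Cons nth_code_def tl_code_def)
      have 2: "triple (prod_encode (5, prod_encode (prog_code f, prog_code g))) (list_encode xs) y \<in> run D (Suc s)"
        using Suc.prems PrimRec by simp
      show ?thesis
      proof (cases x)
        case 0
        then have "triple (prog_code f) (list_encode xs') y \<in> run D s"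
          using 2 1 by (simp add: triple_run_Suc step_def)
        then show ?thesis using Suc.IH PrimRec Cons 0 by (auto intro: computes.intros)
      next
        case (Suc n)
        obtain r where r: "triple (prog_code p) (list_encode (n # xs')) r \<in> run D s"
          "triple (prog_code g) (list_encode (r # n # xs')) y \<in> run D s"
          using 2 1 Suc PrimRec by (auto simp: triple_run_Suc step_def)
        show ?thesis using Suc.IH[OF r(1)] Suc.IH[OF r(2)]
          unfolding PrimRec Cons Suc by (rule computes.primrec_Suc)
      qed
    qed
  next
    case (Mu f)
    then have "triple (prog_code f) (list_encode (y # xs)) 0 \<in> run D s"
      "\<forall>m<y. \<exists>z<s. triple (prog_code f) (list_encode (m # xs)) (Suc z) \<in> run D s"
      using Suc.prems by (auto simp: triple_run_Suc step_def)
    then show ?thesis unfolding Mu using Suc.IH by (blast intro: computes.mu)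
  qed
qed simp

lemma run_finite_subset: "finite A \<Longrightarrow> A \<subseteq> (\<Union>s. run D s) \<Longrightarrow> \<exists>s. A \<subseteq> run D s"
proof (induction A rule: finite_induct)
  case (insert a A)
  then obtain s s' where "A \<subseteq> run D s" "a \<in> run D s'" by auto
  then have "insert a A \<subseteq> run D (max s s')"
    using run_mono[of s "max s s'" D] run_mono[of s' "max s s'" D] by auto
  then show ?case by blast
qed simp

lemma step_in_run:
  assumes "step D (run D s) s t c l y"
  shows "\<exists>s. triple (prod_encode (t, c)) l y \<in> run D s"
proof -
  let ?n = "triple (prod_encode (t, c)) l y"
  have "step D (run D (max s ?n)) (max s ?n) t c l y"
    using assms by (rule step_mono) (auto intro: run_mono[THEN subsetD, rotated])
  then have "?n \<in> run D (Suc (max s ?n))" by (auto simp: triple_run_Suc)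
  then show ?thesis by blast
qed

text \<open>The finitely many premises of a rule appear at a common stage, and by
  \<open>triple_bound\<close> that stage exceeds all their values, so the bounded witnesses in
  \<open>step\<close> are available.\<close>

lemma run_complete: "computes D p xs y \<Longrightarrow> \<exists>s. triple (prog_code p) (list_encode xs) y \<in> run D s"
proof (induction rule: computes.induct)
  case (zero xs)
  show ?case using step_in_run[of D 0 0 0 "list_encode xs" 0] by (simp add: step_def)
next
  case (succ x)
  show ?case using step_in_run[of D 0 1 0 "list_encode [x]" "Suc x"] by (simp add: step_def nth_code_def)
next
  case (proj i xs)
  then show ?case using step_in_run[of D 0 2 i "list_encode xs" "xs ! i"] by (simp add: step_def nth_code_def)
next
  case (query x)
  show ?case using step_in_run[of D 0 3 0 "list_encode [x]" "if x \<in> D then 1 else 0"]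
    by (simp add: step_def nth_code_def split del: if_split) (simp split: if_split)
next
  case (comp xs gs ys f z)
  let ?A = "insert (triple (prog_code f) (list_encode ys) z)
    ((\<lambda>i. triple (prog_code (gs ! i)) (list_encode xs) (ys ! i)) ` {..<length gs})"
  have "?A \<subseteq> (\<Union>s. run D s)"
    using comp.IH by (auto simp: list_all2_conv_all_nth)
  then obtain s where s: "?A \<subseteq> run D s" using run_finite_subset[of ?A D] by blast
  then have "list_encode ys < s" using triple_bound by blast
  moreover have "length gs = length ys" using comp.IH(1) by (rule list_all2_lengthD)
  ultimately have "step D (run D s) s 4 (prod_encode (prog_code f, list_encode (map prog_code gs))) (list_encode xs) z"
    using s by (auto simp: step_def list_all2_conv_all_nth intro!: exI[of _ "list_encode ys"])
  from step_in_run[OF this] show ?case by simp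
next
  case (primrec_0 f xs y g)
  then obtain s where "triple (prog_code f) (list_encode xs) y \<in> run D s" by blast
  then have "step D (run D s) s 5 (prod_encode (prog_code f, prog_code g)) (list_encode (0 # xs)) y"
    by (simp add: step_def nth_code_def tl_code_def)
  from step_in_run[OF this] show ?case by simp
next
  case (primrec_Suc f g n xs r y)
  let ?A = "{triple (prog_code (PrimRec f g)) (list_encode (n # xs)) r,
     triple (prog_code g) (list_encode (r # n # xs)) y}"
  have "?A \<subseteq> (\<Union>s. run D s)" using primrec_Suc.IH by auto
  then obtain s where s: "?A \<subseteq> run D s" using run_finite_subset[of ?A D] by blast
  then have "r < s" using triple_bound by blast
  then have "step D (run D s) s 5 (prod_encode (prog_code f, prog_code g)) (list_encode (Suc n # xs)) y"
    using s by (auto simp: step_def nth_code_def tl_code_def)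
  from step_in_run[OF this] show ?case by simp
next
  case (mu f n xs)
  then obtain z where z: "\<And>m. m < n \<Longrightarrow> \<exists>s. triple (prog_code f) (list_encode (m # xs)) (Suc (z m)) \<in> run D s"
    by metis
  let ?A = "insert (triple (prog_code f) (list_encode (n # xs)) 0)
    ((\<lambda>m. triple (prog_code f) (list_encode (m # xs)) (Suc (z m))) ` {..<n})"
  have "?A \<subseteq> (\<Union>s. run D s)" using mu.IH(1) z by auto
  then obtain s where s: "?A \<subseteq> run D s" using run_finite_subset[of ?A D] by blast
  have "z m < s" if "m < n" for m using s that triple_bound[of "prog_code f" "list_encode (m # xs)" "Suc (z m)" D s] by auto
  then have "step D (run D s) s 6 (prog_code f) (list_encode xs) n"
    using s by (auto simp: step_def)
  from step_in_run[OF this] show ?case by simp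
qed

lemma computable_triple [computable_intros]:
  "computable X f \<Longrightarrow> computable X g \<Longrightarrow> computable X h \<Longrightarrow> computable X (\<lambda>x. triple (f x) (g x) (h x))"
  unfolding triple_def by (intro computable_intros)

lemma computable_tl_code [computable_intros]: "computable X f \<Longrightarrow> computable X (\<lambda>x. tl_code (f x))"
  unfolding tl_code_def by (intro computable_intros)

lemma computable_run [computable_intros]:
  assumes "computable X f" "computable X g"
  shows "computable X (\<lambda>x. set_encode (run (set_decode (f x)) (g x)))"
proof -
  have "computable X (\<lambda>x. rec_nat 0 (\<lambda>s r. set_encode {n. n < Suc s \<and>
     step (set_decode (f x)) (set_decode r) s (left (left n)) (right (left n)) (left (right n)) (right (right n))}) (g x))"
    unfolding step_def by (intro computable_intros computable_comp[OF assms(1)] assms)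
  moreover have "rec_nat 0 (\<lambda>s r. set_encode {n. n < Suc s \<and>
     step D (set_decode r) s (left (left n)) (right (left n)) (left (right n)) (right (right n))}) m
     = set_encode (run D m)" for D m
    by (induction m) (simp_all add: run.simps(2))
  ultimately show ?thesis by simp
qed

lemma decidable_run [computable_intros]:
  assumes "computable X f" "computable X g" "computable X h"
  shows "decidable X (\<lambda>x. h x \<in> run (set_decode (f x)) (g x))"
  using decidable_set_decode[OF assms(3) computable_run[OF assms(1,2)]] by simp

text \<open>The bound on the output makes this decidable, and \<open>triple_bound\<close> ensures
  that no output escapes it.\<close>

definition halts :: "nat set \<Rightarrow> nat \<Rightarrow> nat \<Rightarrow> nat \<Rightarrow> bool" where
  "halts D s e x \<longleftrightarrow> (\<exists>y<s. triple e (list_encode [x]) y \<in> run D s)"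

lemma decidable_halts [computable_intros]:
  assumes "computable X f" "computable X g" "computable X h" "computable X k"
  shows "decidable X (\<lambda>x. halts (set_decode (f x)) (g x) (h x) (k x))"
  unfolding halts_def
  by (simp, intro computable_intros computable_comp[OF assms(1)] computable_comp[OF assms(2)]
      computable_comp[OF assms(3)] computable_comp[OF assms(4)] assms)

lemma halts_mono: "halts D s e x \<Longrightarrow> s \<le> s' \<Longrightarrow> halts D s' e x"
  unfolding halts_def using run_mono[of s s' D] less_le_trans by blast

lemma halts_use: "D \<inter> {..<s} = D' \<inter> {..<s} \<Longrightarrow> halts D s e x \<longleftrightarrow> halts D' s e x"
  unfolding halts_def using run_use by metis

lemma halts_prog_code: "(\<exists>s. halts D s (prog_code p) x) \<longleftrightarrow> (\<exists>y. computes D p [x] y)"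
proof
  assume "\<exists>y. computes D p [x] y"
  then obtain s y where "triple (prog_code p) (list_encode [x]) y \<in> run D s"
    using run_complete by blast
  moreover from triple_bound[OF this] have "y < s" by blast
  ultimately show "\<exists>s. halts D s (prog_code p) x" unfolding halts_def by blast
next
  assume "\<exists>s. halts D s (prog_code p) x"
  then show "\<exists>y. computes D p [x] y" unfolding halts_def using run_sound by blast
qed

subsection \<open>Recursively enumerable sets\<close>

lemma W_iff: "x \<in> W e \<longleftrightarrow> e \<in> range prog_code \<and> (\<exists>s. halts {} s e x)"
proof -
  have "x \<in> W e \<longleftrightarrow> (\<exists>p. prog_code p = e \<and> (\<exists>s. halts {} s (prog_code p) x))"
    unfolding W_def halts_prog_code by blast
  then show ?thesis by blast
qed

text \<open>Membership of \<open>e\<close> in the range of \<open>prog_code\<close> is tested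
  separately, because \<open>run\<close> never inspects subprograms that it does not evaluate:
  \<open>PrimRec\<close> at 0 succeeds even if the code of its second part is meaningless.\<close>

definition W_stage :: "nat \<Rightarrow> nat \<Rightarrow> nat \<Rightarrow> bool" where
  "W_stage e x s \<longleftrightarrow> e \<in> range prog_code \<and> halts {} s e x"

lemma W_stage: "x \<in> W e \<longleftrightarrow> (\<exists>s. W_stage e x s)"
  by (auto simp: W_iff W_stage_def)

lemma W_stage_mono: "W_stage e x s \<Longrightarrow> s \<le> s' \<Longrightarrow> W_stage e x s'"
  by (auto simp: W_stage_def intro: halts_mono)

lemma decidable_W_stage [computable_intros]:
  assumes "computable X f" "computable X g" "computable X h"
  shows "decidable X (\<lambda>x. W_stage (f x) (g x) (h x))"
  using decidable_halts[OF computable_const[of X 0] assms(3,1,2)] decidable_prog_code[OF assms(1)]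
  unfolding W_stage_def by (auto intro: decidable_conj)

text \<open>The set is the domain of an unbounded search for a witness. \<open>Mu\<close> puts the
  candidate before the input, hence the arguments \<open>[n, x]\<close> of the program.\<close>

lemma re_setI:
  assumes "decidable {} (\<lambda>u. P (left u) (right u))"
  shows "re_set {x. \<exists>s. P x s}"
proof -
  have "computable {} (\<lambda>u. if P (left u) (right u) then 0 else 1)"
    by (intro computable_intros assms)
  then have c: "rec_in {} 1 (\<lambda>xs. if P (left (xs ! 0)) (right (xs ! 0)) then 0 else 1)"
    unfolding computable_iff_rec_in .
  have "rec_in {} 2 (\<lambda>xs. if P (xs ! 1) (xs ! 0) then 0 else 1)"
    using rec_in_comp1[OF c rec_in_comp2[OF rec_in_pair2 rec_in_proj[of 1 2] rec_in_proj[of 0 2]]] by simp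
  then obtain p where "\<And>xs. length xs = 2 \<Longrightarrow> computes {} p xs (if P (xs ! 1) (xs ! 0) then 0 else 1)"
    unfolding rec_in_def by blast
  from this[of "[_, _]"] have p: "computes {} p [n, x] (if P x n then 0 else 1)" for n x
    by simp
  have "(\<exists>y. computes {} (Mu p) [x] y) \<longleftrightarrow> (\<exists>s. P x s)" for x
  proof
    assume "\<exists>y. computes {} (Mu p) [x] y"
    then obtain y where "computes {} p [y, x] 0" by (auto elim: computes_Mu)
    with p[of y x] have "P x y" using computes_deterministic by (fastforce split: if_splits)
    then show "\<exists>s. P x s" by blast
  next
    assume ex: "\<exists>s. P x s"
    define n where "n = (LEAST s. P x s)"
    have "P x n" unfolding n_def using ex by (rule LeastI_ex)
    moreover have "\<not> P x m" if "m < n" for m using that not_less_Least unfolding n_def by blast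
    ultimately have "computes {} (Mu p) [x] n"
      using p[of _ x] by (intro computes.mu) (metis, metis One_nat_def)
    then show "\<exists>y. computes {} (Mu p) [x] y" by blast
  qed
  then have "{x. \<exists>s. P x s} = W (prog_code (Mu p))"
    by (auto simp: W_iff halts_prog_code simp del: prog_code.simps)
  then show ?thesis unfolding re_set_def by blast
qed

text \<open>The witness is a stage of the universal machine, which is why it can be enlarged at
  will; this monotonicity lets finitely many memberships share one stage.\<close>

lemma re_setE:
  assumes "re_set A"
  obtains P where "decidable {} (\<lambda>u. P (left u) (right u))" "A = {x. \<exists>s. P x s}"
    "\<And>x s s'. P x s \<Longrightarrow> s \<le> s' \<Longrightarrow> P x s'"
proof -
  obtain e where "A = W e" using assms unfolding re_set_def by blast
  then have "A = {x. \<exists>s. W_stage e x s}" by (auto simp: W_stage)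
  moreover have "decidable {} (\<lambda>u. W_stage e (left u) (right u))" by (intro computable_intros)
  ultimately show thesis using that W_stage_mono by blast
qed

lemma re_set_image:
  assumes "re_set A" "computable {} f"
  shows "re_set (f ` A)"
proof -
  obtain P where P: "decidable {} (\<lambda>u. P (left u) (right u))" "A = {x. \<exists>s. P x s}"
    using re_setE[OF assms(1)] .
  have "re_set {y. \<exists>s. P (left s) (right s) \<and> y = f (left s)}"
    by (intro re_setI computable_intros decidable_comp[OF P(1)] computable_comp[OF assms(2)])
  moreover have "{y. \<exists>s. P (left s) (right s) \<and> y = f (left s)} = f ` A"
    unfolding P(2) by (auto intro: exI[of _ "prod_encode (_, _)"])
  ultimately show ?thesis by simp
qed

lemma decidable_imp_re_set: "decidable {} (\<lambda>x. x \<in> A) \<Longrightarrow> re_set A"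
  using re_setI[of "\<lambda>x s. x \<in> A"] decidable_comp[of "{}" "\<lambda>x. x \<in> A" left]
  by (simp add: computable_intros)

lemma re_set_union:
  assumes "re_set A" "re_set B" shows "re_set (A \<union> B)"
proof -
  obtain P where P: "decidable {} (\<lambda>u. P (left u) (right u))" "A = {x. \<exists>s. P x s}"
    using re_setE[OF assms(1)] .
  obtain Q where Q: "decidable {} (\<lambda>u. Q (left u) (right u))" "B = {x. \<exists>s. Q x s}"
    using re_setE[OF assms(2)] .
  have "re_set {x. \<exists>s. P x s \<or> Q x s}" by (intro re_setI computable_intros P(1) Q(1))
  also have "{x. \<exists>s. P x s \<or> Q x s} = A \<union> B" unfolding P(2) Q(2) by blast
  finally show ?thesis .
qed

lemma re_set_insert: "re_set A \<Longrightarrow> re_set (insert a A)"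
  using re_set_union[of "{a}" A] by (simp add: decidable_imp_re_set computable_intros)

lemma re_set_W_pairs: "re_set {u. left u \<in> W (right u)}"
  unfolding W_stage by (intro re_setI computable_intros)

lemma re_set_halting_set: "re_set halting_set"
  unfolding halting_set_def W_stage by (intro re_setI computable_intros)

primrec const_prog :: "nat \<Rightarrow> prog" where
  "const_prog 0 = Zero"
| "const_prog (Suc n) = Comp Succ [const_prog n]"

lemma computes_const_prog: "computes X (const_prog n) xs n"
  by (induction n) (auto intro!: computes.zero computes.succ computes.comp[where ys = "[_]"])

lemma computable_const_prog:
  assumes "computable X f" shows "computable X (\<lambda>x. prog_code (const_prog (f x)))"
proof -
  have "computable X (\<lambda>x. rec_nat (prog_code Zero) (\<lambda>n r.
      prod_encode (4, prod_encode (prog_code Succ, Suc (prod_encode (r, 0))))) (f x))"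
    by (intro computable_intros assms)
  moreover have "rec_nat (prog_code Zero) (\<lambda>n r.
      prod_encode (4, prod_encode (prog_code Succ, Suc (prod_encode (r, 0))))) m
      = prog_code (const_prog m)" for m
    by (induction m) simp_all
  ultimately show ?thesis by simp
qed

text \<open>The program with index \<open>e\<close> is composed with one that maps \<open>z\<close>
  to the pair of \<open>z\<close> and the constant \<open>c\<close>. If \<open>e\<close> is not a
  code then neither is \<open>S e c\<close>, so the equivalence holds for every
  \<open>e\<close>.\<close>

lemma smn:
  obtains S where "\<And>X f g. computable X f \<Longrightarrow> computable X g \<Longrightarrow> computable X (\<lambda>x. S (f x) (g x))"
    and "\<And>e c z. z \<in> W (S e c) \<longleftrightarrow> prod_encode (z, c) \<in> W e"
proof -
  obtain pair where "\<And>xs. length xs = 2 \<Longrightarrow> computes {} pair xs (prod_encode (xs ! 0, xs ! 1))"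
    using rec_in_pair2 unfolding rec_in_def by blast
  from this[of "[_, _]"] have pair: "computes {} pair [x, y] (prod_encode (x, y))" for x y by simp
  define arg where "arg c = Comp pair [Proj 0, const_prog c]" for c
  have arg: "computes {} (arg c) [z] (prod_encode (z, c))" for c z
    unfolding arg_def
    using computes.proj[of 0 "[z]"] by (auto intro!: computes.comp[where ys = "[z, c]"] pair computes_const_prog)
  define S where "S e c = prod_encode (4, prod_encode (e, list_encode [prog_code (arg c)]))" for e c
  have "z \<in> W (S e c) \<longleftrightarrow> prod_encode (z, c) \<in> W e" for e c z
  proof
    assume "z \<in> W (S e c)"
    then obtain p y where p: "prog_code p = S e c" "computes {} p [z] y" unfolding W_def by blast
    then obtain f gs where f: "p = Comp f gs" unfolding S_def by (cases p) auto
    then have "prog_code f = e" "map prog_code gs = map prog_code [arg c]"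
      using p(1) unfolding S_def f by (auto simp: list_encode_eq simp del: list_encode.simps)
    then have "prog_code f = e" "gs = [arg c]"
      by (auto intro: prog_code_inject)
    moreover obtain ys where "list_all2 (\<lambda>g y. computes {} g [z] y) gs ys" "computes {} f ys y"
      using p(2) unfolding f by (rule computes_Comp)
    ultimately have "computes {} f [prod_encode (z, c)] y"
      using computes_deterministic[OF arg] by (auto simp: list_all2_Cons1)
    with \<open>prog_code f = e\<close> show "prod_encode (z, c) \<in> W e" unfolding W_def by blast
  next
    assume "prod_encode (z, c) \<in> W e"
    then obtain f y where "prog_code f = e" "computes {} f [prod_encode (z, c)] y" unfolding W_def by blast
    then have "prog_code (Comp f [arg c]) = S e c" "computes {} (Comp f [arg c]) [z] y"
      by (auto simp: S_def intro!: computes.comp[where ys = "[prod_encode (z, c)]"] arg)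
    then show "z \<in> W (S e c)" unfolding W_def by blast
  qed
  moreover have "computable X (\<lambda>x. S (f x) (g x))" if "computable X f" "computable X g" for X f g
    unfolding S_def arg_def prog_code.simps list.map list_encode.simps
    by (intro computable_intros computable_const_prog that)
  ultimately show thesis using that by blast
qed

text \<open>\<open>S e x\<close> is an index of everything if \<open>x \<in> A\<close> and of the
  empty set otherwise, so it belongs to its own domain exactly in the first case.\<close>

lemma re_set_le_halting_set:
  assumes "re_set A" shows "decidable halting_set (\<lambda>x. x \<in> A)"
proof -
  obtain S where S: "\<And>X f g. computable X f \<Longrightarrow> computable X g \<Longrightarrow> computable X (\<lambda>x. S (f x) (g x))"
    "\<And>e c z. z \<in> W (S e c) \<longleftrightarrow> prod_encode (z, c) \<in> W e"
    using smn by metis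
  obtain P where P: "decidable {} (\<lambda>u. P (left u) (right u))" "A = {x. \<exists>s. P x s}"
    using re_setE[OF assms] .
  have "re_set {u. \<exists>s. P (right u) s}"
    by (intro re_setI decidable_comp2[where P = P, OF P(1)] computable_intros)
  then obtain e where e: "W e = {u. right u \<in> A}" unfolding re_set_def P(2) by auto
  have "decidable halting_set (\<lambda>x. S e x \<in> halting_set)" by (intro computable_intros S(1))
  then show ?thesis
    by (rule decidable_cong) (simp add: halting_set_def S(2) e)
qed

text \<open>The productive function \<open>f\<close> is applied to an index \<open>h x\<close> of a
  set that is \<open>{f (h x)}\<close> if \<open>x\<close> is in the halting set and empty
  otherwise; then \<open>f (h x)\<close> lies in \<open>A\<close> in the first case only. The set
  mentions its own index, which takes a built-in instance of the recursion theorem.\<close>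

lemma creative_imp_complete:
  assumes "creative_set A" shows "decidable A (\<lambda>x. x \<in> halting_set)"
proof -
  obtain S where S: "\<And>X f g. computable X f \<Longrightarrow> computable X g \<Longrightarrow> computable X (\<lambda>x. S (f x) (g x))"
    "\<And>e c z. z \<in> W (S e c) \<longleftrightarrow> prod_encode (z, c) \<in> W e"
    using smn by metis
  obtain f where f: "computable {} f" "\<And>e. W e \<inter> A = {} \<Longrightarrow> f e \<notin> A \<union> W e"
    using assms unfolding creative_set_def recursive_fun_1_iff by auto
  obtain P where P: "decidable {} (\<lambda>u. P (left u) (right u))" "halting_set = {x. \<exists>s. P x s}"
    using re_setE[OF re_set_halting_set] .
  let ?V = "{u. \<exists>s. P (right (right u)) s \<and> left u = f (S (left (right u)) (right u))}"
  have "re_set ?V"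
    by (intro re_setI computable_intros decidable_comp2[where P = P, OF P(1)] computable_comp[OF f(1)] S(1))
  then obtain d where d: "W d = ?V" unfolding re_set_def by auto
  \<comment> \<open>The set with index \<open>d\<close> reads from its parameter an index and
    \<open>x\<close>; giving it \<open>d\<close> itself makes the index computed inside the set
    agree with \<open>h x\<close>.\<close>
  define h where "h x = S d (prod_encode (d, x))" for x
  have h: "z \<in> W (h x) \<longleftrightarrow> x \<in> halting_set \<and> z = f (h x)" for x z
    unfolding h_def S(2) d P(2) by simp
  have "f (h x) \<in> A \<longleftrightarrow> x \<in> halting_set" for x
  proof -
    have "W (h x) = (if x \<in> halting_set then {f (h x)} else {})"
      by (rule set_eqI) (simp add: h)
    then show ?thesis using f(2)[of "h x"] by (cases "x \<in> halting_set") auto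
  qed
  moreover have "computable A (\<lambda>x. f (h x))"
    unfolding h_def by (intro computable_comp[OF computable_any_oracle[OF f(1)]] S(1) computable_intros)
  ultimately show ?thesis using decidable_query[of A "\<lambda>x. f (h x)"] by simp
qed

section \<open>A low set that cannot be separated recursively\<close>

text \<open>Diagonalisation relative to \<open>X\<close>: \<open>p\<close> ignores its first
  argument, so \<open>Mu p\<close> halts at 0 or never, the former exactly on \<open>e\<close>
  outside the jump. This is contradictory on its own code.\<close>

lemma jump_not_decidable: "\<not> decidable X (\<lambda>e. \<exists>t. halts X t e e)"
proof
  assume "decidable X (\<lambda>e. \<exists>t. halts X t e e)"
  then have "rec_in X 1 (\<lambda>xs. if \<exists>t. halts X t (xs ! 0) (xs ! 0) then 1 else 0)"
    unfolding decidable_def computable_iff_rec_in .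
  from rec_in_comp1[OF this rec_in_proj[of 1 2]] obtain p where
    "\<And>xs. length xs = 2 \<Longrightarrow> computes X p xs (if \<exists>t. halts X t (xs ! 1) (xs ! 1) then 1 else 0)"
    unfolding rec_in_def by auto
  from this[of "[_, _]"]
  have p: "computes X p [n, e] (if \<exists>t. halts X t e e then 1 else 0)" for n e by simp
  let ?e = "prog_code (Mu p)"
  have "(\<exists>y. computes X (Mu p) [?e] y) \<longleftrightarrow> \<not> (\<exists>t. halts X t ?e ?e)"
  proof
    assume "\<exists>y. computes X (Mu p) [?e] y"
    then obtain y where "computes X p [y, ?e] 0" by (auto elim: computes_Mu)
    from computes_deterministic[OF this p] show "\<not> (\<exists>t. halts X t ?e ?e)" by (auto split: if_splits)
  next
    assume "\<not> (\<exists>t. halts X t ?e ?e)"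
    then have "computes X p [0, ?e] 0" using p[of 0 ?e] by (simp del: prog_code.simps)
    then have "computes X (Mu p) [?e] 0" by (rule computes.mu) simp
    then show "\<exists>y. computes X (Mu p) [?e] y" by blast
  qed
  then show False using halts_prog_code[of X "Mu p" ?e] by blast
qed

text \<open>The number \<open>2 x\<close> in the constructed set puts \<open>x\<close> on one side, \<open>2 x + 1\<close> puts it on the other.
  Requirement \<open>e\<close> defeats the program with code \<open>e\<close> as a separator, by a number of the column \<open>e\<close>.\<close>

abbreviation column :: "nat \<Rightarrow> nat" where "column n \<equiv> left (n div 2)"

text \<open>Zero if the computation of \<open>e\<close> on input \<open>e\<close> does not halt by stage \<open>s\<close>, otherwise a bound
  for its queries. It must not grow with \<open>s\<close>.\<close>

definition restraint :: "nat set \<Rightarrow> nat \<Rightarrow> nat \<Rightarrow> nat" where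
  "restraint D e s = (if halts D s e e then Suc (LEAST t. s \<le> t \<or> halts D t e e) else 0)"

text \<open>The column must not have acted before, and the restraints of all indices up to its own,
  which have priority over it, must be respected. The last clause waits for the output of program
  \<open>column n\<close> on \<open>n div 2\<close>: output 0 sends the number to the even side, any
  other to the odd one. The empty oracle is written \<open>set_decode 0\<close> to match the rules
  for decidability.\<close>

definition enters :: "nat set \<Rightarrow> nat \<Rightarrow> nat \<Rightarrow> bool" where
  "enters D s n \<longleftrightarrow> (\<forall>m<s. m \<in> D \<longrightarrow> column m \<noteq> column n)
     \<and> (\<forall>i\<le>column n. restraint D i s \<le> n)
     \<and> (if even n then triple (column n) (cons_code (n div 2) 0) 0 \<in> run (set_decode 0) s
        else triple (column n) (cons_code (n div 2) 0) 0 \<notin> run (set_decode 0) s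
           \<and> (\<exists>v<s. triple (column n) (cons_code (n div 2) 0) (Suc v) \<in> run (set_decode 0) s))"

primrec low_stage :: "nat \<Rightarrow> nat set" where
  "low_stage 0 = {}"
| "low_stage (Suc s) = {n. n < s \<and> (n \<in> low_stage s \<or> enters (low_stage s) s n)}"

definition low_set :: "nat set" where "low_set = (\<Union>s. low_stage s)"

lemma low_stage_less: "n \<in> low_stage s \<Longrightarrow> n < s"
  by (cases s) auto

lemma finite_low_stage [simp]: "finite (low_stage s)"
  by (rule finite_subset[of _ "{..<s}"]) (auto dest: low_stage_less)

lemma low_stage_mono: "s \<le> s' \<Longrightarrow> low_stage s \<subseteq> low_stage s'"
  by (rule lift_Suc_mono_le[where f = low_stage]) (auto dest: low_stage_less)

lemma computable_restraint [computable_intros]: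
  assumes "computable X f" "computable X g" "computable X h"
  shows "computable X (\<lambda>x. restraint (set_decode (f x)) (g x) (h x))"
proof -
  have "computable X (\<lambda>u. LEAST t. right (right u) \<le> t \<or> halts (set_decode (left u)) t (left (right u)) (left (right u)))"
    by (intro computable_Least computable_intros) auto
  from computable_comp[OF this, of "\<lambda>x. prod_encode (f x, prod_encode (g x, h x))"]
  have "computable X (\<lambda>x. LEAST t. h x \<le> t \<or> halts (set_decode (f x)) t (g x) (g x))"
    by (simp add: computable_intros assms)
  then show ?thesis unfolding restraint_def by (intro computable_intros assms)
qed

lemma computable_low_stage [computable_intros]:
  assumes "computable X f" shows "computable X (\<lambda>x. set_encode (low_stage (f x)))"
proof -
  have "computable X (\<lambda>x. rec_nat 0 (\<lambda>s r. set_encode {n. n < s \<and>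
     (n \<in> set_decode r \<or> enters (set_decode r) s n)}) (f x))"
    unfolding enters_def by (intro computable_intros assms)
  moreover have "rec_nat 0 (\<lambda>s r. set_encode {n. n < s \<and>
     (n \<in> set_decode r \<or> enters (set_decode r) s n)}) m = set_encode (low_stage m)" for m
    by (induction m) simp_all
  ultimately show ?thesis by simp
qed

lemma decidable_low_stage:
  "computable X f \<Longrightarrow> computable X g \<Longrightarrow> decidable X (\<lambda>x. g x \<in> low_stage (f x))"
  using decidable_set_decode[OF _ computable_low_stage, of X g f] by simp

lemma computable_restraint_low_stage:
  "computable X f \<Longrightarrow> computable X g \<Longrightarrow> computable X (\<lambda>x. restraint (low_stage (g x)) (f x) (g x))"
  using computable_restraint[OF computable_low_stage, of X g f g] by simp

lemma re_set_low_set: "re_set low_set"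
proof -
  have "re_set {n. \<exists>s. n \<in> low_stage s}"
    by (intro re_setI decidable_low_stage computable_intros)
  then show ?thesis by (simp add: low_set_def UNION_eq)
qed

definition new :: "nat \<Rightarrow> nat \<Rightarrow> bool" where
  "new n s \<longleftrightarrow> n \<notin> low_stage s \<and> n \<in> low_stage (Suc s)"

lemma new_enters: "new n s \<Longrightarrow> enters (low_stage s) s n"
  by (auto simp: new_def)

lemma low_set_new: "n \<in> low_set \<Longrightarrow> \<exists>s. new n s"
proof -
  assume "n \<in> low_set"
  then obtain s where "n \<in> low_stage s" by (auto simp: low_set_def)
  then show ?thesis
    by (induction s) (simp, unfold new_def, blast)
qed

text \<open>Once a column contains a number it is closed. Several of its numbers may still enter
  together, at the one stage at which it acts.\<close>

lemma new_same_column: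
  assumes "new m s" "new n s'" "column m = column n" shows "s = s'"
proof -
  have "\<not> s < s'" if "new m s" "new n s'" "column m = column n" for m n s s'
  proof
    assume "s < s'"
    then have "m \<in> low_stage s'" using that(1) low_stage_mono[of "Suc s" s'] by (auto simp: new_def)
    with new_enters[OF that(2)] that(3) show False
      by (auto simp: enters_def dest: low_stage_less)
  qed
  from this[OF assms] this[OF assms(2,1)] assms(3) show ?thesis by simp
qed

text \<open>Both numbers lie in the same column and hence would enter at the same stage, where they
  demand contradictory facts about output 0. This works even if the column is not the code of a
  program.\<close>

lemma low_set_disjoint: "\<not> (2 * x \<in> low_set \<and> Suc (2 * x) \<in> low_set)"
proof
  assume "2 * x \<in> low_set \<and> Suc (2 * x) \<in> low_set"
  then obtain s s' where s: "new (2 * x) s" "new (Suc (2 * x)) s'" using low_set_new by blast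
  then have "s = s'" by (rule new_same_column) simp
  with s have "enters (low_stage s) s (2 * x)" "enters (low_stage s) s (Suc (2 * x))"
    by (auto dest: new_enters)
  then show False by (simp add: enters_def)
qed

lemma column_settles: "\<exists>s0. \<forall>s\<ge>s0. \<forall>n. new n s \<longrightarrow> column n \<noteq> j"
proof (cases "\<exists>m s. new m s \<and> column m = j")
  case True
  then obtain m s where "new m s" "column m = j" by blast
  then have "column n \<noteq> j" if "Suc s \<le> s'" "new n s'" for n s'
    using new_same_column[of m s n s'] that by auto
  then show ?thesis by blast
qed blast

text \<open>Each of the columns below \<open>e\<close> acts at one stage at most; afterwards nothing
  of higher priority can injure requirement \<open>e\<close>.\<close>

lemma columns_settle: "\<exists>s0. \<forall>s\<ge>s0. \<forall>n. new n s \<longrightarrow> e \<le> column n"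
proof (induction e)
  case (Suc e)
  then obtain s0 s1 where "\<forall>s\<ge>s0. \<forall>n. new n s \<longrightarrow> e \<le> column n"
    "\<forall>s\<ge>s1. \<forall>n. new n s \<longrightarrow> column n \<noteq> e" using column_settles[of e] by blast
  then have "Suc e \<le> column n" if "max s0 s1 \<le> s" "new n s" for n s
    using that by (metis Suc_leI le_neq_implies_less max.boundedE)
  then show ?case by blast
qed simp

lemma restraint_eq_0: "restraint D e s = 0 \<longleftrightarrow> \<not> halts D s e e"
  by (simp add: restraint_def)

text \<open>A positive value is determined by the first halting stage alone, whatever the current
  stage; this is what can be preserved.\<close>

lemma restraint_eq_Suc:
  "restraint D e s = Suc t \<longleftrightarrow> t \<le> s \<and> halts D t e e \<and> (\<forall>t'<t. \<not> halts D t' e e)"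
proof
  assume *: "restraint D e s = Suc t"
  then have h: "halts D s e e" "t = (LEAST t. s \<le> t \<or> halts D t e e)"
    by (auto simp: restraint_def split: if_splits)
  then have "t \<le> s" by (auto intro: Least_le)
  moreover have "s \<le> t \<or> halts D t e e"
    unfolding h(2) by (rule LeastI[of _ s]) simp
  moreover have "\<forall>t'<t. \<not> halts D t' e e"
    unfolding h(2) using not_less_Least by blast
  ultimately show "t \<le> s \<and> halts D t e e \<and> (\<forall>t'<t. \<not> halts D t' e e)"
    using h(1) by force
next
  assume *: "t \<le> s \<and> halts D t e e \<and> (\<forall>t'<t. \<not> halts D t' e e)"
  then have "halts D s e e" using halts_mono by blast
  moreover have "(LEAST t. s \<le> t \<or> halts D t e e) = t"
    using * by (intro Least_equality) (auto simp: not_less[symmetric])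
  ultimately show "restraint D e s = Suc t" by (simp add: restraint_def)
qed

text \<open>When only columns from \<open>e\<close> on are active, every newcomer respects the
  restraint of \<open>e\<close>. So once positive it protects the oracle below the first halting
  stage and stays as it is; otherwise it is 0 for ever.\<close>

lemma restraint_converges:
  "\<exists>s0. \<forall>s\<ge>s0. restraint (low_stage s) e s = restraint (low_stage s0) e s0"
proof -
  obtain s0 where s0: "\<And>s n. s0 \<le> s \<Longrightarrow> new n s \<Longrightarrow> e \<le> column n" using columns_settle by blast
  have step: "restraint (low_stage (Suc s)) e (Suc s) = Suc t"
    if s: "s0 \<le> s" and r: "restraint (low_stage s) e s = Suc t" for s t
  proof -
    have "Suc t \<le> n" if "new n s" for n
      using new_enters[OF that] s0[OF s that] r unfolding enters_def by metis
    then have "n \<in> low_stage s \<longleftrightarrow> n \<in> low_stage (Suc s)" if "n < Suc t" for n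
      using low_stage_mono[of s "Suc s"] that unfolding new_def by fastforce
    then have "low_stage s \<inter> {..<t'} = low_stage (Suc s) \<inter> {..<t'}" if "t' \<le> t" for t'
      using that by (auto simp del: low_stage.simps)
    from halts_use[OF this] have "halts (low_stage s) t' e e = halts (low_stage (Suc s)) t' e e"
      if "t' \<le> t" for t' using that by blast
    then show ?thesis using r unfolding restraint_eq_Suc by auto
  qed
  show ?thesis
  proof (cases "\<exists>s1\<ge>s0. restraint (low_stage s1) e s1 \<noteq> 0")
    case True
    then obtain s1 t where s1: "s0 \<le> s1" "restraint (low_stage s1) e s1 = Suc t"
      using not0_implies_Suc by blast
    have "restraint (low_stage s) e s = Suc t" if "s1 \<le> s" for s
      using that by (induction s rule: dec_induct) (use s1 step in auto)
    then show ?thesis using s1(2) by (intro exI[of _ s1]) simp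
  next
    case False
    then show ?thesis by (intro exI[of _ s0]) simp
  qed
qed

lemma restraint_bounded: "\<exists>b. \<forall>i\<le>e. \<forall>s. restraint (low_stage s) i s \<le> b"
proof -
  have "\<exists>b. \<forall>s. restraint (low_stage s) i s \<le> b" for i
  proof -
    obtain s0 where s0: "\<And>s. s0 \<le> s \<Longrightarrow> restraint (low_stage s) i s = restraint (low_stage s0) i s0"
      using restraint_converges by blast
    let ?R = "(\<lambda>s. restraint (low_stage s) i s) ` {..s0}"
    have "restraint (low_stage s) i s \<in> ?R" for s
      using s0[of s] by (cases "s0 \<le> s") auto
    then show ?thesis by (intro exI[of _ "Max ?R"] allI Max_ge) auto
  qed
  then obtain b where b: "\<And>i s. restraint (low_stage s) i s \<le> b i" by metis
  show ?thesis
    by (rule exI[of _ "Max (b ` {..e})"]) (auto intro: le_trans[OF b] Max_ge)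
qed

text \<open>Either the column of the program acts, and its number then contradicts the output; or it
  never acts, and a number of the column beyond all relevant restraints would be allowed to enter at
  a late stage.\<close>

lemma low_set_inseparable:
  assumes "computable {} f"
  shows "\<exists>x. 2 * x \<in> low_set \<and> f x = 0 \<or> Suc (2 * x) \<in> low_set \<and> f x \<noteq> 0"
proof -
  obtain p where p: "\<And>x. computes {} p [x] (f x)" using assms unfolding computable_def by blast
  define e where "e = prog_code p"
  have val: "v = f x" if "triple e (cons_code x 0) v \<in> run {} s" for x v s
    using run_sound[of p "[x]" v "{}" s] that computes_deterministic[OF p] by (auto simp: e_def)
  show ?thesis
  proof (cases "\<exists>n s. new n s \<and> column n = e")
    case True
    then obtain n s where n: "new n s" "column n = e" by blast
    then have "n \<in> low_set" unfolding new_def low_set_def by blast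
    have enters: "enters (low_stage s) s n" by (rule new_enters[OF n(1)])
    have "2 * (n div 2) \<in> low_set \<and> f (n div 2) = 0
        \<or> Suc (2 * (n div 2)) \<in> low_set \<and> f (n div 2) \<noteq> 0"
    proof (cases "even n")
      case True
      then have "f (n div 2) = 0" using enters val[of "n div 2" 0 s] by (simp add: enters_def n(2))
      then show ?thesis using True \<open>n \<in> low_set\<close> by simp
    next
      case False
      then obtain v where "f (n div 2) = Suc v"
        using enters val[of "n div 2" "Suc _" s] by (force simp: enters_def n(2))
      then show ?thesis using False \<open>n \<in> low_set\<close> by simp
    qed
    then show ?thesis by blast
  next
    case False
    obtain b where b: "\<And>i s. i \<le> e \<Longrightarrow> restraint (low_stage s) i s \<le> b"
      using restraint_bounded by blast
    \<comment> \<open>The first component places the number in column \<open>e\<close>, the second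
      makes it at least \<open>b\<close>, which bounds the restraints of indices up to
      \<open>e\<close>.\<close>
    define x where "x = prod_encode (e, b)"
    define n where "n = (if f x = 0 then 2 * x else Suc (2 * x))"
    have n: "n div 2 = x" "even n \<longleftrightarrow> f x = 0" "b \<le> n"
      using le_prod_encode_2[of b e] by (auto simp: n_def x_def)
    have col: "column m \<noteq> e" if "m \<in> low_stage s" for m s
      using low_set_new[of m] that False by (auto simp: low_set_def)
    obtain s0 where "triple e (list_encode [x]) (f x) \<in> run {} s0"
      using run_complete[OF p] unfolding e_def by blast
    then have r: "triple e (cons_code x 0) (f x) \<in> run {} s" if "s0 \<le> s" for s
      using run_mono[OF that] by auto
    define s where "s = max s0 (Suc n)"
    have "s0 \<le> s" "n < s" by (auto simp: s_def)
    have "triple e (cons_code x 0) 0 \<notin> run {} s" if "f x \<noteq> 0" using val that by metis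
    moreover have "\<exists>v<s. triple e (cons_code x 0) (Suc v) \<in> run {} s" if "f x \<noteq> 0"
      using r[OF \<open>s0 \<le> s\<close>] triple_bound[OF r[OF \<open>s0 \<le> s\<close>]] that
      by (intro exI[of _ "f x - 1"]) auto
    moreover have "restraint (low_stage s) i s \<le> n" if "i \<le> e" for i
      using b[OF that] n(3) le_trans by blast
    moreover have "column n = e" by (simp add: n(1)) (simp add: x_def)
    ultimately have "enters (low_stage s) s n"
      unfolding enters_def n(1,2) using col[of _ s] r[OF \<open>s0 \<le> s\<close>] by (auto simp: x_def)
    then have "n \<in> low_stage (Suc s)" using \<open>n < s\<close> by simp
    with col \<open>column n = e\<close> show ?thesis by blast
  qed
qed

lemma low_stage_settles: "\<exists>s0. \<forall>s\<ge>s0. low_stage s \<inter> {..<t} = low_set \<inter> {..<t}"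
proof -
  have "finite A \<Longrightarrow> A \<subseteq> low_set \<Longrightarrow> \<exists>s. A \<subseteq> low_stage s" for A
  proof (induction A rule: finite_induct)
    case (insert a A)
    then obtain s s' where "A \<subseteq> low_stage s" "a \<in> low_stage s'" by (auto simp: low_set_def)
    then have "insert a A \<subseteq> low_stage (max s s')"
      using low_stage_mono[of s "max s s'"] low_stage_mono[of s' "max s s'"] by auto
    then show ?case by blast
  qed simp
  from this[of "low_set \<inter> {..<t}"] obtain s0 where "low_set \<inter> {..<t} \<subseteq> low_stage s0" by auto
  then have "low_stage s \<inter> {..<t} = low_set \<inter> {..<t}" if "s0 \<le> s" for s
    using low_stage_mono[OF that] by (auto simp: low_set_def)
  then show ?thesis by blast
qed

text \<open>A halting computation sees the oracle only below its own stage, and there the finite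
  approximations eventually agree with \<open>low_set\<close>.\<close>

lemma jump_low_set_limit:
  assumes lim: "\<And>s. s0 \<le> s \<Longrightarrow> restraint (low_stage s) e s = restraint (low_stage s0) e s0"
  shows "restraint (low_stage s0) e s0 \<noteq> 0 \<longleftrightarrow> (\<exists>t. halts low_set t e e)"
proof
  assume "restraint (low_stage s0) e s0 \<noteq> 0"
  then obtain t where t: "\<And>s. s0 \<le> s \<Longrightarrow> restraint (low_stage s) e s = Suc t"
    using lim not0_implies_Suc by metis
  obtain s1 where s1: "\<And>s. s1 \<le> s \<Longrightarrow> low_stage s \<inter> {..<t} = low_set \<inter> {..<t}"
    using low_stage_settles by blast
  have "halts (low_stage (max s0 s1)) t e e" using t[of "max s0 s1"] by (simp add: restraint_eq_Suc)
  then show "\<exists>t. halts low_set t e e" using halts_use[OF s1[of "max s0 s1"]] max.cobounded2[of s1 s0] by blast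
next
  assume "\<exists>t. halts low_set t e e"
  then obtain t where t: "halts low_set t e e" by blast
  obtain s1 where s1: "\<And>s. s1 \<le> s \<Longrightarrow> low_stage s \<inter> {..<t} = low_set \<inter> {..<t}"
    using low_stage_settles by blast
  define s where "s = max (max s0 s1) t"
  have "s1 \<le> s" by (simp add: s_def)
  then have "halts (low_stage s) t e e" using t halts_use[OF s1] by blast
  then have "halts (low_stage s) s e e" by (rule halts_mono) (simp add: s_def)
  then have "restraint (low_stage s) e s \<noteq> 0" by (simp add: restraint_eq_0)
  then show "restraint (low_stage s0) e s0 \<noteq> 0" using lim[of s] by (auto simp: s_def)
qed

text \<open>Relative to a complete set the modulus of convergence of the restraints is computable,
  hence a complete \<open>low_set\<close> would compute its own jump.\<close>

lemma halting_set_not_le_low_set: "\<not> decidable low_set (\<lambda>x. x \<in> halting_set)"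
proof
  assume complete: "decidable low_set (\<lambda>x. x \<in> halting_set)"
  let ?r = "\<lambda>e s. restraint (low_stage s) e s"
  \<comment> \<open>\<open>C\<close> collects the pairs of \<open>e\<close> and \<open>s\<close>
    such that the restraint of \<open>e\<close> at some later stage differs from that at
    \<open>s\<close>. It is RE, so a complete oracle decides it, and the least \<open>s\<close>
    outside is a modulus of convergence.\<close>
  define C where "C = {u. \<exists>t. right u \<le> t \<and> ?r (left u) t \<noteq> ?r (left u) (right u)}"
  have "re_set C" unfolding C_def
    by (intro re_setI computable_intros computable_restraint_low_stage)
  then have C: "decidable low_set (\<lambda>u. u \<in> C)"
    by (rule decidable_trans[OF re_set_le_halting_set complete])
  define m where "m e = (LEAST s. prod_encode (e, s) \<notin> C)" for e
  have C_iff: "prod_encode (e, s) \<in> C \<longleftrightarrow> (\<exists>t. s \<le> t \<and> ?r e t \<noteq> ?r e s)" for e s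
    by (simp add: C_def)
  have ex: "\<exists>s. prod_encode (e, s) \<notin> C" for e
    using restraint_converges[of e] unfolding C_iff by blast
  have "computable low_set m" unfolding m_def
    by (intro computable_Least computable_intros decidable_comp[OF C] ex)
  then have "decidable low_set (\<lambda>e. ?r e (m e) \<noteq> 0)"
    by (intro computable_intros computable_restraint_low_stage)
  moreover have "?r e (m e) \<noteq> 0 \<longleftrightarrow> (\<exists>t. halts low_set t e e)" for e
  proof (rule jump_low_set_limit)
    have "prod_encode (e, m e) \<notin> C" unfolding m_def using ex by (rule LeastI_ex)
    then show "?r e s = ?r e (m e)" if "m e \<le> s" for s using that unfolding C_iff by blast
  qed
  ultimately show False using jump_not_decidable[of low_set] by simp
qed

section \<open>First-order logic\<close>

subsection \<open>Substitution\<close>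

abbreviation shift :: "tm \<Rightarrow> tm" where "shift \<equiv> subst_tm (\<lambda>m. Var (Suc m))"

lemma subst_tm_cong: "tm_in L k t \<Longrightarrow> (\<And>i. i < k \<Longrightarrow> \<sigma> i = \<tau> i) \<Longrightarrow> subst_tm \<sigma> t = subst_tm \<tau> t"
  by (induction t) auto

lemma subst_fm_cong: "fm_in L k \<phi> \<Longrightarrow> (\<And>i. i < k \<Longrightarrow> \<sigma> i = \<tau> i) \<Longrightarrow> subst_fm \<sigma> \<phi> = subst_fm \<tau> \<phi>"
proof (induction \<phi> arbitrary: k \<sigma> \<tau>)
  case (All \<phi>)
  have "up \<sigma> i = up \<tau> i" if "i < Suc k" for i
    using that All.prems(2) by (auto simp: up_def split: nat.split)
  with All.IH[of "Suc k" "up \<sigma>" "up \<tau>"] All.prems(1) show ?case by simp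
next
  case (Imp \<phi> \<psi>)
  then show ?case by (metis fm_in.simps(4) subst_fm.simps(4))
qed (auto intro: subst_tm_cong)

lemma subst_tm_Var [simp]: "subst_tm Var t = t"
  by (induction t) (auto intro: map_idI)

lemma up_Var [simp]: "up Var = Var"
  by (auto simp: up_def fun_eq_iff split: nat.split)

lemma subst_fm_Var [simp]: "subst_fm Var \<phi> = \<phi>"
  by (induction \<phi>) (auto intro: map_idI)

lemma subst_sentence: "sentence L \<phi> \<Longrightarrow> subst_fm \<sigma> \<phi> = \<phi>"
  using subst_fm_cong[of L 0 \<phi> \<sigma> Var] by simp

lemma lift_sentence: "sentence L \<phi> \<Longrightarrow> lift \<phi> = \<phi>"
  unfolding lift_def by (rule subst_sentence)

lemma subst_tm_subst_tm: "subst_tm \<sigma> (subst_tm \<tau> t) = subst_tm (\<lambda>n. subst_tm \<sigma> (\<tau> n)) t"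
  by (induction t) auto

lemma up_comp: "(\<lambda>n. subst_tm (up \<sigma>) (up \<tau> n)) = up (\<lambda>n. subst_tm \<sigma> (\<tau> n))"
  by (auto simp: up_def fun_eq_iff subst_tm_subst_tm split: nat.split)

lemma subst_fm_subst_fm: "subst_fm \<sigma> (subst_fm \<tau> \<phi>) = subst_fm (\<lambda>n. subst_tm \<sigma> (\<tau> n)) \<phi>"
  by (induction \<phi> arbitrary: \<sigma> \<tau>) (auto simp: subst_tm_subst_tm up_comp)

lemma tm_in_subst_tm:
  "tm_in L k t \<Longrightarrow> (\<And>i. i < k \<Longrightarrow> tm_in L m (\<sigma> i)) \<Longrightarrow> tm_in L m (subst_tm \<sigma> t)"
  by (induction t) auto

lemma fm_in_subst_fm:
  "fm_in L k \<phi> \<Longrightarrow> (\<And>i. i < k \<Longrightarrow> tm_in L m (\<sigma> i)) \<Longrightarrow> fm_in L m (subst_fm \<sigma> \<phi>)"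
proof (induction \<phi> arbitrary: k m \<sigma>)
  case (All \<phi>)
  have "tm_in L (Suc m) (up \<sigma> i)" if "i < Suc k" for i
    using that All.prems(2)
    by (auto simp: up_def less_Suc_eq_0_disj intro!: tm_in_subst_tm[where k = m and L = L])
  with All.IH[of "Suc k" "Suc m" "up \<sigma>"] All.prems(1) show ?case by simp
next
  case (Imp \<phi> \<psi>)
  then show ?case by (metis fm_in.simps(4) subst_fm.simps(4))
qed (auto intro: tm_in_subst_tm)

lemma subst_num [simp]: "subst_tm \<sigma> (num n) = num n"
  by (induction n) auto

lemma tm_in_num: "has_numerals L \<Longrightarrow> tm_in L k (num n)"
  by (induction n) (auto simp: has_numerals_def)

lemma subst_tm_case_nat_shift [simp]: "subst_tm (case_nat u \<sigma>) (shift t) = subst_tm \<sigma> t"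
  by (simp add: subst_tm_subst_tm)

subsection \<open>Derivations\<close>

lemma weaken: "\<Gamma> \<turnstile> \<phi> \<Longrightarrow> \<Gamma> \<subseteq> \<Delta> \<Longrightarrow> \<Delta> \<turnstile> \<phi>"
proof (induction arbitrary: \<Delta> rule: provable.induct)
  case (imp_intro \<phi> \<Gamma> \<psi>)
  then show ?case by (meson insert_mono provable.imp_intro)
next
  case (classical \<phi> \<Gamma>)
  then show ?case by (meson insert_mono provable.classical)
next
  case (all_intro \<Gamma> \<phi>)
  then show ?case by (meson image_mono provable.all_intro)
qed (blast intro: provable.intros)+

lemma ex_falso: "\<Gamma> \<turnstile> Fls \<Longrightarrow> \<Gamma> \<turnstile> \<phi>"
  by (rule classical) (erule weaken, blast)

lemma neg_elim: "\<Gamma> \<turnstile> Neg \<phi> \<Longrightarrow> \<Gamma> \<turnstile> \<phi> \<Longrightarrow> \<Gamma> \<turnstile> \<psi>"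
  by (rule ex_falso) (rule imp_elim)

lemma cut: "insert \<phi> \<Gamma> \<turnstile> \<psi> \<Longrightarrow> \<Gamma> \<turnstile> \<phi> \<Longrightarrow> \<Gamma> \<turnstile> \<psi>"
  by (rule imp_elim[OF imp_intro])

lemma case_split:
  assumes "insert \<phi> \<Gamma> \<turnstile> \<psi>" "insert (Neg \<phi>) \<Gamma> \<turnstile> \<psi>"
  shows "\<Gamma> \<turnstile> \<psi>"
proof (rule classical)
  let ?\<Delta> = "insert (Neg \<psi>) \<Gamma>"
  have "insert \<phi> ?\<Delta> \<turnstile> Fls"
    by (rule imp_elim[OF assm weaken[OF assms(1)]]) auto
  then have "?\<Delta> \<turnstile> Neg \<phi>" by (rule imp_intro)
  then have "?\<Delta> \<turnstile> \<psi>" by (rule cut[rotated]) (rule weaken[OF assms(2)], blast)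
  then show "?\<Delta> \<turnstile> Fls" by (rule imp_elim[OF assm, rotated]) simp
qed

lemma conj_elim1: "\<Gamma> \<turnstile> Conj \<phi> \<psi> \<Longrightarrow> \<Gamma> \<turnstile> \<phi>"
proof (rule classical)
  assume *: "\<Gamma> \<turnstile> Conj \<phi> \<psi>"
  have "insert (Neg \<phi>) \<Gamma> \<turnstile> Imp \<phi> (Neg \<psi>)"
    by (rule imp_intro, rule neg_elim[of _ \<phi>]) (simp_all add: assm)
  then show "insert (Neg \<phi>) \<Gamma> \<turnstile> Fls" by (rule imp_elim[rotated]) (rule weaken[OF *], blast)
qed

lemma conj_elim2: "\<Gamma> \<turnstile> Conj \<phi> \<psi> \<Longrightarrow> \<Gamma> \<turnstile> \<psi>"
proof (rule classical)
  assume *: "\<Gamma> \<turnstile> Conj \<phi> \<psi>"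
  have "insert (Neg \<psi>) \<Gamma> \<turnstile> Imp \<phi> (Neg \<psi>)"
    by (rule imp_intro) (simp add: assm)
  then show "insert (Neg \<psi>) \<Gamma> \<turnstile> Fls" by (rule imp_elim[rotated]) (rule weaken[OF *], blast)
qed

lemma lift_image_sentences:
  assumes "\<And>\<phi>. \<phi> \<in> T \<Longrightarrow> sentence L \<phi>" shows "lift ` T = T"
proof -
  have "lift \<phi> = \<phi>" if "\<phi> \<in> T" for \<phi> using lift_sentence[OF assms[OF that]] .
  then show ?thesis by simp
qed

text \<open>All axioms of \<open>T\<close> are cut at once, inside the derivation. Side assumptions
  are collected in \<Gamma>, which quantifier introduction lifts, while the two theories stay fixed
  as sets.\<close>

lemma extendsI:
  assumes T: "\<And>\<phi>. \<phi> \<in> T \<Longrightarrow> lift \<phi> = \<phi>" and S: "lift ` S = S" and ST: "\<And>\<phi>. \<phi> \<in> T \<Longrightarrow> S \<turnstile> \<phi>"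
  shows "extends S T"
proof -
  have "\<Delta> \<turnstile> \<phi> \<Longrightarrow> \<Delta> \<subseteq> \<Gamma> \<union> T \<Longrightarrow> \<Gamma> \<union> S \<turnstile> \<phi>" for \<Delta> \<Gamma> \<phi>
  proof (induction arbitrary: \<Gamma> rule: provable.induct)
    case (assm \<phi> \<Delta>)
    then show ?case
      using provable.assm[of \<phi> "\<Gamma> \<union> S"] weaken[OF ST, of \<phi> "\<Gamma> \<union> S"] by blast
  next
    case (imp_intro \<phi> \<Delta> \<psi>)
    have "insert \<phi> \<Gamma> \<union> S \<turnstile> \<psi>" by (rule imp_intro.IH) (use imp_intro.prems in blast)
    then show ?case by (simp add: provable.imp_intro)
  next
    case (classical \<phi> \<Delta>)
    have "insert (Neg \<phi>) \<Gamma> \<union> S \<turnstile> Fls" by (rule classical.IH) (use classical.prems in blast)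
    then show ?case by (simp add: provable.classical)
  next
    case (all_intro \<Delta> \<phi>)
    have "lift ` \<Gamma> \<union> S \<turnstile> \<phi>" by (rule all_intro.IH) (use all_intro.prems T in force)
    then show ?case by (intro provable.all_intro) (simp add: image_Un S)
  qed (blast intro: provable.intros)+
  from this[of T _ "{}"] show ?thesis unfolding extends_def by simp
qed

lemma con_re_theory_lift: "con_re_theory L T \<Longrightarrow> lift ` T = T"
  unfolding con_re_theory_def re_theory_def by (intro lift_image_sentences) blast

subsection \<open>Soundness\<close>

fun evt :: "(nat \<Rightarrow> 'a list \<Rightarrow> 'a) \<Rightarrow> (nat \<Rightarrow> 'a) \<Rightarrow> tm \<Rightarrow> 'a" where
  "evt I env (Var n) = env n"
| "evt I env (Fun f ts) = I f (map (evt I env) ts)"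

fun sat :: "(nat \<Rightarrow> 'a list \<Rightarrow> 'a) \<Rightarrow> (nat \<Rightarrow> 'a list \<Rightarrow> bool) \<Rightarrow> (nat \<Rightarrow> 'a) \<Rightarrow> fm \<Rightarrow> bool" where
  "sat I R env (Eq t u) \<longleftrightarrow> evt I env t = evt I env u"
| "sat I R env (Rel r ts) \<longleftrightarrow> R r (map (evt I env) ts)"
| "sat I R env Fls \<longleftrightarrow> False"
| "sat I R env (Imp \<phi> \<psi>) \<longleftrightarrow> (sat I R env \<phi> \<longrightarrow> sat I R env \<psi>)"
| "sat I R env (All \<phi>) \<longleftrightarrow> (\<forall>d. sat I R (case_nat d env) \<phi>)"

lemma evt_subst: "evt I env (subst_tm \<sigma> t) = evt I (\<lambda>n. evt I env (\<sigma> n)) t"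
  by (induction t) (auto simp: comp_def cong: map_cong)

lemma evt_up: "(\<lambda>n. evt I (case_nat d env) (up \<sigma> n)) = case_nat d (\<lambda>n. evt I env (\<sigma> n))"
  by (auto simp: up_def fun_eq_iff evt_subst split: nat.split)

lemma sat_subst: "sat I R env (subst_fm \<sigma> \<phi>) \<longleftrightarrow> sat I R (\<lambda>n. evt I env (\<sigma> n)) \<phi>"
  by (induction \<phi> arbitrary: env \<sigma>) (simp_all add: evt_subst evt_up comp_def)

lemma sat_inst: "sat I R env (inst t \<phi>) \<longleftrightarrow> sat I R (case_nat (evt I env t) env) \<phi>"
proof -
  have "(\<lambda>n. evt I env (case_nat t Var n)) = case_nat (evt I env t) env"
    by (auto simp: fun_eq_iff split: nat.split)
  then show ?thesis by (simp add: inst_def sat_subst)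
qed

lemma soundness: "\<Gamma> \<turnstile> \<phi> \<Longrightarrow> (\<And>\<gamma>. \<gamma> \<in> \<Gamma> \<Longrightarrow> sat I R env \<gamma>) \<Longrightarrow> sat I R env \<phi>"
proof (induction arbitrary: env rule: provable.induct)
  case (imp_intro \<phi> \<Gamma> \<psi>)
  then show ?case by (metis insert_iff sat.simps(4))
next
  case (classical \<phi> \<Gamma>)
  then show ?case by (metis insert_iff sat.simps(3,4))
next
  case (all_intro \<Gamma> \<phi>)
  have "sat I R (case_nat d env) (lift \<gamma>) \<longleftrightarrow> sat I R env \<gamma>" for d \<gamma>
    by (simp add: lift_def sat_subst)
  with all_intro show ?case by simp blast
next
  case (all_elim \<Gamma> \<phi> t)
  then show ?case by (auto simp: sat_inst)
next
  case (eq_elim \<Gamma> t u \<phi>)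
  then show ?case by (metis sat.simps(1) sat_inst)
qed auto

subsection \<open>Codes of terms and formulas\<close>

lemma tm_code_inject: "tm_code t = tm_code u \<Longrightarrow> t = u"
proof (induction t arbitrary: u)
  case (Var n)
  then show ?case by (cases u) auto
next
  case (Fun f ts)
  then obtain us where u: "u = Fun f us" by (cases u) auto
  with Fun.prems have "map tm_code ts = map tm_code us" by (simp add: list_encode_eq)
  from list.inj_map_strong[OF Fun.IH this] show ?case by (simp add: u)
qed

lemma fm_code_inject: "fm_code \<phi> = fm_code \<psi> \<Longrightarrow> \<phi> = \<psi>"
proof (induction \<phi> arbitrary: \<psi>)
  case (Eq t u)
  then show ?case by (cases \<psi>) (auto intro: tm_code_inject)
next
  case (Rel r ts)
  then obtain us where \<psi>: "\<psi> = Rel r us" by (cases \<psi>) auto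
  with Rel.prems have "map tm_code ts = map tm_code us" by (simp add: list_encode_eq)
  from list.inj_map_strong[OF tm_code_inject this] show ?case by (simp add: \<psi>)
next
  case Fls
  then show ?case by (cases \<psi>) auto
next
  case (Imp \<phi>1 \<phi>2)
  then show ?case by (cases \<psi>) auto
next
  case (All \<phi>)
  then show ?case by (cases \<psi>) auto
qed

lemma mem_theorem_codes: "fm_code \<phi> \<in> theorem_codes L T \<longleftrightarrow> sentence L \<phi> \<and> T \<turnstile> \<phi>"
  unfolding theorem_codes_def by (auto dest: fm_code_inject)

lemma computable_num_code [computable_intros]:
  assumes "computable X f" shows "computable X (\<lambda>x. tm_code (num (f x)))"
proof -
  \<comment> \<open>A function symbol has its name plus one as tag, so
    \<open>prod_encode (2, cons_code r 0)\<close> codes the successor applied to the term with code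
    \<open>r\<close>.\<close>
  have "computable X (\<lambda>x. rec_nat (tm_code (num 0)) (\<lambda>n r. prod_encode (2, cons_code r 0)) (f x))"
    by (intro computable_intros assms)
  moreover have "rec_nat (tm_code (num 0)) (\<lambda>n r. prod_encode (2, cons_code r 0)) m = tm_code (num m)"
    for m by (induction m) simp_all
  ultimately show ?thesis by simp
qed

subsection \<open>Strong representability implies essential undecidability\<close>

lemma provable_num_Imp_iff:
  assumes T: "lift ` T = T" and \<phi>: "fm_in L 1 \<phi>"
  shows "T \<turnstile> All (Imp (Eq (Var 0) (num n)) \<phi>) \<longleftrightarrow> T \<turnstile> inst (num n) \<phi>"
proof
  assume "T \<turnstile> All (Imp (Eq (Var 0) (num n)) \<phi>)"
  from all_elim[OF this, of "num n"] have "T \<turnstile> Imp (Eq (num n) (num n)) (inst (num n) \<phi>)"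
    by (simp add: inst_def)
  then show "T \<turnstile> inst (num n) \<phi>" by (rule imp_elim) (rule eq_intro)
next
  assume *: "T \<turnstile> inst (num n) \<phi>"
  let ?G = "insert (Eq (Var 0) (num n)) T"
  \<comment> \<open>Symmetry of equality comes from replacement in
    \<open>Eq (Var 0) (Var 1)\<close>, whose second variable is merely lowered to
    \<open>Var 0\<close>.\<close>
  have "?G \<turnstile> Eq (num n) (Var 0)"
    using eq_elim[of ?G "Var 0" "num n" "Eq (Var 0) (Var 1)"] by (simp add: inst_def eq_intro assm)
  then have "?G \<turnstile> inst (Var 0) \<phi>"
    by (rule eq_elim) (rule weaken[OF *], blast)
  also have "inst (Var 0) \<phi> = \<phi>"
    unfolding inst_def using subst_fm_cong[OF \<phi>, of "case_nat (Var 0) Var" Var] by simp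
  finally show "T \<turnstile> All (Imp (Eq (Var 0) (num n)) \<phi>)"
    by (intro all_intro imp_intro) (simp add: T)
qed

text \<open>Diagonalisation needs no substitution on codes: \<open>\<phi>(n)\<close> is replaced by the equivalent
  sentence \<open>\<forall>x. x = n \<longrightarrow> \<phi>(x)\<close>.\<close>

lemma RSS_imp_EU:
  assumes L: "has_numerals L" and RSS: "RSS L T"
  shows "EU L T"
  unfolding EU_def
proof (intro allI impI notI)
  fix S assume S: "con_re_theory L S \<and> extends S T" and dec: "decidable_theory L S"
  \<comment> \<open>On the code of \<phi> this is the code of
    \<open>All (Imp (Eq (Var 0) (num n)) \<phi>)\<close>, with tags 4, 3 and 0 for
    \<open>All\<close>, \<open>Imp\<close> and \<open>Eq\<close>. A formula representing the set
    \<open>A\<close> of numbers whose diagonal sentence is not a theorem of \<open>S\<close> is then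
    applied to its own code.\<close>
  define g where "g n = prod_encode (4, prod_encode (3, prod_encode
     (prod_encode (0, prod_encode (tm_code (Var 0), tm_code (num n))), n)))" for n
  define A where "A = {n. g n \<notin> theorem_codes L S}"
  have "recursive_set A"
    unfolding recursive_set_iff A_def g_def mem_Collect_eq
    by (intro computable_intros decidable_comp[OF dec[unfolded decidable_theory_def recursive_set_iff]])
  then obtain \<phi> where \<phi>: "fm_in L 1 \<phi>" and
    rep: "\<And>n. n \<in> A \<Longrightarrow> T \<turnstile> inst (num n) \<phi>" "\<And>n. n \<notin> A \<Longrightarrow> T \<turnstile> Neg (inst (num n) \<phi>)"
    using RSS unfolding RSS_def strongly_representable_def by blast
  define n where "n = fm_code \<phi>"
  have "g n = fm_code (All (Imp (Eq (Var 0) (num n)) \<phi>))" by (simp add: g_def n_def)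
  moreover have "sentence L (All (Imp (Eq (Var 0) (num n)) \<phi>))"
    using \<phi> by (simp add: tm_in_num[OF L])
  moreover have "lift ` S = S" using S con_re_theory_lift by blast
  ultimately have A: "n \<in> A \<longleftrightarrow> \<not> S \<turnstile> inst (num n) \<phi>"
    using provable_num_Imp_iff[OF _ \<phi>, of S n] unfolding A_def mem_Collect_eq
    by (metis mem_theorem_codes)
  have "S \<turnstile> Fls"
  proof (cases "n \<in> A")
    case True
    then show ?thesis using rep(1)[OF True] S A unfolding extends_def by blast
  next
    case False
    then have "S \<turnstile> Neg (inst (num n) \<phi>)" using rep(2)[OF False] S unfolding extends_def by blast
    moreover have "S \<turnstile> inst (num n) \<phi>" using A False by blast
    ultimately show ?thesis by (rule imp_elim)
  qed
  then show False using S unfolding con_re_theory_def consistent_def by blast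
qed

text \<open>A formula for the characteristic function, with value 1 plugged in, represents the set
  strongly. Outside the set it would give \<open>1 = 0\<close>, which the inequality of the numerals
  refutes.\<close>

lemma RFD_imp_RSS:
  assumes L: "has_numerals L" and RFD: "RFD L T" and neq: "T \<turnstile> Neg (Eq (num 0) (num 1))"
  shows "RSS L T"
  unfolding RSS_def
proof (intro allI impI)
  fix A assume "recursive_set A"
  define f where "f xs = (if hd xs \<in> A then 1 else 0::nat)" for xs
  have "recursive_fun 1 f" using \<open>recursive_set A\<close> by (simp add: recursive_set_def f_def[abs_def])
  then have "definable_fun L T 1 f" using RFD unfolding RFD_def by blast
  then obtain \<phi> where \<phi>: "fm_in L 2 \<phi>" and
    *: "\<And>as. length as = 1 \<Longrightarrow> T \<turnstile> All (Iff (subst_fm (case_nat (Var 0) (\<lambda>i. num (as ! i))) \<phi>)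
                        (Eq (Var 0) (num (f as))))"
    unfolding definable_fun_def by (auto simp: numeral_2_eq_2)
  \<comment> \<open>Instantiation removes the value variable and lowers the argument from variable 1
    to variable 0.\<close>
  define \<psi> where "\<psi> = inst (num 1) \<phi>"
  have "fm_in L 1 \<psi>" unfolding \<psi>_def inst_def
    by (rule fm_in_subst_fm[OF \<phi>]) (auto simp: numeral_2_eq_2 less_Suc_eq intro: tm_in_num[OF L] simp del: num.simps)
  moreover have iff: "T \<turnstile> Iff (inst (num a) \<psi>) (Eq (num 1) (num (f [a])))" for a
  proof -
    have "inst (num 1) (subst_fm (case_nat (Var 0) (\<lambda>i. num ([a] ! i))) \<phi>) = inst (num a) \<psi>"
      unfolding \<psi>_def inst_def subst_fm_subst_fm
      by (rule subst_fm_cong[OF \<phi>]) (auto simp: numeral_2_eq_2 less_Suc_eq simp del: num.simps)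
    then show ?thesis
      using all_elim[OF *[of "[a]"], of "num 1"] by (simp add: inst_def del: num.simps)
  qed
  moreover have "T \<turnstile> inst (num a) \<psi>" if "a \<in> A" for a
    using imp_elim[OF conj_elim2[OF iff[of a]]] that by (simp add: f_def eq_intro del: num.simps)
  moreover have "T \<turnstile> Neg (inst (num a) \<psi>)" if "a \<notin> A" for a
  proof (rule imp_intro)
    let ?G = "insert (inst (num a) \<psi>) T"
    have "?G \<turnstile> Imp (inst (num a) \<psi>) (Eq (num 1) (num 0))"
      using weaken[OF conj_elim1[OF iff[of a]], of ?G] that by (auto simp: f_def simp del: num.simps)
    then have "?G \<turnstile> Eq (num 1) (num 0)" by (rule imp_elim) (simp add: assm)
    then have "?G \<turnstile> Eq (num 0) (num 1)"
      using eq_elim[of ?G "num 1" "num 0" "Eq (Var 0) (num 1)"] by (simp add: inst_def eq_intro del: num.simps)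
    then show "?G \<turnstile> Fls" by (rule imp_elim[rotated]) (rule weaken[OF neq], blast)
  qed
  ultimately show "strongly_representable L T A"
    unfolding strongly_representable_def by blast
qed

section \<open>Theories of literals\<close>

definition pred_lang :: lang where
  "pred_lang = \<lparr>funs = {(0, 0), (1, 1)}, rels = UNIV \<times> {1}\<rparr>"

lemma pred_lang_simps [simp]: "funs pred_lang = {(0, 0), (1, 1)}" "rels pred_lang = UNIV \<times> {1}"
  by (simp_all add: pred_lang_def)

lemma has_numerals_pred_lang: "has_numerals pred_lang"
  by (simp add: has_numerals_def)

lemma recursive_lang_pred_lang: "recursive_lang pred_lang"
proof -
  have "x \<in> prod_encode ` (UNIV \<times> {1}) \<longleftrightarrow> right x = 1" for x
    by (auto simp: image_iff) (metis prod.collapse prod_decode_inverse)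
  then show ?thesis
    unfolding recursive_lang_def recursive_set_iff pred_lang_simps image_insert image_empty insert_iff empty_iff
    by (simp only:) (intro conjI computable_intros)
qed

section \<open>Decidability of the syntax over \<open>pred_lang\<close>\<close>

definition is_tm :: "nat \<Rightarrow> nat \<Rightarrow> bool" where
  "is_tm k m \<longleftrightarrow> (\<exists>t. tm_code t = m \<and> tm_in pred_lang k t)"

definition is_fm :: "nat \<Rightarrow> nat \<Rightarrow> bool" where
  "is_fm k m \<longleftrightarrow> (\<exists>\<phi>. fm_code \<phi> = m \<and> fm_in pred_lang k \<phi>)"

abbreviation is_singleton :: "nat \<Rightarrow> bool" where
  "is_singleton c \<equiv> c \<noteq> 0 \<and> right (c - 1) = 0"

lemma singleton_code: "is_singleton c \<Longrightarrow> c = cons_code (left (c - 1)) 0"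
  by (metis One_nat_def Suc_pred bot_nat_0.not_eq_extremum prod.collapse prod_decode_inverse)

text \<open>In \<open>tm_code\<close> the function symbol \<open>f\<close> has tag
  \<open>Suc f\<close>: tag 1 is the constant zero, tag 2 the successor.\<close>

lemma is_tm_iff:
  "is_tm k m \<longleftrightarrow> left m = 0 \<and> right m < k \<or> left m = 1 \<and> right m = 0
     \<or> left m = 2 \<and> is_singleton (right m) \<and> is_tm k (left (right m - 1))"
    (is "_ \<longleftrightarrow> ?R")
proof
  assume "is_tm k m"
  then obtain t where t: "tm_code t = m" "tm_in pred_lang k t" unfolding is_tm_def by blast
  show ?R
  proof (cases t)
    case (Var i)
    then show ?thesis using t by auto
  next
    case (Fun f ts)
    then show ?thesis using t by (auto simp: length_Suc_conv is_tm_def)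
  qed
next
  have m: "m = prod_encode (left m, right m)" by simp
  assume ?R
  then consider "left m = 0" "right m < k" | "left m = 1" "right m = 0"
    | t where "left m = 2" "is_singleton (right m)" "tm_code t = left (right m - 1)" "tm_in pred_lang k t"
    unfolding is_tm_def by metis
  then show "is_tm k m"
  proof cases
    case 1
    then show ?thesis unfolding is_tm_def using m by (intro exI[of _ "Var (right m)"]) simp
  next
    case 2
    then show ?thesis unfolding is_tm_def using m by (intro exI[of _ "Fun 0 []"]) simp
  next
    case 3
    have "m = prod_encode (2, cons_code (tm_code t) 0)"
      using m 3(1,3) singleton_code[OF 3(2)] by metis
    then show ?thesis unfolding is_tm_def using 3(4)
      by (intro exI[of _ "Fun 1 [t]"]) (simp add: numeral_2_eq_2)
  qed
qed

lemma is_fm_iff: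
  "is_fm k m \<longleftrightarrow> left m = 0 \<and> is_tm k (left (right m)) \<and> is_tm k (right (right m))
     \<or> left m = 1 \<and> is_singleton (right (right m)) \<and> is_tm k (left (right (right m) - 1))
     \<or> left m = 2 \<and> right m = 0
     \<or> left m = 3 \<and> is_fm k (left (right m)) \<and> is_fm k (right (right m))
     \<or> left m = 4 \<and> is_fm (Suc k) (right m)" (is "_ \<longleftrightarrow> ?R")
proof
  assume "is_fm k m"
  then obtain \<phi> where \<phi>: "fm_code \<phi> = m" "fm_in pred_lang k \<phi>" unfolding is_fm_def by blast
  show ?R
  proof (cases \<phi>)
    case (Eq t u)
    then show ?thesis using \<phi> by (auto simp: is_tm_def)
  next
    case (Rel r ts)
    then show ?thesis using \<phi> by (auto simp: length_Suc_conv is_tm_def)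
  next
    case Fls
    then show ?thesis using \<phi> by auto
  next
    case (Imp \<psi> \<chi>)
    then show ?thesis using \<phi> by (auto simp: is_fm_def)
  next
    case (All \<psi>)
    then show ?thesis using \<phi> by (auto simp: is_fm_def)
  qed
next
  have m: "m = prod_encode (left m, right m)"
    "right m = prod_encode (left (right m), right (right m))" by simp_all
  assume ?R
  then consider t u where "left m = 0" "tm_code t = left (right m)" "tm_code u = right (right m)"
      "tm_in pred_lang k t" "tm_in pred_lang k u"
    | t where "left m = 1" "is_singleton (right (right m))" "tm_code t = left (right (right m) - 1)"
      "tm_in pred_lang k t"
    | "left m = 2" "right m = 0"
    | \<phi> \<psi> where "left m = 3" "fm_code \<phi> = left (right m)" "fm_code \<psi> = right (right m)"
      "fm_in pred_lang k \<phi>" "fm_in pred_lang k \<psi>"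
    | \<phi> where "left m = 4" "fm_code \<phi> = right m" "fm_in pred_lang (Suc k) \<phi>"
    unfolding is_fm_def is_tm_def by (elim disjE conjE exE) metis+
  then show "is_fm k m"
  proof cases
    case 1
    then show ?thesis unfolding is_fm_def using m by (intro exI[of _ "Eq t u"]) simp
  next
    case 2
    then show ?thesis unfolding is_fm_def using m singleton_code[OF 2(2)]
      by (intro exI[of _ "Rel (left (right m)) [t]"]) simp
  next
    case 3
    then show ?thesis unfolding is_fm_def using m by (intro exI[of _ Fls]) simp
  next
    case 4
    then show ?thesis unfolding is_fm_def using m by (intro exI[of _ "Imp \<phi> \<psi>"]) simp
  next
    case 5
    then show ?thesis unfolding is_fm_def using m by (intro exI[of _ "All \<phi>"]) simp
  qed
qed

lemma triangle_ge: "n \<le> triangle n"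
  by (induction n) auto

lemma prod_encode_less: "a + b < a' + b' \<Longrightarrow> prod_encode (a, b) < prod_encode (a', b')"
  using triangle_mono[of "Suc (a + b)" "a' + b'"] by (simp add: prod_encode_def)

text \<open>Needed under \<open>All\<close>, where the pair of \<open>k\<close> and \<open>m\<close>
  passes to \<open>Suc k\<close> and \<open>right m\<close>: the tag 4 makes \<open>right m\<close>
  smaller than \<open>m\<close> by more than one, which compensates for the larger \<open>k\<close>,
  and by \<open>prod_encode_less\<close> a smaller sum means a smaller code.\<close>

lemma right_less_add: "right m + left m + left m \<le> m"
proof -
  have "m = triangle (left m + right m) + left m"
    using prod_decode_inverse[of m] by (simp add: prod_encode_def case_prod_beta)
  then show ?thesis using triangle_ge[of "left m + right m"] by linarith
qed

lemma decidable_is_tm [computable_intros]: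
  assumes "computable X f" "computable X g" shows "decidable X (\<lambda>x. is_tm (f x) (g x))"
proof -
  define A where "A = {u. is_tm (left u) (right u)}"
  define P where "P A u \<longleftrightarrow> left (right u) = 0 \<and> right (right u) < left u
     \<or> left (right u) = 1 \<and> right (right u) = 0
     \<or> left (right u) = 2 \<and> is_singleton (right (right u))
       \<and> prod_encode (left u, left (right (right u) - 1)) \<in> A" for A u
  have "decidable X (\<lambda>u. u \<in> A)"
  proof (rule decidable_course_of_values)
    show "decidable X (\<lambda>u. P (set_decode (left u)) (right u))"
      unfolding P_def by (intro computable_intros)
    fix u
    have "left (right (right u) - 1) < right u" if "left (right u) = 2"
      using right_less_add[of "right u"] left_le[of "right (right u) - 1"] that by linarith
    with prod_encode_less[of "left u" _ "left u" "right u"]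
    have "left (right u) = 2 \<Longrightarrow> prod_encode (left u, left (right (right u) - 1)) < u" by simp
    then have "P B u \<longleftrightarrow> P (B \<inter> {..<u}) u" for B
      unfolding P_def by (intro refl disj_cong conj_cong) simp_all
    moreover have "u \<in> A \<longleftrightarrow> P A u" unfolding A_def P_def mem_Collect_eq
      by (subst is_tm_iff) simp
    ultimately show "u \<in> A \<longleftrightarrow> P (A \<inter> {..<u}) u" by blast
  qed
  from decidable_comp[OF this computable_pair[OF assms]] show ?thesis by (simp add: A_def)
qed

lemma decidable_is_fm [computable_intros]:
  assumes "computable X f" "computable X g" shows "decidable X (\<lambda>x. is_fm (f x) (g x))"
proof -
  define A where "A = {u. is_fm (left u) (right u)}"
  define P where "P A u \<longleftrightarrow>
     left (right u) = 0 \<and> is_tm (left u) (left (right (right u))) \<and> is_tm (left u) (right (right (right u)))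
     \<or> left (right u) = 1 \<and> is_singleton (right (right (right u)))
        \<and> is_tm (left u) (left (right (right (right u)) - 1))
     \<or> left (right u) = 2 \<and> right (right u) = 0
     \<or> left (right u) = 3 \<and> prod_encode (left u, left (right (right u))) \<in> A
        \<and> prod_encode (left u, right (right (right u))) \<in> A
     \<or> left (right u) = 4 \<and> prod_encode (Suc (left u), right (right u)) \<in> A" for A u
  have "decidable X (\<lambda>u. u \<in> A)"
  proof (rule decidable_course_of_values)
    show "decidable X (\<lambda>u. P (set_decode (left u)) (right u))"
      unfolding P_def by (intro computable_intros)
    fix u
    have "left (right m) < m" "right (right m) < m" if "left m = 3" for m
      using right_less_add[of m] left_le[of "right m"] right_le[of "right m"] that by linarith+
    from this[of "right u"] prod_encode_less[of "left u" _ "left u" "right u"]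
    have 3: "left (right u) = 3 \<Longrightarrow> prod_encode (left u, left (right (right u))) < u"
      "left (right u) = 3 \<Longrightarrow> prod_encode (left u, right (right (right u))) < u" by simp_all
    have "Suc (right m) < m" if "left m = 4" for m
      using right_less_add[of m] that by linarith
    from this[of "right u"] prod_encode_less[of "Suc (left u)" _ "left u" "right u"]
    have 4: "left (right u) = 4 \<Longrightarrow> prod_encode (Suc (left u), right (right u)) < u" by simp
    have "P B u \<longleftrightarrow> P (B \<inter> {..<u}) u" for B
      unfolding P_def by (intro refl disj_cong conj_cong) (use 3 4 in simp_all)
    moreover have "u \<in> A \<longleftrightarrow> P A u" unfolding A_def P_def mem_Collect_eq
      by (subst is_fm_iff) simp
    ultimately show "u \<in> A \<longleftrightarrow> P (A \<inter> {..<u}) u" by blast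
  qed
  from decidable_comp[OF this computable_pair[OF assms]] show ?thesis by (simp add: A_def)
qed

section \<open>Truth in one-element structures, for formulas and for codes\<close>

fun ev :: "nat set \<Rightarrow> fm \<Rightarrow> bool" where
  "ev V (Eq t u) \<longleftrightarrow> True"
| "ev V (Rel r ts) \<longleftrightarrow> r \<in> V"
| "ev V Fls \<longleftrightarrow> False"
| "ev V (Imp \<phi> \<psi>) \<longleftrightarrow> (ev V \<phi> \<longrightarrow> ev V \<psi>)"
| "ev V (All \<phi>) \<longleftrightarrow> ev V \<phi>"

text \<open>With one element an equation always holds, a quantifier has a single instance, and
  \<open>Rel r\<close> acts as a propositional variable, so \<open>ev\<close> can do without an
  environment.\<close>

lemma ev_sat: "ev V \<phi> \<longleftrightarrow> sat (\<lambda>_ _. ()) (\<lambda>r _. r \<in> V) env \<phi>"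
proof (induction \<phi> arbitrary: env)
  case (All \<phi>)
  show ?case unfolding ev.simps sat.simps using All by blast
qed auto

text \<open>\<open>ev\<close> transferred to codes. It is total, with value false on tag 2 and on
  tags that no formula has, so that course-of-values recursion applies to all numbers.\<close>

function evn :: "nat set \<Rightarrow> nat \<Rightarrow> bool" where
  "evn V m \<longleftrightarrow> (if left m = 0 then True else if left m = 1 then left (right m) \<in> V
     else if left m = 3 then evn V (left (right m)) \<longrightarrow> evn V (right (right m))
     else if left m = 4 then evn V (right m) else False)"
  by pat_completeness auto
termination
proof (relation "measure snd", goal_cases)
  case (2 V m)
  then show ?case using right_less[of m] left_le[of "right m"] by simp
next
  case (3 V m)
  then show ?case using right_less[of m] right_le[of "right m"] by simp
next
  case (4 V m)
  then show ?case using right_less[of m] by simp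
qed simp

declare evn.simps [simp del]

lemma evn_fm_code: "evn V (fm_code \<phi>) \<longleftrightarrow> ev V \<phi>"
  by (induction \<phi>) (simp_all add: evn.simps[of V "prod_encode _"])

lemma decidable_evn [computable_intros]:
  assumes "computable X f" "computable X g" shows "decidable X (\<lambda>x. evn (set_decode (f x)) (g x))"
proof -
  define A where "A = {u. evn (set_decode (left u)) (right u)}"
  define P where "P A u \<longleftrightarrow> left (right u) = 0
     \<or> left (right u) = 1 \<and> left (right (right u)) \<in> set_decode (left u)
     \<or> left (right u) = 3 \<and> (prod_encode (left u, left (right (right u))) \<in> A
          \<longrightarrow> prod_encode (left u, right (right (right u))) \<in> A)
     \<or> left (right u) = 4 \<and> prod_encode (left u, right (right u)) \<in> A" for A u
  have "decidable X (\<lambda>u. u \<in> A)"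
  proof (rule decidable_course_of_values)
    show "decidable X (\<lambda>u. P (set_decode (left u)) (right u))"
      unfolding P_def by (intro computable_intros)
    fix u
    have "left (right m) < m" "right (right m) < m" "right m < m" if "0 < left m" for m
      using right_less_add[of m] left_le[of "right m"] right_le[of "right m"] that by linarith+
    from this[of "right u"] prod_encode_less[of "left u" _ "left u" "right u"]
    have 3: "0 < left (right u) \<Longrightarrow> prod_encode (left u, left (right (right u))) < u"
      "0 < left (right u) \<Longrightarrow> prod_encode (left u, right (right (right u))) < u"
      "0 < left (right u) \<Longrightarrow> prod_encode (left u, right (right u)) < u" by simp_all
    have "P B u \<longleftrightarrow> P (B \<inter> {..<u}) u" for B
      unfolding P_def by (intro refl disj_cong conj_cong) (use 3 in simp_all)
    moreover have "u \<in> A \<longleftrightarrow> P A u" unfolding A_def P_def mem_Collect_eq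
      by (subst evn.simps) auto
    ultimately show "u \<in> A \<longleftrightarrow> P (A \<inter> {..<u}) u" by blast
  qed
  from decidable_comp[OF this computable_pair[OF assms]] show ?thesis by (simp add: A_def)
qed

section \<open>Literal theories and the complexity of their theorems\<close>

definition lit :: "nat \<Rightarrow> fm" where
  "lit n = (if even n then Rel (n div 2) [num 0] else Neg (Rel (n div 2) [num 0]))"

definition one_element :: fm where
  "one_element = All (All (Eq (Var 0) (Var 1)))"

definition lit_theory :: "nat set \<Rightarrow> fm set" where
  "lit_theory D = insert one_element (lit ` D)"

lemma sentence_lit: "sentence pred_lang (lit n)"
  by (auto simp: lit_def)

lemma sentence_lit_theory: "\<phi> \<in> lit_theory D \<Longrightarrow> sentence pred_lang \<phi>"
  by (auto simp: lit_theory_def one_element_def sentence_lit)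

lemma lift_lit_theory: "lift ` lit_theory D = lit_theory D"
  by (rule lift_image_sentences[OF sentence_lit_theory])

lemma ev_lit: "ev V (lit n) \<longleftrightarrow> (n div 2 \<in> V \<longleftrightarrow> even n)"
  by (auto simp: lit_def)

lemma ev_soundness: "\<Gamma> \<turnstile> \<phi> \<Longrightarrow> (\<And>\<gamma>. \<gamma> \<in> \<Gamma> \<Longrightarrow> ev V \<gamma>) \<Longrightarrow> ev V \<phi>"
  unfolding ev_sat[of V _ "\<lambda>_. ()"] by (rule soundness)

definition disjoint_sides :: "nat set \<Rightarrow> bool" where
  "disjoint_sides D \<longleftrightarrow> (\<forall>x. \<not> (2 * x \<in> D \<and> Suc (2 * x) \<in> D))"

lemma ev_lit_theory:
  assumes "disjoint_sides D" "\<gamma> \<in> lit_theory D"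
    and V: "\<And>n. n \<in> D \<Longrightarrow> n div 2 \<in> V \<longleftrightarrow> even n"
  shows "ev V \<gamma>"
  using assms(2) V by (auto simp: lit_theory_def one_element_def ev_lit)

text \<open>The valuation that makes exactly the asserted atoms true satisfies all axioms, so no
  further atom is provable.\<close>

lemma lit_theory_lit_iff:
  assumes "disjoint_sides D" shows "lit_theory D \<turnstile> lit (2 * x) \<longleftrightarrow> 2 * x \<in> D"
proof
  have "n div 2 \<in> {x. 2 * x \<in> D} \<longleftrightarrow> even n" if "n \<in> D" for n
    using that assms by (cases "even n") (auto simp: disjoint_sides_def elim!: oddE)
  then have "ev {x. 2 * x \<in> D} \<gamma>" if "\<gamma> \<in> lit_theory D" for \<gamma>
    by (rule ev_lit_theory[OF assms that])
  moreover assume "lit_theory D \<turnstile> lit (2 * x)"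
  ultimately have "ev {x. 2 * x \<in> D} (lit (2 * x))" using ev_soundness by blast
  then show "2 * x \<in> D" by (simp add: ev_lit)
next
  assume "2 * x \<in> D"
  then show "lit_theory D \<turnstile> lit (2 * x)" by (intro assm) (simp add: lit_theory_def)
qed

lemma one_element_Eq:
  assumes "one_element \<in> \<Gamma>" shows "\<Gamma> \<turnstile> Eq t u"
proof -
  have "\<Gamma> \<turnstile> All (All (Eq (Var 0) (Var 1)))" using assms by (auto simp: one_element_def intro: assm)
  from all_elim[OF this, of u] have "\<Gamma> \<turnstile> All (Eq (Var 0) (shift u))" by (simp add: inst_def up_def)
  from all_elim[OF this, of t] show ?thesis by (simp add: inst_def)
qed

lemma one_element_Rel:
  assumes "one_element \<in> \<Gamma>" "\<Gamma> \<turnstile> Rel r [t]" shows "\<Gamma> \<turnstile> Rel r [u]"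
  using eq_elim[OF one_element_Eq[OF assms(1), of t u], of "Rel r [Var 0]"] assms(2)
  by (simp add: inst_def)

text \<open>Kalmar's argument for propositional completeness: once every relevant atom is decided,
  so is every formula. The name of an atom is at most the code of the formula, so literals below
  \<open>b\<close> suffice. Free variables are allowed, since with one element their values do not
  matter.\<close>

lemma one_element_decides:
  assumes "one_element \<in> \<Gamma>" and lift: "lift ` \<Gamma> = \<Gamma>"
    and lits: "\<And>x. x < b \<Longrightarrow> lit (if x \<in> V then 2 * x else Suc (2 * x)) \<in> \<Gamma>"
  shows "fm_in pred_lang k \<phi> \<Longrightarrow> fm_code \<phi> < b \<Longrightarrow> \<Gamma> \<turnstile> (if ev V \<phi> then \<phi> else Neg \<phi>)"
proof (induction \<phi> arbitrary: k)
  case (Eq t u)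
  then show ?case using one_element_Eq[OF assms(1)] by simp
next
  case (Rel r ts)
  from Rel(1) obtain t where ts: "ts = [t]" by (auto simp: length_Suc_conv)
  have "r \<le> fm_code (Rel r ts)"
    using le_prod_encode_1[of r] le_prod_encode_2 by (simp del: One_nat_def) (meson le_trans)
  then have "lit (if r \<in> V then 2 * r else Suc (2 * r)) \<in> \<Gamma>" using lits[of r] Rel(2) by linarith
  from assm[OF this] have *: "\<Gamma> \<turnstile> (if r \<in> V then Rel r [num 0] else Neg (Rel r [num 0]))"
    by (simp add: lit_def split: if_splits)
  show ?case
  proof (cases "r \<in> V")
    case True
    then show ?thesis using * one_element_Rel[OF assms(1)] by (simp add: ts)
  next
    case False
    have "insert (Rel r [t]) \<Gamma> \<turnstile> Fls"
    proof (rule imp_elim)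
      show "insert (Rel r [t]) \<Gamma> \<turnstile> Neg (Rel r [num 0])"
        using * False by (simp del: num.simps) (rule weaken, auto)
      show "insert (Rel r [t]) \<Gamma> \<turnstile> Rel r [num 0]"
        using one_element_Rel[of "insert (Rel r [t]) \<Gamma>" r t] assms(1) by (simp add: assm)
    qed
    then show ?thesis using False by (simp add: ts imp_intro)
  qed
next
  case Fls
  then show ?case by (simp add: imp_intro assm)
next
  case (Imp \<phi> \<psi>)
  have "fm_code \<phi> \<le> fm_code (Imp \<phi> \<psi>)" "fm_code \<psi> \<le> fm_code (Imp \<phi> \<psi>)"
    using le_prod_encode_1[of "fm_code \<phi>" "fm_code \<psi>"] le_prod_encode_2[of "fm_code \<psi>" "fm_code \<phi>"]
      le_prod_encode_2[of "prod_encode (fm_code \<phi>, fm_code \<psi>)" 3] by simp_all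
  with Imp.prems(2) have less: "fm_code \<phi> < b" "fm_code \<psi> < b" by linarith+
  have IH: "\<Gamma> \<turnstile> (if ev V \<phi> then \<phi> else Neg \<phi>)" "\<Gamma> \<turnstile> (if ev V \<psi> then \<psi> else Neg \<psi>)"
    using Imp.IH(1)[of k, OF _ less(1)] Imp.IH(2)[of k, OF _ less(2)] Imp.prems(1) by simp_all
  consider "ev V \<psi>" | "\<not> ev V \<phi>" | "ev V \<phi>" "\<not> ev V \<psi>" by blast
  then show ?case
  proof cases
    case 1
    then have "insert \<phi> \<Gamma> \<turnstile> \<psi>" using IH(2) by (auto intro: weaken)
    then show ?thesis using 1 by (simp add: imp_intro)
  next
    case 2
    then have "insert \<phi> \<Gamma> \<turnstile> Neg \<phi>" using IH(1) by (auto intro: weaken)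
    then have "insert \<phi> \<Gamma> \<turnstile> \<psi>" by (rule neg_elim) (simp add: assm)
    then show ?thesis using 2 by (simp add: imp_intro)
  next
    case 3
    let ?G = "insert (Imp \<phi> \<psi>) \<Gamma>"
    have "?G \<turnstile> \<phi>" "?G \<turnstile> Neg \<psi>" using IH 3 by (auto intro: weaken)
    then have "?G \<turnstile> Fls" by (meson assm imp_elim insertI1)
    then show ?thesis using 3 by (simp add: imp_intro)
  qed
next
  case (All \<phi>)
  have "fm_code \<phi> \<le> fm_code (All \<phi>)" by (simp add: le_prod_encode_2)
  then have IH: "\<Gamma> \<turnstile> (if ev V \<phi> then \<phi> else Neg \<phi>)" using All.IH[of "Suc k"] All.prems by simp
  show ?case
  proof (cases "ev V \<phi>")
    case True
    then show ?thesis using IH lift by (simp add: all_intro)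
  next
    case False
    \<comment> \<open>The refutation of \<phi> can be generalised because lifting does not change
      \<Gamma>; one instance of it then refutes the universal statement.\<close>
    then have "\<Gamma> \<turnstile> All (Neg \<phi>)" using IH lift by (simp add: all_intro)
    from all_elim[OF this, of "num 0"] have "\<Gamma> \<turnstile> Neg (inst (num 0) \<phi>)" by (simp add: inst_def)
    then have "insert (All \<phi>) \<Gamma> \<turnstile> Neg (inst (num 0) \<phi>)" by (rule weaken) blast
    moreover have "insert (All \<phi>) \<Gamma> \<turnstile> inst (num 0) \<phi>" by (rule all_elim) (simp add: assm)
    ultimately have "insert (All \<phi>) \<Gamma> \<turnstile> Fls" by (rule imp_elim)
    then show ?thesis using False by (simp add: imp_intro)
  qed
qed

text \<open>Provability reduces to a tautology test over the valuations of the atoms below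
  \<open>b\<close> that respect \<open>D\<close>. In one direction such a valuation is extended to a
  model; in the other the derivation branches on every atom below \<open>b\<close>.\<close>

lemma lit_theory_iff:
  assumes D: "disjoint_sides D" and \<phi>: "sentence pred_lang \<phi>" and b: "fm_code \<phi> < b"
  shows "lit_theory D \<turnstile> \<phi> \<longleftrightarrow>
    (\<forall>V\<subseteq>{..<b}. (\<forall>n<2 * b. n \<in> D \<longrightarrow> (n div 2 \<in> V \<longleftrightarrow> even n)) \<longrightarrow> ev V \<phi>)" (is "_ \<longleftrightarrow> ?R")
proof
  have ev_agree: "ev V \<psi> \<longleftrightarrow> ev V' \<psi>" if "fm_code \<psi> < b" "V \<inter> {..<b} = V' \<inter> {..<b}" for V V' \<psi>
    using that(1)
  proof (induction \<psi>)
    case (Rel r ts)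
    have "r \<le> fm_code (Rel r ts)"
      using le_prod_encode_1[of r] le_prod_encode_2 by (simp del: One_nat_def) (meson le_trans)
    then show ?case using Rel that(2) by fastforce
  next
    case (Imp \<psi> \<chi>)
    then show ?case
      using le_prod_encode_1[of "fm_code \<psi>" "fm_code \<chi>"] le_prod_encode_2[of "fm_code \<chi>" "fm_code \<psi>"]
        le_prod_encode_2[of "prod_encode (fm_code \<psi>, fm_code \<chi>)" 3] by simp
  next
    case (All \<psi>)
    then show ?case using le_prod_encode_2[of "fm_code \<psi>" 4] by simp
  qed auto
  assume prov: "lit_theory D \<turnstile> \<phi>"
  show ?R
  proof (intro allI impI)
    fix V assume V: "V \<subseteq> {..<b}" "\<forall>n<2 * b. n \<in> D \<longrightarrow> (n div 2 \<in> V \<longleftrightarrow> even n)"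
    \<comment> \<open>Atoms from \<open>b\<close> on do not occur in \<phi>; they are made true
      exactly if asserted, so that all axioms hold.\<close>
    let ?V = "V \<union> {x. b \<le> x \<and> 2 * x \<in> D}"
    have "n div 2 \<in> ?V \<longleftrightarrow> even n" if "n \<in> D" for n
    proof (cases "n < 2 * b")
      case True
      then show ?thesis using V(2) that by auto
    next
      case False
      then show ?thesis using that V(1) D by (cases "even n") (auto simp: disjoint_sides_def elim!: oddE)
    qed
    from ev_lit_theory[OF D _ this] have "ev ?V \<phi>" using ev_soundness[OF prov] by blast
    moreover have "V \<inter> {..<b} = ?V \<inter> {..<b}" by auto
    ultimately show "ev V \<phi>" using ev_agree[OF b] by blast
  qed
next
  assume R: ?R
  let ?l = "\<lambda>V x. lit (if x \<in> V then 2 * x else Suc (2 * x))"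
  \<comment> \<open>Downward induction: with a literal for every atom below \<open>b\<close>, either
    \<phi> is decided or a literal clashes with an axiom. The literals are then discharged from the
    top by case distinction.\<close>
  have "\<forall>V. lit_theory D \<union> ?l V ` {..<m} \<turnstile> \<phi>" if "m \<le> b" for m
    using that
  proof (induction m rule: inc_induct)
    case base
    show ?case
    proof
      fix V
      let ?G = "lit_theory D \<union> ?l V ` {..<b}"
      show "?G \<turnstile> \<phi>"
      proof (cases "\<forall>n<2 * b. n \<in> D \<longrightarrow> (n div 2 \<in> V \<inter> {..<b} \<longleftrightarrow> even n)")
        case True
        then have "ev (V \<inter> {..<b}) \<phi>" by (rule mp[OF mp[OF spec[OF R] Int_lower2]])
        moreover have "?G \<turnstile> (if ev (V \<inter> {..<b}) \<phi> then \<phi> else Neg \<phi>)"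
        proof (rule one_element_decides[OF _ _ _ \<phi> b])
          show "one_element \<in> ?G" by (simp add: lit_theory_def)
          show "lift ` ?G = ?G"
            by (rule lift_image_sentences[of _ pred_lang]) (auto simp: sentence_lit sentence_lit_theory)
        qed auto
        ultimately show ?thesis by simp
      next
        case False
        then obtain n where n: "n < 2 * b" "n \<in> D" "(n div 2 \<in> V) \<noteq> even n" by auto
        have "?l V (n div 2) \<in> ?l V ` {..<b}" using n(1) by (intro imageI) simp
        then have mem: "?G \<turnstile> lit n" "?G \<turnstile> ?l V (n div 2)"
          using n(2) by (intro assm, simp add: lit_theory_def)+
        have "lit n = Neg (?l V (n div 2)) \<or> ?l V (n div 2) = Neg (lit n)"
          using n(3) by (cases "even n") (auto simp: lit_def elim!: evenE oddE)
        then show ?thesis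
        proof
          assume "lit n = Neg (?l V (n div 2))"
          with mem(1) have "?G \<turnstile> Neg (?l V (n div 2))" by (rule back_subst)
          then show ?thesis using mem(2) by (rule neg_elim)
        next
          assume "?l V (n div 2) = Neg (lit n)"
          with mem(2) have "?G \<turnstile> Neg (lit n)" by (rule back_subst)
          then show ?thesis using mem(1) by (rule neg_elim)
        qed
      qed
    qed
  next
    case (step m)
    show ?case
    proof
      fix V
      let ?G = "lit_theory D \<union> ?l V ` {..<m}"
      have "?l (insert m V) ` {..<m} = ?l V ` {..<m}" "?l (V - {m}) ` {..<m} = ?l V ` {..<m}"
        by (rule image_cong, simp, simp)+
      moreover have "lit (2 * m) = Rel m [num 0]" "lit (Suc (2 * m)) = Neg (Rel m [num 0])"
        by (simp_all add: lit_def)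
      ultimately have 1: "?l (insert m V) ` {..<Suc m} = insert (Rel m [num 0]) (?l V ` {..<m})"
        "?l (V - {m}) ` {..<Suc m} = insert (Neg (Rel m [num 0])) (?l V ` {..<m})"
        by (simp_all add: lessThan_Suc)
      show "?G \<turnstile> \<phi>"
      proof (rule case_split)
        show "insert (Rel m [num 0]) ?G \<turnstile> \<phi>"
          using step.IH[rule_format, of "insert m V"] unfolding 1 by simp
        show "insert (Neg (Rel m [num 0])) ?G \<turnstile> \<phi>"
          using step.IH[rule_format, of "V - {m}"] unfolding 1 by simp
      qed
    qed
  qed
  from this[of 0] show "lit_theory D \<turnstile> \<phi>" by simp
qed

lemma computable_lit_code [computable_intros]:
  assumes "computable X f" shows "computable X (\<lambda>x. fm_code (lit (f x)))"
proof -
  have "fm_code (lit n) = (if even n then prod_encode (1, prod_encode (n div 2, cons_code (tm_code (num 0)) 0))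
     else prod_encode (3, prod_encode (prod_encode (1, prod_encode (n div 2, cons_code (tm_code (num 0)) 0)), fm_code Fls)))"
    for n by (simp add: lit_def)
  then show ?thesis by (simp only:) (intro computable_intros assms)
qed

lemma set_encode_less: "V \<subseteq> {..<b} \<Longrightarrow> set_encode V < 2 ^ b"
proof -
  assume "V \<subseteq> {..<b}"
  then have "V = {n. n < b \<and> n \<in> V}" by auto
  moreover have "set_encode {n. n < b \<and> n \<in> V} < 2 ^ b"
    by (induction b) (auto simp: set_encode_less_Suc)
  ultimately show ?thesis by simp
qed

lemma set_decode_subset: "c < 2 ^ b \<Longrightarrow> set_decode c \<subseteq> {..<b}"
proof
  fix x assume "c < 2 ^ b" "x \<in> set_decode c"
  then have "c div 2 ^ x \<noteq> 0" by (auto simp: set_decode_def intro: ccontr)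
  then have "2 ^ x \<le> c" by (simp add: div_eq_0_iff)
  with \<open>c < 2 ^ b\<close> have "(2::nat) ^ x < 2 ^ b" by linarith
  then show "x \<in> {..<b}" by simp
qed

text \<open>The tautology test in numbers, with \<open>b = Suc n\<close>: the valuations are the
  sets coded by numbers below \<open>2 ^ Suc n\<close>, and only literals below
  \<open>2 * Suc n\<close> concern them, so all quantifiers are bounded.\<close>

definition lit_theorem :: "nat set \<Rightarrow> nat \<Rightarrow> bool" where
  "lit_theorem D n \<longleftrightarrow> is_fm 0 n \<and> (\<forall>c<2 ^ Suc n.
     (\<forall>m<2 * Suc n. m \<in> D \<longrightarrow> (m div 2 \<in> set_decode c \<longleftrightarrow> even m)) \<longrightarrow> evn (set_decode c) n)"

lemma lit_theorem_iff:
  assumes "disjoint_sides D"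
  shows "n \<in> theorem_codes pred_lang (lit_theory D) \<longleftrightarrow> lit_theorem D n"
proof (cases "is_fm 0 n")
  case True
  then obtain \<phi> where \<phi>: "fm_code \<phi> = n" "sentence pred_lang \<phi>" unfolding is_fm_def by blast
  let ?P = "\<lambda>V. (\<forall>m<2 * Suc n. m \<in> D \<longrightarrow> (m div 2 \<in> V \<longleftrightarrow> even m)) \<longrightarrow> ev V \<phi>"
  have "(\<forall>V\<subseteq>{..<Suc n}. ?P V) \<longleftrightarrow> (\<forall>c<2 ^ Suc n. ?P (set_decode c))"
  proof
    assume L: "\<forall>V\<subseteq>{..<Suc n}. ?P V"
    show "\<forall>c<2 ^ Suc n. ?P (set_decode c)"
    proof (rule allI, rule impI)
      fix c :: nat assume "c < 2 ^ Suc n"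
      from set_decode_subset[OF this] show "?P (set_decode c)" by (rule mp[OF spec[OF L]])
    qed
  next
    assume R: "\<forall>c<2 ^ Suc n. ?P (set_decode c)"
    show "\<forall>V\<subseteq>{..<Suc n}. ?P V"
    proof (intro allI impI)
      fix V assume V: "V \<subseteq> {..<Suc n}" "\<forall>m<2 * Suc n. m \<in> D \<longrightarrow> (m div 2 \<in> V \<longleftrightarrow> even m)"
      have "set_decode (set_encode V) = V" using V(1) by (simp add: finite_subset)
      then show "ev V \<phi>" using R[rule_format, OF set_encode_less[OF V(1)]] V(2) by simp
    qed
  qed
  moreover have "n \<in> theorem_codes pred_lang (lit_theory D) \<longleftrightarrow> lit_theory D \<turnstile> \<phi>"
    using mem_theorem_codes[of \<phi>] \<phi> by simp
  moreover have "lit_theory D \<turnstile> \<phi> \<longleftrightarrow> (\<forall>V\<subseteq>{..<Suc n}. ?P V)"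
    by (rule lit_theory_iff[OF assms \<phi>(2)]) (simp add: \<phi>(1))
  moreover have "lit_theorem D n \<longleftrightarrow> (\<forall>c<2 ^ Suc n. ?P (set_decode c))"
    unfolding lit_theorem_def using True evn_fm_code[of _ \<phi>] \<phi>(1) by simp
  ultimately show ?thesis by simp
next
  case False
  then show ?thesis by (auto simp: lit_theorem_def theorem_codes_def is_fm_def)
qed

lemma decidable_theorem_codes:
  assumes "disjoint_sides D" "decidable X (\<lambda>x. x \<in> D)"
  shows "decidable X (\<lambda>n. n \<in> theorem_codes pred_lang (lit_theory D))"
  unfolding lit_theorem_iff[OF assms(1)] lit_theorem_def
  by (intro computable_intros decidable_comp[OF assms(2)])

text \<open>\<open>D\<close> occurs in the test only as a hypothesis on valuations, so a larger
  \<open>D\<close> yields more theorems; and for each sentence only finitely many members of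
  \<open>D\<close> matter, so one stage of its enumeration suffices.\<close>

lemma re_set_theorem_codes:
  assumes "disjoint_sides D" "re_set D"
  shows "re_set (theorem_codes pred_lang (lit_theory D))"
proof -
  obtain P where P: "decidable {} (\<lambda>u. P (left u) (right u))" "D = {x. \<exists>s. P x s}"
    "\<And>x s s'. P x s \<Longrightarrow> s \<le> s' \<Longrightarrow> P x s'"
    using re_setE[OF assms(2)] by blast
  have "re_set {n. \<exists>s. lit_theorem {x. P x s} n}"
    unfolding lit_theorem_def mem_Collect_eq
    by (intro re_setI computable_intros decidable_comp2[where P = P, OF P(1)])
  moreover have "(\<exists>s. lit_theorem {x. P x s} n) \<longleftrightarrow> lit_theorem D n" for n
  proof
    assume "\<exists>s. lit_theorem {x. P x s} n"
    then show "lit_theorem D n" unfolding lit_theorem_def P(2) by blast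
  next
    assume D: "lit_theorem D n"
    have "\<exists>s. \<forall>m<b. m \<in> D \<longrightarrow> P m s" for b
    proof (induction b)
      case (Suc b)
      then obtain s where s: "\<forall>m<b. m \<in> D \<longrightarrow> P m s" by blast
      obtain s' where "b \<in> D \<longrightarrow> P b s'" using P(2) by blast
      then have "\<forall>m<Suc b. m \<in> D \<longrightarrow> P m (max s s')"
        using s P(3)[OF _ max.cobounded1] P(3)[OF _ max.cobounded2] by (auto simp: less_Suc_eq)
      then show ?case by blast
    qed simp
    then obtain s where "\<forall>m<2 * Suc n. m \<in> D \<longrightarrow> P m s" by blast
    then show "\<exists>s. lit_theorem {x. P x s} n"
      using D unfolding lit_theorem_def mem_Collect_eq by blast
  qed
  moreover have "theorem_codes pred_lang (lit_theory D) = {n. lit_theorem D n}"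
    using lit_theorem_iff[OF assms(1)] by blast
  ultimately show ?thesis by simp
qed

lemma re_set_lit_codes: "re_set D \<Longrightarrow> re_set (fm_code ` lit ` D)"
  unfolding image_image by (erule re_set_image) (intro computable_intros)

lemma con_re_theory_lit_theory:
  assumes "disjoint_sides D" "re_set D"
  shows "con_re_theory pred_lang (lit_theory D)"
proof -
  have "\<not> lit_theory D \<turnstile> Fls"
  proof -
    have "n div 2 \<in> {x. 2 * x \<in> D} \<longleftrightarrow> even n" if "n \<in> D" for n
      using that assms(1) by (cases "even n") (auto simp: disjoint_sides_def elim!: oddE)
    then have "ev {x. 2 * x \<in> D} \<gamma>" if "\<gamma> \<in> lit_theory D" for \<gamma>
      by (rule ev_lit_theory[OF assms(1) that])
    then show ?thesis using ev_soundness[of "lit_theory D" Fls "{x. 2 * x \<in> D}"] by auto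
  qed
  moreover have "re_set (fm_code ` lit_theory D)"
    unfolding lit_theory_def image_insert by (intro re_set_insert re_set_lit_codes assms(2))
  ultimately show ?thesis
    unfolding con_re_theory_def re_theory_def consistent_def
    using recursive_lang_pred_lang sentence_lit_theory by blast
qed

text \<open>In a decidable consistent extension, provability of \<open>lit (2 * x)\<close> would be
  a recursive separator: asserted atoms are provable and refuted ones are not. Only the literals are
  required of \<open>T\<close>, so this serves theories with and without the one-element
  axiom.\<close>

lemma inseparable_imp_EU:
  assumes D: "\<And>f. computable {} f \<Longrightarrow> \<exists>x. 2 * x \<in> D \<and> f x = 0 \<or> Suc (2 * x) \<in> D \<and> f x \<noteq> 0"
    and T: "lit ` D \<subseteq> T"
  shows "EU pred_lang T"
  unfolding EU_def
proof (intro allI impI notI)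
  fix S assume S: "con_re_theory pred_lang S \<and> extends S T" and dec: "decidable_theory pred_lang S"
  define f where "f x = (if fm_code (lit (2 * x)) \<in> theorem_codes pred_lang S then 1 else 0::nat)" for x
  have "computable {} f" unfolding f_def
    by (intro computable_intros decidable_comp[OF dec[unfolded decidable_theory_def recursive_set_iff]])
  then obtain x where x: "2 * x \<in> D \<and> f x = 0 \<or> Suc (2 * x) \<in> D \<and> f x \<noteq> 0" using D by blast
  have f: "f x \<noteq> 0 \<longleftrightarrow> S \<turnstile> lit (2 * x)"
    by (simp add: f_def mem_theorem_codes sentence_lit)
  have S_lit: "S \<turnstile> lit n" if "n \<in> D" for n
    using S T that assm[of "lit n" T] unfolding extends_def by blast
  from x show False
  proof
    assume "2 * x \<in> D \<and> f x = 0"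
    then show False using S_lit[of "2 * x"] f by simp
  next
    assume *: "Suc (2 * x) \<in> D \<and> f x \<noteq> 0"
    then have "S \<turnstile> Neg (lit (2 * x))" using S_lit[of "Suc (2 * x)"] by (simp add: lit_def)
    then have "S \<turnstile> Fls" using * f by (blast intro: imp_elim)
    then show False using S unfolding con_re_theory_def consistent_def by blast
  qed
qed

lemma disjoint_sides_low_set: "disjoint_sides low_set"
  unfolding disjoint_sides_def using low_set_disjoint by blast

text \<open>The theorems are decidable from \<open>low_set\<close>, so a complete theory would make
  \<open>low_set\<close> complete; and a creative theory is complete.\<close>

lemma EU_not_Zero_Jump_not_Creative:
  "con_re_theory pred_lang (lit_theory low_set) \<and> EU pred_lang (lit_theory low_set)
   \<and> \<not> Zero_Jump pred_lang (lit_theory low_set) \<and> \<not> Creative pred_lang (lit_theory low_set)"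
proof -
  have "\<not> decidable (theorem_codes pred_lang (lit_theory low_set)) (\<lambda>x. x \<in> halting_set)"
  proof
    assume "decidable (theorem_codes pred_lang (lit_theory low_set)) (\<lambda>x. x \<in> halting_set)"
    moreover have "decidable low_set (\<lambda>n. n \<in> theorem_codes pred_lang (lit_theory low_set))"
      by (intro decidable_theorem_codes disjoint_sides_low_set computable_intros)
    ultimately have "decidable low_set (\<lambda>x. x \<in> halting_set)" by (rule decidable_trans)
    then show False using halting_set_not_le_low_set by blast
  qed
  moreover have "EU pred_lang (lit_theory low_set)"
    by (rule inseparable_imp_EU[OF low_set_inseparable]) (auto simp: lit_theory_def)
  ultimately show ?thesis
    using con_re_theory_lit_theory[OF disjoint_sides_low_set re_set_low_set] creative_imp_complete
    unfolding Zero_Jump_def degree_zero_jump_def turing_le_iff Creative_def by blast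
qed

abbreviation double :: "nat \<Rightarrow> nat" where "double x \<equiv> 2 * x"

lemma disjoint_sides_double: "disjoint_sides (double ` A)"
  unfolding disjoint_sides_def by (auto, presburger)

lemma decidable_double:
  assumes "decidable X (\<lambda>x. x \<in> A)" shows "decidable X (\<lambda>x. x \<in> double ` A)"
proof -
  have "decidable X (\<lambda>x. even x \<and> x div 2 \<in> A)"
    by (intro computable_intros decidable_comp[OF assms])
  then show ?thesis by (rule decidable_cong) auto
qed

lemma not_EU_if_extends:
  assumes "extends (lit_theory (range double)) T" shows "\<not> EU pred_lang T"
proof -
  have dec: "decidable {} (\<lambda>x. x \<in> range double)"
    by (intro decidable_double) (simp add: computable_intros)
  then have "decidable_theory pred_lang (lit_theory (range double))"
    unfolding decidable_theory_def recursive_set_iff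
    by (intro decidable_theorem_codes disjoint_sides_double)
  moreover have "con_re_theory pred_lang (lit_theory (range double))"
    by (intro con_re_theory_lit_theory disjoint_sides_double decidable_imp_re_set dec)
  ultimately show ?thesis using assms unfolding EU_def by blast
qed

lemma Zero_Jump_Creative_not_EU:
  fixes T defines "T \<equiv> lit_theory (double ` halting_set)"
  shows "con_re_theory pred_lang T \<and> Zero_Jump pred_lang T \<and> Creative pred_lang T \<and> \<not> EU pred_lang T"
proof -
  have re: "re_set (double ` halting_set)"
    by (intro re_set_image re_set_halting_set computable_intros)
  let ?C = "theorem_codes pred_lang T"
  \<comment> \<open>A many-one reduction of the halting set to the theorems. It yields both
    completeness and creativity, the latter by taking preimages of RE sets.\<close>
  define g where "g x = fm_code (lit (double x))" for x
  have comp_g: "computable X (\<lambda>x. g (f x))" if "computable X f" for X f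
    unfolding g_def by (intro computable_intros that)
  have g: "g x \<in> ?C \<longleftrightarrow> x \<in> halting_set" for x
    using lit_theory_lit_iff[OF disjoint_sides_double, of halting_set x]
    by (auto simp: g_def mem_theorem_codes sentence_lit T_def)
  have "con_re_theory pred_lang T" unfolding T_def
    by (intro con_re_theory_lit_theory disjoint_sides_double re)
  moreover have "Zero_Jump pred_lang T"
  proof -
    have "decidable halting_set (\<lambda>x. x \<in> ?C)" unfolding T_def
      by (intro decidable_theorem_codes disjoint_sides_double decidable_double computable_intros)
    moreover have "decidable ?C (\<lambda>x. g x \<in> ?C)"
      by (intro decidable_query comp_g computable_intros)
    ultimately show ?thesis unfolding Zero_Jump_def degree_zero_jump_def turing_le_iff g by blast
  qed
  moreover have "Creative pred_lang T"
  proof -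
    obtain S where S: "\<And>X f g. computable X f \<Longrightarrow> computable X g \<Longrightarrow> computable X (\<lambda>x. S (f x) (g x))"
      "\<And>e c z. z \<in> W (S e c) \<longleftrightarrow> prod_encode (z, c) \<in> W e"
      using smn by metis
    have "re_set {u. g (left u) \<in> W (right u)}" unfolding W_stage
      by (intro re_setI computable_intros comp_g)
    then obtain d where d: "W d = {u. g (left u) \<in> W (right u)}" unfolding re_set_def by auto
    \<comment> \<open>\<open>S d e\<close> is an index of the preimage of \<open>W e\<close> under \<open>g\<close>, and the halting set is
      creative via the identity.\<close>
    have pre: "z \<in> W (S d e) \<longleftrightarrow> g z \<in> W e" for z e by (simp add: S(2) d)
    have "g (S d e) \<notin> ?C \<union> W e" if "W e \<inter> ?C = {}" for e
    proof -
      have "g (S d e) \<in> W e \<longleftrightarrow> g (S d e) \<in> ?C" using pre g by (simp add: halting_set_def)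
      with that show ?thesis by blast
    qed
    moreover have "recursive_fun 1 (\<lambda>xs. g (S d (hd xs)))"
      unfolding recursive_fun_1_iff by (simp, intro comp_g S(1) computable_intros)
    moreover have "re_set ?C" unfolding T_def
      by (intro re_set_theorem_codes disjoint_sides_double re)
    ultimately show ?thesis unfolding Creative_def creative_set_def
      by (intro conjI exI[of _ "\<lambda>xs. g (S d (hd xs))"]) auto
  qed
  moreover have "extends (lit_theory (range double)) T"
    unfolding extends_def T_def by (auto simp: lit_theory_def intro: weaken)
  ultimately show ?thesis using not_EU_if_extends by blast
qed

lemma EU_not_representable:
  fixes T defines "T \<equiv> insert (Eq (num 0) (num 2)) (insert (Neg (Eq (num 0) (num 1))) (lit ` low_set))"
  shows "con_re_theory pred_lang T \<and> EU pred_lang T \<and> \<not> REW pred_lang T \<and> \<not> RFD pred_lang T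
    \<and> \<not> RSS pred_lang T \<and> \<not> RSW pred_lang T"
proof -
  have "\<not> T \<turnstile> Fls"
  proof
    \<comment> \<open>Two elements, with zero as \<open>False\<close> and the successor as negation,
      give \<open>0 = 2 \<noteq> 1\<close>. The predicates do not depend on their argument, so the
      literals are free to follow \<open>low_set\<close>.\<close>
    let ?I = "\<lambda>f ds. f \<noteq> 0 \<and> \<not> hd ds"
    let ?R = "\<lambda>r _. 2 * r \<in> low_set"
    have lit: "sat ?I ?R env (lit n)" if "n \<in> low_set" for n env
      using that low_set_disjoint[of "n div 2"] by (cases "even n") (auto simp: lit_def elim!: oddE)
    have "sat ?I ?R env \<gamma>" if "\<gamma> \<in> T" for \<gamma> env
      using that unfolding T_def
    proof (elim insertE imageE)
      fix n assume "\<gamma> = lit n" "n \<in> low_set"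
      then show ?thesis using lit by blast
    qed (simp_all add: numeral_2_eq_2)
    moreover assume "T \<turnstile> Fls"
    ultimately show False using soundness[of T Fls ?I ?R "\<lambda>_. False"] by simp
  qed
  moreover have "sentence pred_lang \<phi>" if "\<phi> \<in> T" for \<phi>
    using that tm_in_num[OF has_numerals_pred_lang]
    by (auto simp: T_def sentence_lit simp del: num.simps)
  moreover have "re_set (fm_code ` T)"
    unfolding T_def image_insert by (intro re_set_insert re_set_lit_codes re_set_low_set)
  ultimately have con: "con_re_theory pred_lang T"
    unfolding con_re_theory_def re_theory_def consistent_def using recursive_lang_pred_lang by blast
  have EU: "EU pred_lang T"
    by (rule inseparable_imp_EU[OF low_set_inseparable]) (auto simp: T_def)
  have "T \<turnstile> Eq (num 0) (num 2)" by (rule assm) (simp add: T_def)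
  then have same: "T \<turnstile> inst (num 2) \<phi>" if "T \<turnstile> inst (num 0) \<phi>" for \<phi>
    using that by (rule eq_elim)
  have rec: "recursive_set {0}"
    unfolding recursive_set_iff by (simp, intro computable_intros)
  have "\<not> weakly_representable pred_lang T {0}"
  proof
    assume "weakly_representable pred_lang T {0}"
    then obtain \<phi> where \<phi>: "\<And>n. n \<in> {0} \<longleftrightarrow> T \<turnstile> inst (num n) \<phi>"
      unfolding weakly_representable_def by blast
    have "2 \<in> {0::nat}" unfolding \<phi> by (rule same, unfold \<phi>[symmetric]) simp
    then show False by simp
  qed
  moreover have "re_set {0}" using rec decidable_imp_re_set unfolding recursive_set_iff by blast
  ultimately have "\<not> RSW pred_lang T" "\<not> REW pred_lang T"
    using rec unfolding RSW_def REW_def by blast+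
  moreover have RSS: "\<not> RSS pred_lang T"
  proof
    assume "RSS pred_lang T"
    then obtain \<phi> where \<phi>: "\<And>n. n \<in> {0} \<Longrightarrow> T \<turnstile> inst (num n) \<phi>"
      "\<And>n. n \<notin> {0} \<Longrightarrow> T \<turnstile> Neg (inst (num n) \<phi>)"
      using rec unfolding RSS_def strongly_representable_def by blast
    have "T \<turnstile> Neg (inst (num 2) \<phi>)" by (rule \<phi>(2)) simp
    moreover have "T \<turnstile> inst (num 2) \<phi>" by (rule same[OF \<phi>(1)]) simp
    ultimately have "T \<turnstile> Fls" by (rule imp_elim)
    then show False using con unfolding con_re_theory_def consistent_def by blast
  qed
  \<comment> \<open>This axiom is what excludes \<open>RFD\<close>: with a single element every
    function would be defined by \<open>y = y\<close>.\<close>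
  moreover have "T \<turnstile> Neg (Eq (num 0) (num 1))" by (rule assm) (simp add: T_def)
  then have "\<not> RFD pred_lang T"
    using RFD_imp_RSS[OF has_numerals_pred_lang] RSS by blast
  ultimately show ?thesis using con EU by blast
qed

lemma REW_RSW_not_EU:
  fixes T defines "T \<equiv> {Rel e [num n] |e n. n \<in> W e}"
  shows "con_re_theory pred_lang T \<and> REW pred_lang T \<and> RSW pred_lang T \<and> \<not> EU pred_lang T"
proof -
  \<comment> \<open>In the standard numbers with \<open>Rel e\<close> read as \<open>W e\<close>, an
    atom \<open>Rel e [num n]\<close> holds only if it is an axiom, so no other atom of this form is
    provable.\<close>
  let ?I = "\<lambda>f ds. if f = 0 then 0 else Suc (hd ds)"
  let ?R = "\<lambda>r ds. hd ds \<in> W r"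
  have evt_num: "evt ?I env (num n) = n" for env n by (induction n) auto
  have model: "sat ?I ?R env \<phi>" if "T \<turnstile> \<phi>" for \<phi> env
    by (rule soundness[OF that]) (auto simp: T_def evt_num)
  have sentence: "sentence pred_lang \<phi>" if "\<phi> \<in> T" for \<phi>
    using that tm_in_num[OF has_numerals_pred_lang] by (auto simp: T_def)
  have "\<not> T \<turnstile> Fls" using model[of Fls] by auto
  moreover have "re_set (fm_code ` T)"
  proof -
    have "T = (\<lambda>u. Rel (right u) [num (left u)]) ` {u. left u \<in> W (right u)}"
      unfolding T_def by (auto intro!: image_eqI[of _ _ "prod_encode (_, _)"])
    then have "fm_code ` T = (\<lambda>u. fm_code (Rel (right u) [num (left u)])) ` {u. left u \<in> W (right u)}"
      by (simp add: image_image)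
    moreover have "re_set \<dots>"
      by (rule re_set_image[OF re_set_W_pairs]) (simp, intro computable_intros)
    ultimately show ?thesis by simp
  qed
  ultimately have "con_re_theory pred_lang T"
    unfolding con_re_theory_def re_theory_def consistent_def
    using recursive_lang_pred_lang sentence by blast
  moreover have REW: "REW pred_lang T"
    unfolding REW_def
  proof (intro allI impI)
    fix A assume "re_set A"
    then obtain e where A: "A = W e" unfolding re_set_def by blast
    have "n \<in> W e \<longleftrightarrow> T \<turnstile> inst (num n) (Rel e [Var 0])" for n
    proof
      assume "n \<in> W e"
      then show "T \<turnstile> inst (num n) (Rel e [Var 0])" by (intro assm) (auto simp: inst_def T_def)
    next
      assume "T \<turnstile> inst (num n) (Rel e [Var 0])"
      from model[OF this] show "n \<in> W e" by (simp add: inst_def evt_num)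
    qed
    moreover have "fm_in pred_lang 1 (Rel e [Var 0])" by simp
    ultimately show "weakly_representable pred_lang T A"
      unfolding weakly_representable_def A by blast
  qed
  moreover have "RSW pred_lang T"
    using REW decidable_imp_re_set unfolding RSW_def REW_def recursive_set_iff by blast
  moreover have "extends (lit_theory (range double)) T"
  proof (rule extendsI[OF _ lift_lit_theory])
    fix \<phi> assume \<phi>: "\<phi> \<in> T"
    then show "lift \<phi> = \<phi>" using sentence lift_sentence by blast
    obtain e n where e: "\<phi> = Rel e [num n]" using \<phi> by (auto simp: T_def)
    have "lit (double e) \<in> lit_theory (range double)" by (simp add: lit_theory_def)
    then have "lit_theory (range double) \<turnstile> Rel e [num 0]"
      using assm by (simp add: lit_def)
    \<comment> \<open>The one-element axiom turns the atom at 0 into the atom at every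
      numeral.\<close>
    then show "lit_theory (range double) \<turnstile> \<phi>"
      unfolding e by (rule one_element_Rel[rotated]) (simp add: lit_theory_def)
  qed
  ultimately show ?thesis using not_EU_if_extends by blast
qed

text \<open>For \<open>RFD\<close> the inequality of numerals is a genuine restriction:
  \<open>lit_theory (range double)\<close> proves all elements equal, so every function is definable
  in it, yet it is decidable.\<close>

theorem theorem7p2:
  "(\<exists>L T. con_re_theory L T \<and> EU L T \<and> \<not> Creative L T)
 \<and> (\<exists>L T. con_re_theory L T \<and> Creative L T \<and> \<not> EU L T)
 \<and> (\<exists>L T. con_re_theory L T \<and> EU L T \<and> \<not> Zero_Jump L T)
 \<and> (\<exists>L T. con_re_theory L T \<and> Zero_Jump L T \<and> \<not> EU L T)
 \<and> (\<exists>L T. con_re_theory L T \<and> has_numerals L \<and> EU L T \<and> \<not> REW L T)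
 \<and> (\<exists>L T. con_re_theory L T \<and> has_numerals L \<and> REW L T \<and> \<not> EU L T)
 \<and> (\<exists>L T. con_re_theory L T \<and> has_numerals L \<and> EU L T \<and> \<not> RFD L T)
 \<and> (\<exists>L T. con_re_theory L T \<and> has_numerals L \<and> EU L T \<and> \<not> RSS L T)
 \<and> (\<exists>L T. con_re_theory L T \<and> has_numerals L \<and> EU L T \<and> \<not> RSW L T)
 \<and> (\<forall>L T. con_re_theory L T \<and> has_numerals L \<and> RFD L T
        \<and> T \<turnstile> Neg (Eq (num 0) (num 1)) \<longrightarrow> EU L T)
 \<and> (\<forall>L T. con_re_theory L T \<and> has_numerals L \<and> RSS L T \<longrightarrow> EU L T)
 \<and> (\<exists>L T. con_re_theory L T \<and> has_numerals L \<and> RSW L T \<and> \<not> EU L T)"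
  using EU_not_Zero_Jump_not_Creative Zero_Jump_Creative_not_EU EU_not_representable REW_RSW_not_EU
    has_numerals_pred_lang RSS_imp_EU RFD_imp_RSS
  by (intro conjI) blast+

end
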